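(* Let $H\in(0,\frac12)$ and $T>0$, and let $b:[0,T]\times\mathbb{R}\to\mathbb{R}$ be Borel measurable such that (i) there is a constant $K>0$ with $|b(t,x)-b(t,y)|\le K|x-y|$ for all $x,y\in\mathbb{R}$, $t\in[0,T]$, and (ii) $t\mapsto b(t,0)$ is bounded on $[0,T]$. Let $P_Tf(x)=\mathbb{E}f(X_T^x)$, where $X^x$ is the solution of $dX_t=b(t,X_t)\,dt+dB_t^H$, $X_0=x$. Let $\mu$ be a probability measure on $\mathbb{R}$ such that $\mu(P_Tg)\le\mu(g)$ for all nonnegative bounded measurable $g:\mathbb{R}\to\mathbb{R}$. Then for every nonnegative bounded measurable $f:\mathbb{R}\to\mathbb{R}$ with $\mu(f)=1$, $$\mu\left(P_T^*f\,\log P_T^*f\right)\le C(T,K,H)\,W_2^2(\mu,f\mu),$$ where $P_T^*$ is the adjoint operator of $P_T$ in $L^2(\mu)$ and $$C(T,K,H)=\left(\frac{\mathrm{B}(\frac32-H,\frac12-H)}{\Gamma(\frac12-H)}\right)^2\frac{T^{2-2H}}{K^{-2}(1-e^{-2KT})^2(1-H)}.$$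
   Context: $\mu(g)=\int g\,d\mu$; $f\mu$ is the probability measure with density $f$ with respect to $\mu$; the convention $0\log0=0$ is used. $W_2$ is the $L^2$-Wasserstein distance for the Euclidean distance: $W_2^2(\mu,\nu)=\inf_{\pi\in\mathscr{C}(\mu,\nu)}\int_{\mathbb{R}}\int_{\mathbb{R}}|x-y|^2\,\pi(dx,dy)$, where $\mathscr{C}(\mu,\nu)$ is the set of all couplings of $\mu$ and $\nu$ (possibly $W_2=\infty$). $\Gamma$ is the Gamma function and $\mathrm{B}(\cdot,\cdot)$ is the Euler Beta function. $B^H=(B^H_t)_{t\in[0,T]}$ is a fractional Brownian motion with Hurst parameter $H$, with the normalization given by the integral representation $B^H_t=\int_0^tK_H(t,s)\,dW_s$, where $W$ is a standard one-dimensional Wiener process and, for $0<s<t\le T$, $$K_H(t,s)=\Gamma(H+\tfrac12)^{-1}(t-s)^{H-\frac12}F\left(H-\tfrac12,\tfrac12-H,H+\tfrac12,1-\tfrac ts\right),$$ $F$ being the Gauss hypergeometric function (analytically continued). Thus $B^H$ is a centered Gaussian process with covariance $\mathbb{E}(B^H_tB^H_s)=\int_0^{t\wedge s}K_H(t,r)K_H(s,r)\,dr$, which is proportional to $t^{2H}+s^{2H}-|t-s|^{2H}$. A solution $X^x$ of the equation is a continuous adapted process with $X^x_t=x+\int_0^tb(s,X^x_s)\,ds+B^H_t$ for $t\in[0,T]$; under the stated hypotheses on $b$ there is a unique (strong) solution. *)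

theory Defs
  imports "HOL-Probability.Probability" "HOL-Complex_Analysis.Complex_Analysis"
begin

(* The holomorphic function on the plane slit along [1, infinity) that extends the
   hypergeometric series; it is unique because the slit plane is connected. *)
definition gauss_hypergeometric :: "complex \<Rightarrow> complex \<Rightarrow> complex \<Rightarrow> complex \<Rightarrow> complex" where
  "gauss_hypergeometric a b c z =
    (SOME f. f holomorphic_on (- (complex_of_real ` {1..})) \<and>
       (\<forall>w\<in>ball 0 1.
          (\<lambda>n. pochhammer a n * pochhammer b n / (pochhammer c n * fact n) * w ^ n) sums f w)) z"

(* The parameters and the argument are real, and so is the value. For 0 < s < t the
   argument 1 - t/s is negative, hence off the slit, but it may lie outside the unit disc. *)
definition fbm_kernel :: "real \<Rightarrow> real \<Rightarrow> real \<Rightarrow> real" where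
  "fbm_kernel H t s =
    (if 0 < s \<and> s < t
     then inverse (Gamma (H + 1/2)) * (t - s) powr (H - 1/2) *
          Re (gauss_hypergeometric (of_real (H - 1/2)) (of_real (1/2 - H)) (of_real (H + 1/2))
                (of_real (1 - t / s)))
     else 0)"

definition filtered_prob_space :: "'a measure \<Rightarrow> (real \<Rightarrow> 'a measure) \<Rightarrow> real \<Rightarrow> bool" where
  "filtered_prob_space M F T \<longleftrightarrow>
     prob_space M \<and>
     (\<forall>t\<in>{0..T}. subalgebra M (F t)) \<and>
     (\<forall>s t. 0 \<le> s \<and> s \<le> t \<and> t \<le> T \<longrightarrow> sets (F s) \<subseteq> sets (F t))"

definition adapted :: "(real \<Rightarrow> 'a measure) \<Rightarrow> real \<Rightarrow> (real \<Rightarrow> 'a \<Rightarrow> real) \<Rightarrow> bool" where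
  "adapted F T Z \<longleftrightarrow> (\<forall>t\<in>{0..T}. Z t \<in> borel_measurable (F t))"

definition continuous_paths :: "'a measure \<Rightarrow> real \<Rightarrow> (real \<Rightarrow> 'a \<Rightarrow> real) \<Rightarrow> bool" where
  "continuous_paths M T Z \<longleftrightarrow> (AE \<omega> in M. continuous_on {0..T} (\<lambda>t. Z t \<omega>))"

definition wiener_process ::
  "'a measure \<Rightarrow> (real \<Rightarrow> 'a measure) \<Rightarrow> real \<Rightarrow> (real \<Rightarrow> 'a \<Rightarrow> real) \<Rightarrow> bool" where
  "wiener_process M F T W \<longleftrightarrow>
     adapted F T W \<and> continuous_paths M T W \<and> (AE \<omega> in M. W 0 \<omega> = 0) \<and>
     (\<forall>s t. 0 \<le> s \<and> s < t \<and> t \<le> T \<longrightarrow>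
        distributed M lborel (\<lambda>\<omega>. W t \<omega> - W s \<omega>) (normal_density 0 (sqrt (t - s))) \<and>
        prob_space.indep_set M (sets (F s))
          {(\<lambda>\<omega>. W t \<omega> - W s \<omega>) -` A \<inter> space M |A. A \<in> sets borel})"

(* A step function, i.e. a sum of terms c * indicator (a, b], is coded by the list of its
   triples (c, a, b). *)
definition step_fun :: "(real \<times> real \<times> real) list \<Rightarrow> real \<Rightarrow> real" where
  "step_fun \<phi> s = (\<Sum>(c, a, b)\<leftarrow>\<phi>. c * indicator {a<..b} s)"

definition step_integral ::
  "(real \<Rightarrow> 'a \<Rightarrow> real) \<Rightarrow> (real \<times> real \<times> real) list \<Rightarrow> 'a \<Rightarrow> real" where
  "step_integral W \<phi> \<omega> = (\<Sum>(c, a, b)\<leftarrow>\<phi>. c * (W b \<omega> - W a \<omega>))"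

(* Y is (a version of) the integral of the deterministic function g against dW over [0, t]:
   the limit in L^2(M) of the integrals of step functions converging to g in L^2([0, t]). *)
definition has_wiener_integral ::
  "'a measure \<Rightarrow> (real \<Rightarrow> 'a \<Rightarrow> real) \<Rightarrow> real \<Rightarrow> (real \<Rightarrow> real) \<Rightarrow> ('a \<Rightarrow> real) \<Rightarrow> bool" where
  "has_wiener_integral M W t g Y \<longleftrightarrow>
     set_borel_measurable lborel {0..t} g \<and> Y \<in> borel_measurable M \<and>
     (\<exists>\<phi> :: nat \<Rightarrow> (real \<times> real \<times> real) list.
        (\<forall>n. \<forall>(c, a, b)\<in>set (\<phi> n). 0 \<le> a \<and> a \<le> b \<and> b \<le> t) \<and>
        (\<lambda>n. \<integral>\<^sup>+s\<in>{0..t}. ennreal ((g s - step_fun (\<phi> n) s)\<^sup>2) \<partial>lborel) \<longlonglongrightarrow> 0 \<and>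
        (\<lambda>n. \<integral>\<^sup>+\<omega>. ennreal ((Y \<omega> - step_integral W (\<phi> n) \<omega>)\<^sup>2) \<partial>M) \<longlonglongrightarrow> 0)"

definition fractional_brownian_motion ::
  "'a measure \<Rightarrow> (real \<Rightarrow> 'a measure) \<Rightarrow> real \<Rightarrow> real \<Rightarrow> (real \<Rightarrow> 'a \<Rightarrow> real) \<Rightarrow>
   (real \<Rightarrow> 'a \<Rightarrow> real) \<Rightarrow> bool" where
  "fractional_brownian_motion M F T H W B \<longleftrightarrow>
     wiener_process M F T W \<and> continuous_paths M T B \<and>
     (\<forall>t\<in>{0..T}. has_wiener_integral M W t (fbm_kernel H t) (B t))"

definition sde_solution ::
  "'a measure \<Rightarrow> (real \<Rightarrow> 'a measure) \<Rightarrow> real \<Rightarrow> (real \<Rightarrow> real \<Rightarrow> real) \<Rightarrow>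
   (real \<Rightarrow> 'a \<Rightarrow> real) \<Rightarrow> real \<Rightarrow> (real \<Rightarrow> 'a \<Rightarrow> real) \<Rightarrow> bool" where
  "sde_solution M F T b B x X \<longleftrightarrow>
     adapted F T X \<and> continuous_paths M T X \<and>
     (AE \<omega> in M. \<forall>t\<in>{0..T}.
        X t \<omega> = x + (LINT s:{0..t}|lborel. b s (X s \<omega>)) + B t \<omega>)"

(* X x is the solution started at x. *)
definition transition_op ::
  "'a measure \<Rightarrow> (real \<Rightarrow> real \<Rightarrow> 'a \<Rightarrow> real) \<Rightarrow> real \<Rightarrow> (real \<Rightarrow> real) \<Rightarrow> real \<Rightarrow> real" where
  "transition_op M X T g x = (\<integral>\<omega>. g (X x T \<omega>) \<partial>M)"

definition L2_fun :: "real measure \<Rightarrow> (real \<Rightarrow> real) set" where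
  "L2_fun \<mu> = {g. g \<in> borel_measurable \<mu> \<and> integrable \<mu> (\<lambda>x. (g x)\<^sup>2)}"

(* A representative of the adjoint applied to f; it is determined up to a \<mu>-null set. *)
definition L2_adjoint ::
  "real measure \<Rightarrow> ((real \<Rightarrow> real) \<Rightarrow> real \<Rightarrow> real) \<Rightarrow> (real \<Rightarrow> real) \<Rightarrow> real \<Rightarrow> real" where
  "L2_adjoint \<mu> P f =
     (SOME h. h \<in> L2_fun \<mu> \<and>
        (\<forall>g\<in>L2_fun \<mu>. (\<integral>x. h x * g x \<partial>\<mu>) = (\<integral>x. f x * P g x \<partial>\<mu>)))"

definition couplings :: "real measure \<Rightarrow> real measure \<Rightarrow> (real \<times> real) measure set" where
  "couplings \<mu> \<nu> =
     {\<pi>. sets \<pi> = sets (borel \<Otimes>\<^sub>M borel) \<and> distr \<pi> borel fst = \<mu> \<and> distr \<pi> borel snd = \<nu>}"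

definition wasserstein2_sq :: "real measure \<Rightarrow> real measure \<Rightarrow> ennreal" where
  "wasserstein2_sq \<mu> \<nu> =
     (INF \<pi>\<in>couplings \<mu> \<nu>. \<integral>\<^sup>+p. ennreal (\<bar>fst p - snd p\<bar>\<^sup>2) \<partial>\<pi>)"

end

theory Submission
  imports Defs
begin

text \<open>
  The inequality is the integrated form of the log-Harnack inequality
  \<open>P (ln g) y \<le> ln (P g x) + C * (x - y)\<^sup>2\<close> for \<open>P = P\<^sub>T\<close>, with \<open>C\<close> the constant of the theorem.
  Sub-invariance of \<open>\<mu>\<close>, applied to a set and to its complement, is invariance. Let \<open>h\<close> be the
  adjoint applied to \<open>f\<close>; testing it with indicators shows \<open>0 \<le> h \<le> sup f\<close>. For a coupling \<open>\<pi>\<close> of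
  \<open>\<mu>\<close> and \<open>f\<mu>\<close> and for \<open>g = h + \<epsilon>\<close>, the integral of \<open>h * ln h\<close> is at most that of \<open>h * ln g\<close>, which
  is the \<open>f\<mu>\<close>-integral of \<open>P (ln g)\<close>, that is, the \<open>\<pi>\<close>-integral of \<open>P (ln g) y\<close>. By the log-Harnack
  inequality this is at most the \<open>\<mu>\<close>-integral of \<open>ln (P g)\<close> plus \<open>C\<close> times the transport cost, and
  by Jensen's inequality and invariance the former is at most \<open>ln (1 + \<epsilon>)\<close>. Let \<open>\<epsilon>\<close> tend to 0 and
  take the infimum over \<open>\<pi>\<close> (lemma \<open>entropy_cost\<close>).

  For the log-Harnack inequality let \<open>Y\<close> be the solution started at \<open>y\<close>. The process
  \<open>Z t = Y t + (1 - t / T) * (x - y)\<close> starts at \<open>x\<close>, ends at \<open>Y T\<close>, and solves the equation driven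
  by \<open>B\<close> plus the primitive of \<open>u = b(Y) - b(Z) - (x - y) / T\<close>, where \<open>\<bar>u\<bar> \<le> (K + 1 / T) * \<bar>x - y\<bar>\<close>.
  Since \<open>B\<close> is a Wiener integral, this driving path is obtained by adding a drift with density \<open>v\<close>
  to \<open>W\<close>, provided that the kernel of \<open>B\<close> maps \<open>v\<close> to the primitive of \<open>u\<close>; the solution \<open>v\<close> is a
  weighted fractional integral of \<open>u\<close> and is bounded by a Beta integral (\<open>abs_frac_drift_le\<close>).
  The variational inequality
  \<open>E \<Psi>(W + drift) \<le> ln (E (exp \<Psi>(W))) + E (energy of the drift) / 2\<close>, where the energy is the
  integral of \<open>v\<^sup>2\<close> and \<open>\<Psi> = ln g\<close> of the terminal value, gives the log-Harnack inequality for
  continuous \<open>g\<close> (\<open>solution_entropy_bound\<close>), and approximation in \<open>L\<^sup>1\<close> extends it to Borel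
  functions (\<open>entropy_bound_borel\<close>). Its constant takes the form in the theorem because
  \<open>K + 1 / T \<le> 2 * K / (1 - exp (- 2 * K * T))\<close>.

  For finitely many Gaussian increments the variational inequality follows from the Cameron-Martin
  formula and Jensen's inequality (\<open>gaussian_drift_entropy_bound\<close>). The terminal value of a solution
  is reached from there by three limits: finer time grids, on which the drift is delayed by one
  cell so that its increments are known at the left end point (\<open>wiener_drift_entropy_bound\<close>); step
  functions approximating the kernel of \<open>B\<close> in \<open>L\<^sup>2\<close> (\<open>fractional_drift_entropy_bound\<close>); and the
  Euler scheme, which turns the solution into a limit of functionals of finitely many values of
  the driving path (\<open>euler_convergence\<close>). Every limit is an almost sure one, under which the
  inequality is stable (\<open>entropy_bound_limit\<close>).

  That the kernel maps \<open>v\<close> to the primitive of \<open>u\<close> rests on one integral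
  (\<open>nn_integral_fbm_kernel\<close>). With \<open>\<alpha> = 1/2 - H\<close> the hypergeometric function of the kernel has
  the parameters \<open>-\<alpha>, \<alpha>; 1 - \<alpha>\<close>. Since the lower parameter exceeds an upper one by 1, the function
  satisfies a first-order differential equation, which identifies its value at \<open>1 - t/s\<close> with
  \<open>(s/t) powr \<alpha>\<close> times a power series in \<open>1 - s/t\<close> with positive coefficients. Integrated term
  by term this series gives Beta integrals, and these add up to a binomial series.
\<close>

section \<open>Gaussian increments with a predictable drift\<close>

text \<open>
  Independence makes the joint law of \<open>\<omega>\<close>, seen through \<open>\<G>\<close>, and of \<open>D\<close> a product measure, so
  that Tonelli's theorem applies. The lemma takes the place of conditioning on \<open>\<G>\<close>: everything that
  is \<open>\<G>\<close>-measurable is frozen while \<open>D\<close> is averaged.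
\<close>
lemma (in prob_space) nn_integral_freeze:
  assumes sub: "subalgebra M \<G>" and D: "random_variable S D"
    and ind: "indep_set (sets \<G>) {D -` A \<inter> space M |A. A \<in> sets S}"
    and h: "(\<lambda>p. h (fst p) (snd p)) \<in> borel_measurable (\<G> \<Otimes>\<^sub>M S)"
  shows "(\<integral>\<^sup>+\<omega>. h \<omega> (D \<omega>) \<partial>M) = (\<integral>\<^sup>+\<omega>. \<integral>\<^sup>+z. h \<omega> z \<partial>distr M S D \<partial>M)"
proof -
  have sp: "space \<G> = space M" and ss: "sets \<G> \<subseteq> sets M"
    using sub by (auto simp: subalgebra_def)
  have id[measurable]: "(\<lambda>\<omega>. \<omega>) \<in> measurable M \<G>"
    using sub by (rule measurable_from_subalg) simp
  note D[measurable] h[measurable]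
  interpret Q: prob_space "distr M S D" by (rule prob_space_distr) fact
  interpret G: prob_space "distr M \<G> (\<lambda>\<omega>. \<omega>)" by (rule prob_space_distr) fact
  have prod: "distr M \<G> (\<lambda>\<omega>. \<omega>) \<Otimes>\<^sub>M distr M S D = distr M (\<G> \<Otimes>\<^sub>M S) (\<lambda>\<omega>. (\<omega>, D \<omega>))"
  proof (rule pair_measure_eqI)
    show "sigma_finite_measure (distr M \<G> (\<lambda>\<omega>. \<omega>))" "sigma_finite_measure (distr M S D)"
      by unfold_locales
    show "sets (distr M \<G> (\<lambda>\<omega>. \<omega>) \<Otimes>\<^sub>M distr M S D) = sets (distr M (\<G> \<Otimes>\<^sub>M S) (\<lambda>\<omega>. (\<omega>, D \<omega>)))"
      by (simp cong: sets_pair_measure_cong)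
    fix A B assume "A \<in> sets (distr M \<G> (\<lambda>\<omega>. \<omega>))" "B \<in> sets (distr M S D)"
    then have A: "A \<in> sets \<G>" and B: "B \<in> sets S" by simp_all
    have AM: "A \<subseteq> space M" using sets.sets_into_space[OF A] sp by simp
    have "prob (A \<inter> (D -` B \<inter> space M)) = prob A * prob (D -` B \<inter> space M)"
      using ind A B by (intro indep_setD[where A="sets \<G>"]) auto
    moreover have "(\<lambda>\<omega>. (\<omega>, D \<omega>)) -` (A \<times> B) \<inter> space M = A \<inter> (D -` B \<inter> space M)"
      "(\<lambda>\<omega>. \<omega>) -` A \<inter> space M = A"
      using AM by auto
    ultimately show "emeasure (distr M \<G> (\<lambda>\<omega>. \<omega>)) A * emeasure (distr M S D) B
        = emeasure (distr M (\<G> \<Otimes>\<^sub>M S) (\<lambda>\<omega>. (\<omega>, D \<omega>))) (A \<times> B)"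
      using A B by (simp add: emeasure_distr emeasure_eq_measure ennreal_mult'[symmetric])
  qed
  have h': "(\<lambda>p. h (fst p) (snd p)) \<in> borel_measurable (distr M \<G> (\<lambda>\<omega>. \<omega>) \<Otimes>\<^sub>M distr M S D)"
    using h by (simp cong: measurable_cong_sets sets_pair_measure_cong)
  have "(\<integral>\<^sup>+\<omega>. h \<omega> (D \<omega>) \<partial>M) = (\<integral>\<^sup>+p. h (fst p) (snd p) \<partial>distr M (\<G> \<Otimes>\<^sub>M S) (\<lambda>\<omega>. (\<omega>, D \<omega>)))"
    by (subst nn_integral_distr) simp_all
  also have "\<dots> = (\<integral>\<^sup>+p. h (fst p) (snd p) \<partial>(distr M \<G> (\<lambda>\<omega>. \<omega>) \<Otimes>\<^sub>M distr M S D))"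
    by (simp only: prod)
  also have "\<dots> = (\<integral>\<^sup>+\<omega>. \<integral>\<^sup>+z. h \<omega> z \<partial>distr M S D \<partial>distr M \<G> (\<lambda>\<omega>. \<omega>))"
    using Q.nn_integral_fst[OF h'] by simp
  also have "\<dots> = (\<integral>\<^sup>+\<omega>. \<integral>\<^sup>+z. h \<omega> z \<partial>distr M S D \<partial>M)"
    using Q.borel_measurable_nn_integral_fst[OF h'] by (subst nn_integral_distr) simp_all
  finally show ?thesis .
qed

lemma normal_density_shift_weight:
  assumes "\<sigma> > 0"
  shows "normal_density 0 \<sigma> z * exp (- (v * z / \<sigma>\<^sup>2 + v\<^sup>2 / (2 * \<sigma>\<^sup>2))) = normal_density 0 \<sigma> (z + v)"
proof -
  have "- (z - 0)\<^sup>2 / (2 * \<sigma>\<^sup>2) + - (v * z / \<sigma>\<^sup>2 + v\<^sup>2 / (2 * \<sigma>\<^sup>2)) = - (z + v - 0)\<^sup>2 / (2 * \<sigma>\<^sup>2)"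
    using assms by (simp add: field_simps power2_eq_square)
  then show ?thesis
    unfolding normal_density_def by (simp add: exp_add[symmetric])
qed

text \<open>
  The weight completes the square in the Gaussian density, which becomes its own translate by
  \<open>v\<close>; Lebesgue measure does not see the translation.
\<close>
lemma nn_integral_normal_cameron_martin:
  assumes "\<sigma> > 0" and [measurable]: "g \<in> borel_measurable borel"
  shows "(\<integral>\<^sup>+z. ennreal (exp (- (v * z / \<sigma>\<^sup>2 + v\<^sup>2 / (2 * \<sigma>\<^sup>2)))) * g (z + v) \<partial>density lborel (normal_density 0 \<sigma>))
       = (\<integral>\<^sup>+z. g z \<partial>density lborel (normal_density 0 \<sigma>))"
proof -
  have "(\<integral>\<^sup>+z. ennreal (exp (- (v * z / \<sigma>\<^sup>2 + v\<^sup>2 / (2 * \<sigma>\<^sup>2)))) * g (z + v) \<partial>density lborel (normal_density 0 \<sigma>))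
      = (\<integral>\<^sup>+z. ennreal (normal_density 0 \<sigma> (z + v)) * g (z + v) \<partial>lborel)"
    by (subst nn_integral_density)
       (auto simp: mult.assoc[symmetric] ennreal_mult[symmetric] normal_density_shift_weight[OF assms(1)]
          simp del: minus_add_distrib)
  also have "\<dots> = (\<integral>\<^sup>+z. ennreal (normal_density 0 \<sigma> z) * g z \<partial>distr lborel borel (\<lambda>z. v + z))"
    by (subst nn_integral_distr) (simp_all add: add.commute)
  also have "\<dots> = (\<integral>\<^sup>+z. ennreal (normal_density 0 \<sigma> z) * g z \<partial>lborel)"
    by (simp only: lborel_distr_plus)
  also have "\<dots> = (\<integral>\<^sup>+z. g z \<partial>density lborel (normal_density 0 \<sigma>))"
    by (subst nn_integral_density) simp_all
  finally show ?thesis .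
qed

text \<open>
  Induction on the number of increments. In the last step everything up to time \<open>n\<close>, including
  \<open>V n\<close>, is frozen and the last increment is integrated out. The Cameron-Martin formula removes
  the drift \<open>V n\<close> and leaves a functional of the path up to time \<open>n\<close>, to which the induction
  hypothesis applies. Paths are elements of the product over all natural numbers that vanish
  beyond \<open>n\<close>, so that appending a value is a function update.
\<close>
lemma (in prob_space) discrete_girsanov:
  fixes w V :: "nat \<Rightarrow> 'a \<Rightarrow> real"
  assumes \<sigma>: "\<sigma> > 0"
    and sub: "\<And>i. i \<le> N \<Longrightarrow> subalgebra M (\<G> i)"
    and mono: "\<And>i j. i \<le> j \<Longrightarrow> j \<le> N \<Longrightarrow> sets (\<G> i) \<subseteq> sets (\<G> j)"
    and w: "\<And>i. i \<le> N \<Longrightarrow> w i \<in> borel_measurable (\<G> i)"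
    and V: "\<And>i. i < N \<Longrightarrow> V i \<in> borel_measurable (\<G> i)"
    and D: "\<And>i. i < N \<Longrightarrow> distributed M lborel (\<lambda>\<omega>. w (Suc i) \<omega> - w i \<omega>) (normal_density 0 \<sigma>)"
    and ind: "\<And>i. i < N \<Longrightarrow> indep_set (sets (\<G> i))
          {(\<lambda>\<omega>. w (Suc i) \<omega> - w i \<omega>) -` A \<inter> space M |A. A \<in> sets borel}"
    and n: "n \<le> N"
    and G: "G \<in> borel_measurable (PiM UNIV (\<lambda>_::nat. borel :: real measure))"
  shows "(\<integral>\<^sup>+\<omega>. ennreal (exp (- (\<Sum>i<n. V i \<omega> * (w (Suc i) \<omega> - w i \<omega>) / \<sigma>\<^sup>2 + (V i \<omega>)\<^sup>2 / (2 * \<sigma>\<^sup>2)))) *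
            G (\<lambda>i. if i \<le> n then w i \<omega> + (\<Sum>j<i. V j \<omega>) else 0) \<partial>M)
       = (\<integral>\<^sup>+\<omega>. G (\<lambda>i. if i \<le> n then w i \<omega> else 0) \<partial>M)"
  using n G
proof (induction n arbitrary: G)
  case 0
  have "(\<lambda>i. if i \<le> 0 then w i \<omega> + (\<Sum>j<i. V j \<omega>) else 0) = (\<lambda>i. if i \<le> 0 then w i \<omega> else 0)" for \<omega>
    by (auto simp: fun_eq_iff)
  then show ?case by simp
next
  case (Suc n G)
  let ?PiM = "PiM UNIV (\<lambda>_::nat. borel :: real measure)"
  let ?N = "density lborel (normal_density 0 \<sigma>)"
  let ?D = "\<lambda>\<omega>. w (Suc n) \<omega> - w n \<omega>"
  define S where "S \<omega> = (\<Sum>i<n. V i \<omega> * (w (Suc i) \<omega> - w i \<omega>) / \<sigma>\<^sup>2 + (V i \<omega>)\<^sup>2 / (2 * \<sigma>\<^sup>2))" for \<omega>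
  define y where "y \<omega> = (\<lambda>i. if i \<le> n then w i \<omega> + (\<Sum>j<i. V j \<omega>) else 0)" for \<omega>
  define x where "x \<omega> = (\<lambda>i. if i \<le> n then w i \<omega> else 0)" for \<omega>
  define G' where "G' p = (\<integral>\<^sup>+z. G (p(Suc n := p n + z)) \<partial>?N)" for p
  have n: "n < N" using Suc.prems by simp
  note Gm[measurable] = Suc.prems(2)
  have up: "f \<in> borel_measurable (\<G> n)" if "f \<in> borel_measurable (\<G> i)" "i \<le> n" for i and f :: "'a \<Rightarrow> real"
  proof -
    have "space (\<G> n) = space (\<G> i)" using sub[of n] sub[of i] n that(2) by (simp add: subalgebra_def)
    then have "subalgebra (\<G> n) (\<G> i)"
      using mono[of i n] n that(2) by (simp add: subalgebra_def)
    from measurable_from_subalg[OF this that(1)] show ?thesis .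
  qed
  have wm: "w i \<in> borel_measurable (\<G> n)" if "i \<le> n" for i
    using up[OF w[of i] that] n that by simp
  have Vm: "V i \<in> borel_measurable (\<G> n)" if "i \<le> n" for i
    using up[OF V[of i] that] n that by simp
  have [measurable]: "V n \<in> borel_measurable (\<G> n)" by (rule Vm) simp
  have Sm[measurable]: "S \<in> borel_measurable (\<G> n)"
    unfolding S_def using wm Vm by (intro borel_measurable_sum borel_measurable_add borel_measurable_divide
      borel_measurable_times borel_measurable_diff borel_measurable_power) auto
  have ym[measurable]: "y \<in> measurable (\<G> n) ?PiM"
  proof -
    have "(\<lambda>\<omega>. y \<omega> i) \<in> borel_measurable (\<G> n)" for i
      unfolding y_def using wm Vm by (cases "i \<le> n") (auto intro!: borel_measurable_add borel_measurable_sum)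
    then show ?thesis by (intro measurable_PiM_single'[where f="\<lambda>i \<omega>. y \<omega> i"]) auto
  qed
  have xm[measurable]: "x \<in> measurable (\<G> n) ?PiM"
  proof -
    have "(\<lambda>\<omega>. x \<omega> i) \<in> borel_measurable (\<G> n)" for i
      unfolding x_def using wm by (cases "i \<le> n") auto
    then show ?thesis by (intro measurable_PiM_single'[where f="\<lambda>i \<omega>. x \<omega> i"]) auto
  qed
  have comp[measurable]: "(\<lambda>p. p n) \<in> borel_measurable ?PiM"
    by (rule measurable_component_singleton) simp
  have upd: "(\<lambda>q. G ((f q)(Suc n := g q))) \<in> borel_measurable K"
    if "f \<in> measurable K ?PiM" "g \<in> borel_measurable K" for f and g :: "_ \<Rightarrow> real" and K
    using measurable_compose[OF measurable_fun_upd[OF _ that, of UNIV "Suc n"] Gm] by (simp add: fun_upd_def)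
  interpret N: prob_space ?N by (rule prob_space_normal_density) fact
  have G'm: "G' \<in> borel_measurable ?PiM"
    unfolding G'_def by (intro N.borel_measurable_nn_integral) (auto simp: case_prod_beta' intro!: upd)
  have rv: "random_variable borel ?D"
    using D[OF n] by (simp add: distributed_def measurable_lborel1)
  have dist: "distr M borel ?D = ?N"
    using D[OF n] unfolding distributed_def
    by (metis (no_types, lifting) distr_cong sets_lborel)
  \<comment> \<open>In \<open>h1\<close> and \<open>h2\<close> the last increment is replaced by a free variable \<open>z\<close>.\<close>
  define h1 where "h1 \<omega> z = ennreal (exp (- S \<omega>)) *
      (ennreal (exp (- (V n \<omega> * z / \<sigma>\<^sup>2 + (V n \<omega>)\<^sup>2 / (2 * \<sigma>\<^sup>2)))) * G ((y \<omega>)(Suc n := y \<omega> n + (z + V n \<omega>))))" for \<omega> z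
  define h2 where "h2 \<omega> z = G ((x \<omega>)(Suc n := x \<omega> n + z))" for \<omega> z
  have h1m: "(\<lambda>p. h1 (fst p) (snd p)) \<in> borel_measurable (\<G> n \<Otimes>\<^sub>M borel)"
    unfolding h1_def by (intro borel_measurable_times_ennreal upd) simp_all
  have h2m: "(\<lambda>p. h2 (fst p) (snd p)) \<in> borel_measurable (\<G> n \<Otimes>\<^sub>M borel)"
    unfolding h2_def by (intro upd) simp_all
  have "(\<integral>\<^sup>+\<omega>. ennreal (exp (- (\<Sum>i<Suc n. V i \<omega> * (w (Suc i) \<omega> - w i \<omega>) / \<sigma>\<^sup>2 + (V i \<omega>)\<^sup>2 / (2 * \<sigma>\<^sup>2)))) *
            G (\<lambda>i. if i \<le> Suc n then w i \<omega> + (\<Sum>j<i. V j \<omega>) else 0) \<partial>M)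
     = (\<integral>\<^sup>+\<omega>. h1 \<omega> (?D \<omega>) \<partial>M)"
  proof (rule nn_integral_cong)
    fix \<omega>
    have 1: "(\<lambda>i. if i \<le> Suc n then w i \<omega> + (\<Sum>j<i. V j \<omega>) else 0) = (y \<omega>)(Suc n := y \<omega> n + (?D \<omega> + V n \<omega>))"
      by (auto simp: y_def fun_eq_iff le_Suc_eq)
    have 2: "exp (- (\<Sum>i<Suc n. V i \<omega> * (w (Suc i) \<omega> - w i \<omega>) / \<sigma>\<^sup>2 + (V i \<omega>)\<^sup>2 / (2 * \<sigma>\<^sup>2)))
       = exp (- S \<omega>) * exp (- (V n \<omega> * ?D \<omega> / \<sigma>\<^sup>2 + (V n \<omega>)\<^sup>2 / (2 * \<sigma>\<^sup>2)))"
      unfolding exp_add[symmetric] S_def by simp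
    show "ennreal (exp (- (\<Sum>i<Suc n. V i \<omega> * (w (Suc i) \<omega> - w i \<omega>) / \<sigma>\<^sup>2 + (V i \<omega>)\<^sup>2 / (2 * \<sigma>\<^sup>2)))) *
            G (\<lambda>i. if i \<le> Suc n then w i \<omega> + (\<Sum>j<i. V j \<omega>) else 0) = h1 \<omega> (?D \<omega>)"
      unfolding 1 2 h1_def by (simp add: ennreal_mult mult.assoc)
  qed
  also have "\<dots> = (\<integral>\<^sup>+\<omega>. \<integral>\<^sup>+z. h1 \<omega> z \<partial>?N \<partial>M)"
    unfolding dist[symmetric]
    by (rule nn_integral_freeze[OF sub rv ind h1m]) (use n in auto)
  also have "\<dots> = (\<integral>\<^sup>+\<omega>. ennreal (exp (- S \<omega>)) * G' (y \<omega>) \<partial>M)"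
  proof (rule nn_integral_cong)
    fix \<omega>
    have m: "(\<lambda>z. G ((y \<omega>)(Suc n := y \<omega> n + z))) \<in> borel_measurable borel"
      by (rule upd) (auto simp: space_PiM)
    have "(\<integral>\<^sup>+z. h1 \<omega> z \<partial>?N) = ennreal (exp (- S \<omega>)) *
       (\<integral>\<^sup>+z. ennreal (exp (- (V n \<omega> * z / \<sigma>\<^sup>2 + (V n \<omega>)\<^sup>2 / (2 * \<sigma>\<^sup>2)))) * G ((y \<omega>)(Suc n := y \<omega> n + (z + V n \<omega>))) \<partial>?N)"
      unfolding h1_def
      by (rule nn_integral_cmult) (intro borel_measurable_times_ennreal upd, auto simp: space_PiM)
    then show "(\<integral>\<^sup>+z. h1 \<omega> z \<partial>?N) = ennreal (exp (- S \<omega>)) * G' (y \<omega>)"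
      unfolding G'_def nn_integral_normal_cameron_martin[OF \<sigma> m] .
  qed
  also have "\<dots> = (\<integral>\<^sup>+\<omega>. G' (x \<omega>) \<partial>M)"
    unfolding S_def y_def x_def using Suc.IH[OF _ G'm] n by simp
  also have "\<dots> = (\<integral>\<^sup>+\<omega>. h2 \<omega> (?D \<omega>) \<partial>M)"
    unfolding G'_def h2_def[symmetric] dist[symmetric]
    by (rule nn_integral_freeze[OF sub rv ind h2m, symmetric]) (use n in auto)
  also have "\<dots> = (\<integral>\<^sup>+\<omega>. G (\<lambda>i. if i \<le> Suc n then w i \<omega> else 0) \<partial>M)"
    unfolding h2_def x_def
    by (intro nn_integral_cong arg_cong[where f=G]) (auto simp: fun_eq_iff le_Suc_eq)
  finally show ?case .
qed

lemma (in prob_space) expectation_exp_ge: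
  fixes Y :: "'a \<Rightarrow> real"
  assumes "integrable M Y" "integrable M (\<lambda>\<omega>. exp (Y \<omega>))"
  shows "exp (expectation Y) \<le> expectation (\<lambda>\<omega>. exp (Y \<omega>))"
  by (rule jensens_inequality[where I=UNIV and q=exp and X=Y]) (use assms exp_convex in auto)

lemma (in prob_space) integral_indep_mean_zero:
  fixes V D :: "'a \<Rightarrow> real"
  assumes sub: "subalgebra M \<G>" and V: "V \<in> borel_measurable \<G>" and bd: "\<And>\<omega>. \<omega> \<in> space M \<Longrightarrow> \<bar>V \<omega>\<bar> \<le> c"
    and ind: "indep_set (sets \<G>) {D -` A \<inter> space M |A. A \<in> sets borel}"
    and D: "distributed M lborel D (normal_density 0 \<sigma>)" and \<sigma>: "\<sigma> > 0"
  shows "integrable M (\<lambda>\<omega>. V \<omega> * D \<omega>)" "(\<integral>\<omega>. V \<omega> * D \<omega> \<partial>M) = 0"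
proof -
  have Vm: "random_variable borel V" using measurable_from_subalg[OF sub V] .
  have Dm: "random_variable borel D" using D by (simp add: distributed_def measurable_lborel1)
  have sp: "space \<G> = space M" using sub by (simp add: subalgebra_def)
  have iv: "indep_var borel V borel D"
  proof -
    have sv: "{V -` A \<inter> space M |A. A \<in> sets borel} \<subseteq> sets \<G>"
      using V sp by (auto simp: measurable_def)
    have "indep_set (sigma_sets (space M) {V -` A \<inter> space M |A. A \<in> sets borel})
       (sigma_sets (space M) {D -` A \<inter> space M |A. A \<in> sets borel})"
    proof (rule indep_set_sigma_sets)
      show "indep_set {V -` A \<inter> space M |A. A \<in> sets borel} {D -` A \<inter> space M |A. A \<in> sets borel}"
        unfolding indep_set_def
        by (rule indep_sets_mono_sets[OF ind[unfolded indep_set_def]]) (use sv in \<open>auto split: bool.split\<close>)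
      show "Int_stable {f -` A \<inter> space M |A. A \<in> sets borel}" for f :: "'a \<Rightarrow> real"
      proof (rule Int_stableI, clarsimp)
        fix A A' :: "real set" assume "A \<in> sets borel" "A' \<in> sets borel"
        then show "\<exists>C. f -` A \<inter> space M \<inter> (f -` A' \<inter> space M) = f -` C \<inter> space M \<and> C \<in> sets borel"
          by (intro exI[of _ "A \<inter> A'"]) auto
      qed
      then show "Int_stable {D -` A \<inter> space M |A. A \<in> sets borel}" .
    qed
    then show ?thesis unfolding indep_var_eq using Vm Dm by simp
  qed
  have iV: "integrable M V"
    by (rule integrable_const_bound[where B=c]) (use bd Vm in auto)
  have iD: "integrable M D"
  proof -
    have "integrable lborel (\<lambda>x. normal_density 0 \<sigma> x * x)"
      using integrable_normal_moment[OF \<sigma>, of 0 1] by simp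
    then show ?thesis
      using distributed_integrable[OF D, of "\<lambda>x. x"] \<sigma> by (simp add: normal_density_nonneg)
  qed
  have D0: "expectation D = 0"
    using normal_distributed_expectation[OF \<sigma> D] .
  show "integrable M (\<lambda>\<omega>. V \<omega> * D \<omega>)" by (rule indep_var_integrable[OF iv iV iD])
  show "(\<integral>\<omega>. V \<omega> * D \<omega> \<partial>M) = 0"
    using indep_var_lebesgue_integral[OF iv iV iD] D0 by simp
qed

text \<open>
  Jensen's inequality for the exponential of \<open>\<Psi>\<close> of the drifted path plus the logarithm \<open>- L\<close> of
  the Girsanov density. Changing the measure removes the drift from the expectation of this
  exponential. In the expectation of \<open>L\<close> the terms that are linear in the increments vanish by
  independence, which leaves the energy of the drift. This is the elementary half of the
  Boue-Dupuis variational formula.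
\<close>
lemma (in prob_space) gaussian_drift_entropy_bound:
  fixes w V :: "nat \<Rightarrow> 'a \<Rightarrow> real"
  assumes \<sigma>: "\<sigma> > 0"
    and sub: "\<And>i. i \<le> N \<Longrightarrow> subalgebra M (\<G> i)"
    and mono: "\<And>i j. i \<le> j \<Longrightarrow> j \<le> N \<Longrightarrow> sets (\<G> i) \<subseteq> sets (\<G> j)"
    and w: "\<And>i. i \<le> N \<Longrightarrow> w i \<in> borel_measurable (\<G> i)"
    and V: "\<And>i. i < N \<Longrightarrow> V i \<in> borel_measurable (\<G> i)"
    and D: "\<And>i. i < N \<Longrightarrow> distributed M lborel (\<lambda>\<omega>. w (Suc i) \<omega> - w i \<omega>) (normal_density 0 \<sigma>)"
    and ind: "\<And>i. i < N \<Longrightarrow> indep_set (sets (\<G> i))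
          {(\<lambda>\<omega>. w (Suc i) \<omega> - w i \<omega>) -` A \<inter> space M |A. A \<in> sets borel}"
    and bd: "\<And>i \<omega>. i < N \<Longrightarrow> \<omega> \<in> space M \<Longrightarrow> \<bar>V i \<omega>\<bar> \<le> m i"
    and \<Psi>: "\<Psi> \<in> borel_measurable (PiM UNIV (\<lambda>_::nat. borel :: real measure))" "\<And>p. \<bar>\<Psi> p\<bar> \<le> c"
  shows "expectation (\<lambda>\<omega>. \<Psi> (\<lambda>i. if i \<le> N then w i \<omega> + (\<Sum>j<i. V j \<omega>) else 0))
     \<le> ln (expectation (\<lambda>\<omega>. exp (\<Psi> (\<lambda>i. if i \<le> N then w i \<omega> else 0)))) + (\<Sum>i<N. (m i)\<^sup>2 / (2 * \<sigma>\<^sup>2))"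
proof -
  let ?PiM = "PiM UNIV (\<lambda>_::nat. borel :: real measure)"
  define D where "D i \<omega> = w (Suc i) \<omega> - w i \<omega>" for i \<omega>
  define x where "x \<omega> = (\<lambda>i. if i \<le> N then w i \<omega> else 0)" for \<omega>
  define y where "y \<omega> = (\<lambda>i. if i \<le> N then w i \<omega> + (\<Sum>j<i. V j \<omega>) else 0)" for \<omega>
  define L where "L \<omega> = (\<Sum>i<N. V i \<omega> * D i \<omega> / \<sigma>\<^sup>2 + (V i \<omega>)\<^sup>2 / (2 * \<sigma>\<^sup>2))" for \<omega>
  note \<Psi>(1)[measurable]
  have wm: "w i \<in> borel_measurable M" if "i \<le> N" for i
    using measurable_from_subalg[OF sub w, OF that that] .
  have Vm: "V i \<in> borel_measurable M" if "i < N" for i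
    using measurable_from_subalg[OF sub V, of i] that by simp
  have ym[measurable]: "y \<in> measurable M ?PiM"
  proof -
    have "(\<lambda>\<omega>. y \<omega> i) \<in> borel_measurable M" for i
      unfolding y_def using wm Vm by (cases "i \<le> N") (auto intro!: borel_measurable_add borel_measurable_sum)
    then show ?thesis by (intro measurable_PiM_single'[where f="\<lambda>i \<omega>. y \<omega> i"]) auto
  qed
  have xm[measurable]: "x \<in> measurable M ?PiM"
  proof -
    have "(\<lambda>\<omega>. x \<omega> i) \<in> borel_measurable M" for i
      unfolding x_def using wm by (cases "i \<le> N") auto
    then show ?thesis by (intro measurable_PiM_single'[where f="\<lambda>i \<omega>. x \<omega> i"]) auto
  qed
  have [measurable]: "random_variable borel L"
    unfolding L_def D_def using wm Vm by (intro borel_measurable_sum borel_measurable_add borel_measurable_divide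
      borel_measurable_times borel_measurable_diff borel_measurable_power) auto
  have VD: "integrable M (\<lambda>\<omega>. V i \<omega> * D i \<omega>)" "(\<integral>\<omega>. V i \<omega> * D i \<omega> \<partial>M) = 0" if "i < N" for i
    using integral_indep_mean_zero[OF sub V bd ind assms(6) \<sigma>, of i] that unfolding D_def by auto
  have V2: "integrable M (\<lambda>\<omega>. (V i \<omega>)\<^sup>2)" "(\<integral>\<omega>. (V i \<omega>)\<^sup>2 \<partial>M) \<le> (m i)\<^sup>2" if "i < N" for i
  proof -
    have le: "\<bar>V i \<omega>\<bar>\<^sup>2 \<le> (m i)\<^sup>2" if "\<omega> \<in> space M" for \<omega>
      using bd[OF \<open>i < N\<close> that] by (intro power_mono) auto
    show "integrable M (\<lambda>\<omega>. (V i \<omega>)\<^sup>2)"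
      by (rule integrable_const_bound[where B="(m i)\<^sup>2"]) (use le Vm[OF that] in auto)
    then show "(\<integral>\<omega>. (V i \<omega>)\<^sup>2 \<partial>M) \<le> (m i)\<^sup>2"
      using integral_mono[of M "\<lambda>\<omega>. (V i \<omega>)\<^sup>2" "\<lambda>_. (m i)\<^sup>2"] le by (simp add: prob_space)
  qed
  have iL: "integrable M L"
    unfolding L_def using VD V2 by auto
  have EL: "expectation L \<le> (\<Sum>i<N. (m i)\<^sup>2 / (2 * \<sigma>\<^sup>2))"
  proof -
    have "expectation L = (\<Sum>i<N. (\<integral>\<omega>. (V i \<omega>)\<^sup>2 \<partial>M) / (2 * \<sigma>\<^sup>2))"
      unfolding L_def using VD V2 by simp
    also have "\<dots> \<le> (\<Sum>i<N. (m i)\<^sup>2 / (2 * \<sigma>\<^sup>2))"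
      using V2 by (intro sum_mono divide_right_mono) auto
    finally show ?thesis .
  qed
  have i\<Psi>y: "integrable M (\<lambda>\<omega>. \<Psi> (y \<omega>))"
    by (rule integrable_const_bound[where B=c]) (use \<Psi>(2) in auto)
  have i\<Psi>x: "integrable M (\<lambda>\<omega>. exp (\<Psi> (x \<omega>)))"
    by (rule integrable_const_bound[where B="exp c"]) (use \<Psi>(2) in \<open>auto simp: abs_le_iff\<close>)
  define Y where "Y \<omega> = \<Psi> (y \<omega>) - L \<omega>" for \<omega>
  have iY: "integrable M Y" unfolding Y_def using i\<Psi>y iL by simp
  have nn: "(\<integral>\<^sup>+\<omega>. ennreal (exp (Y \<omega>)) \<partial>M) = (\<integral>\<^sup>+\<omega>. ennreal (exp (\<Psi> (x \<omega>))) \<partial>M)"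
  proof -
    have "(\<integral>\<^sup>+\<omega>. ennreal (exp (Y \<omega>)) \<partial>M) = (\<integral>\<^sup>+\<omega>. ennreal (exp (- L \<omega>)) * ennreal (exp (\<Psi> (y \<omega>))) \<partial>M)"
      by (simp add: Y_def ennreal_mult[symmetric] exp_add[symmetric])
    also have "\<dots> = (\<integral>\<^sup>+\<omega>. ennreal (exp (\<Psi> (x \<omega>))) \<partial>M)"
      using discrete_girsanov[where G="\<lambda>p. ennreal (exp (\<Psi> p))" and N=N and n=N and w=w and V=V and \<G>=\<G>,
          OF \<sigma> sub mono w V assms(6) ind order.refl]
      unfolding L_def D_def x_def y_def by simp
    finally show ?thesis .
  qed
  have ieY: "integrable M (\<lambda>\<omega>. exp (Y \<omega>))"
    using i\<Psi>x unfolding integrable_iff_bounded Y_def by (simp add: nn[unfolded Y_def])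
  have eq: "expectation (\<lambda>\<omega>. exp (Y \<omega>)) = expectation (\<lambda>\<omega>. exp (\<Psi> (x \<omega>)))"
    using nn by (simp add: integral_eq_nn_integral Y_def)
  have "exp (expectation Y) \<le> expectation (\<lambda>\<omega>. exp (\<Psi> (x \<omega>)))"
    using expectation_exp_ge[OF iY ieY] eq by simp
  then have "expectation Y \<le> ln (expectation (\<lambda>\<omega>. exp (\<Psi> (x \<omega>))))"
    by (smt (verit) exp_gt_zero ln_exp ln_le_cancel_iff)
  moreover have "expectation Y = expectation (\<lambda>\<omega>. \<Psi> (y \<omega>)) - expectation L"
    unfolding Y_def using i\<Psi>y iL by simp
  ultimately show ?thesis using EL unfolding x_def y_def by linarith
qed

section \<open>The hypergeometric function of the kernel\<close>

abbreviation slit_plane :: "complex set" where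
  "slit_plane \<equiv> - (complex_of_real ` {1..})"

text \<open>
  The slit plane is the domain on which the principal power \<open>(1 - z) powr b\<close> is holomorphic.
\<close>
lemma slit_plane_iff: "z \<in> slit_plane \<longleftrightarrow> 1 - z \<notin> \<real>\<^sub>\<le>\<^sub>0"
proof -
  have "z \<in> complex_of_real ` {1..} \<longleftrightarrow> 1 - z \<in> \<real>\<^sub>\<le>\<^sub>0"
    by (auto simp: complex_nonpos_Reals_iff image_iff complex_eq_iff intro!: exI[of _ "Re z"] bexI[of _ "Re z"])
  then show ?thesis by simp
qed

lemma open_slit_plane: "open slit_plane"
proof -
  have "slit_plane = (\<lambda>z. 1 - z) -` (- \<real>\<^sub>\<le>\<^sub>0)"
    using slit_plane_iff by auto
  also have "open \<dots>"
    by (intro open_vimage continuous_intros open_Compl closed_nonpos_Reals_complex)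
  finally show ?thesis .
qed

lemma slit_plane_scale:
  assumes "z \<in> slit_plane" "0 \<le> u" "u \<le> 1"
  shows "z * of_real u \<in> slit_plane"
proof (cases "u = 0")
  case False
  show ?thesis
  proof (clarsimp)
    fix x :: real assume x: "z * of_real u = of_real x" "1 \<le> x"
    then have "z = of_real (x / u)" using False by (simp add: field_simps)
    moreover have "x / u \<ge> 1" using x(2) assms False by (simp add: field_simps)
    ultimately have "z \<in> complex_of_real ` {1..}" by blast
    then show False using assms(1) by blast
  qed
qed auto

lemma connected_slit_plane: "connected slit_plane"
proof (rule starlike_imp_connected)
  show "starlike slit_plane"
    unfolding starlike_def
  proof (intro bexI[of _ 0] ballI subsetI)
    fix x y assume x: "x \<in> slit_plane" and y: "y \<in> closed_segment 0 x"
    then obtain u where "0 \<le> u" "u \<le> 1" "y = u *\<^sub>R x" by (auto simp: closed_segment_def)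
    then show "y \<in> slit_plane" using slit_plane_scale[OF x, of u] by (simp add: scaleR_conv_of_real mult.commute)
  qed (auto simp: image_iff)
qed

lemma ball_subset_slit_plane: "ball 0 1 \<subseteq> slit_plane"
  by (auto simp: dist_norm)

lemma powr_one_minus_sums:
  fixes a :: complex
  assumes "norm w < 1"
  shows "(\<lambda>n. pochhammer a n / fact n * w ^ n) sums (1 - w) powr (- a)"
proof -
  have "(\<lambda>n. ((- a) gchoose n) * (- w) ^ n) sums (1 + (- w)) powr (- a)"
    by (rule gen_binomial_complex) (use assms in simp)
  moreover have "((- a) gchoose n) * (- w) ^ n = pochhammer a n / fact n * w ^ n" for n
    unfolding gbinomial_pochhammer power_minus[of w] by (simp add: power_mult_distrib[symmetric])
  ultimately show ?thesis by simp
qed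

lemma holomorphic_powr_slit: "(\<lambda>z. (1 - z) powr b) holomorphic_on slit_plane"
  using slit_plane_iff by (intro holomorphic_intros) auto

text \<open>
  From \<open>pochhammer (- a) (Suc n)\<close> one can split off the first factor or the last one. The
  cancellation is due to the lower parameter exceeding an upper one by 1, and it is the reason
  for the first-order equation \<open>hypergeometric_ode\<close>.
\<close>
lemma hypergeometric_coeff:
  fixes a :: complex
  assumes "\<And>n. 1 - a \<noteq> - of_nat n" "a \<noteq> 0"
  shows "pochhammer (- a) n / pochhammer (1 - a) n = - a / (of_nat n - a)"
proof -
  have nz: "pochhammer (1 - a) n \<noteq> 0" using assms by (simp add: pochhammer_eq_0_iff)
  have nz2: "of_nat n - a \<noteq> 0"
  proof (cases n)
    case (Suc m) then show ?thesis using assms(1)[of m] by (auto simp: algebra_simps eq_neg_iff_add_eq_0)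
  qed (use assms in auto)
  have "pochhammer (- a) n * (of_nat n - a) = - a * pochhammer (1 - a) n"
    using pochhammer_rec[of "- a" n] pochhammer_Suc[of "-a" n] by (simp add: algebra_simps)
  then show ?thesis using nz nz2 by (simp add: field_simps)
qed

context
  fixes \<alpha> :: real
  assumes \<alpha>: "0 < \<alpha>" "\<alpha> < 1/2"
begin

text \<open>
  The difference quotient at 0 of \<open>(1 - z) powr (- \<alpha>)\<close>, with its removable singularity removed.
\<close>
definition binomial_slope :: "complex \<Rightarrow> complex" where
  "binomial_slope \<zeta> = (if \<zeta> = 0 then deriv (\<lambda>z. (1 - z) powr (- of_real \<alpha>)) 0
     else ((1 - \<zeta>) powr (- of_real \<alpha>) - (1 - 0) powr (- of_real \<alpha>)) / (\<zeta> - 0))"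

lemma binomial_slope_holomorphic: "binomial_slope holomorphic_on slit_plane"
  unfolding binomial_slope_def
  by (rule pole_lemma_open[OF holomorphic_powr_slit open_slit_plane])

lemma binomial_slope_sums:
  assumes "norm w < 1"
  shows "(\<lambda>n. pochhammer (of_real \<alpha>) (Suc n) / fact (Suc n) * w ^ n) sums binomial_slope w"
proof (cases "w = 0")
  case True
  have "((\<lambda>z. (1 - z) powr (- of_real \<alpha>)) has_field_derivative of_real \<alpha>) (at (0::complex))"
    by (auto intro!: derivative_eq_intros)
  then have "binomial_slope 0 = of_real \<alpha>" by (simp add: binomial_slope_def DERIV_imp_deriv)
  moreover have "(\<lambda>n. pochhammer (of_real \<alpha>) (Suc n) / fact (Suc n) * 0 ^ n) sums (complex_of_real \<alpha>)"
    using powser_sums_zero[of "\<lambda>n. pochhammer (complex_of_real \<alpha>) (Suc n) / fact (Suc n)"] by simp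
  ultimately show ?thesis using True by simp
next
  case False
  have "(\<lambda>n. pochhammer (of_real \<alpha>) (Suc n) / fact (Suc n) * w ^ Suc n) sums ((1 - w) powr (- of_real \<alpha>) - 1)"
    using powr_one_minus_sums[OF assms, of "of_real \<alpha>"] by (subst sums_Suc_iff) simp
  from sums_divide[OF this, of w] False show ?thesis by (simp add: binomial_slope_def)
qed

text \<open>
  For \<open>n \<ge> 1\<close> the factor \<open>1 / (n - \<alpha>)\<close> of the coefficients is the integral of
  \<open>u powr (n - 1 - \<alpha>)\<close> over the unit interval. Summing the series under the integral sign and
  substituting \<open>u = v\<^sup>2\<close> gives this formula; the substitution makes the weight continuous at 0,
  because \<open>1 - 2 * \<alpha> > 0\<close>.
\<close>
definition hypergeometric_extension :: "complex \<Rightarrow> complex" where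
  "hypergeometric_extension z = 1 - 2 * of_real \<alpha> * z * integral {0..1} (\<lambda>v. of_real (v powr (1 - 2 * \<alpha>)) * binomial_slope (z * of_real (v\<^sup>2)))"

text \<open>
  The slit plane is star-shaped about 0, so the integrand is defined for all parameters, and it
  is continuous in \<open>v\<close> and holomorphic in \<open>z\<close>. Differentiation under the integral sign is applied
  on balls, which are convex.
\<close>
lemma hypergeometric_extension_holomorphic: "hypergeometric_extension holomorphic_on slit_plane"
proof -
  let ?S = slit_plane
  let ?I = "\<lambda>z. integral {0..1} (\<lambda>v. of_real (v powr (1 - 2 * \<alpha>)) * binomial_slope (z * of_real (v\<^sup>2)))"
  have sc: "z * of_real (v\<^sup>2) \<in> ?S" if "z \<in> ?S" "v \<in> {0..1}" for z and v :: real
    using slit_plane_scale[OF that(1), of "v\<^sup>2"] that(2) by (auto simp: power_le_one)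
  have c1: "continuous_on ?S binomial_slope"
    by (rule holomorphic_on_imp_continuous_on[OF binomial_slope_holomorphic])
  have c2: "continuous_on ?S (deriv binomial_slope)"
    by (intro holomorphic_on_imp_continuous_on holomorphic_deriv binomial_slope_holomorphic open_slit_plane)
  have cp: "continuous_on {0..1::real} (\<lambda>v. complex_of_real (v powr (1 - 2 * \<alpha>)))"
    using \<alpha> by (intro continuous_intros continuous_on_powr') auto
  have "?I holomorphic_on ball z r" if r: "ball z r \<subseteq> ?S" for z r
  proof -
    have "(\<lambda>x. integral (cbox 0 1) (\<lambda>v. of_real (v powr (1 - 2 * \<alpha>)) * binomial_slope (x * of_real (v\<^sup>2)))) holomorphic_on ball z r"
    proof (rule leibniz_rule_holomorphic[where fx="\<lambda>x v. of_real (v powr (1 - 2 * \<alpha>)) * (deriv binomial_slope (x * of_real (v\<^sup>2)) * of_real (v\<^sup>2))"])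
      fix x v assume x: "x \<in> ball z r" and v: "v \<in> cbox (0::real) 1"
      have "(binomial_slope has_field_derivative deriv binomial_slope (x * of_real (v\<^sup>2))) (at (x * of_real (v\<^sup>2)))"
        using binomial_slope_holomorphic open_slit_plane sc[of x v] x v r by (intro holomorphic_derivI) auto
      then have "((\<lambda>x. binomial_slope (x * of_real (v\<^sup>2))) has_field_derivative deriv binomial_slope (x * of_real (v\<^sup>2)) * of_real (v\<^sup>2)) (at x)"
        by (rule DERIV_chain2) (auto intro!: derivative_eq_intros)
      then show "((\<lambda>x. of_real (v powr (1 - 2 * \<alpha>)) * binomial_slope (x * of_real (v\<^sup>2))) has_field_derivative
          of_real (v powr (1 - 2 * \<alpha>)) * (deriv binomial_slope (x * of_real (v\<^sup>2)) * of_real (v\<^sup>2))) (at x within ball z r)"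
        by (intro DERIV_cmult) (rule has_field_derivative_at_within)
    next
      fix x assume x: "x \<in> ball z r"
      have "continuous_on {0..1} (\<lambda>v. of_real (v powr (1 - 2 * \<alpha>)) * binomial_slope (x * of_real (v\<^sup>2)))"
        using subsetD[OF r x] sc by (intro continuous_on_mult cp continuous_on_compose2[OF c1] continuous_intros image_subsetI)
      then show "(\<lambda>v. of_real (v powr (1 - 2 * \<alpha>)) * binomial_slope (x * of_real (v\<^sup>2))) integrable_on cbox 0 1"
        by (simp add: integrable_continuous_real)
    next
      have "continuous_on (ball z r \<times> {0..1::real}) (\<lambda>p. complex_of_real (snd p powr (1 - 2 * \<alpha>)))"
        by (rule continuous_on_compose2[OF cp]) (auto intro: continuous_intros)
      moreover have "continuous_on (ball z r \<times> {0..1::real}) (\<lambda>p. deriv binomial_slope (fst p * of_real ((snd p)\<^sup>2)))"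
      proof (rule continuous_on_compose2[OF c2])
        show "continuous_on (ball z r \<times> {0..1::real}) (\<lambda>p. fst p * complex_of_real ((snd p)\<^sup>2))"
          by (intro continuous_intros)
        show "(\<lambda>p. fst p * complex_of_real ((snd p)\<^sup>2)) ` (ball z r \<times> {0..1}) \<subseteq> ?S"
        proof (rule image_subsetI)
          fix p assume "p \<in> ball z r \<times> {0..1::real}"
          then have "fst p \<in> ball z r" "snd p \<in> {0..1}" by (simp_all add: mem_Times_iff)
          then show "fst p * complex_of_real ((snd p)\<^sup>2) \<in> ?S" using sc r by blast
        qed
      qed
      ultimately show "continuous_on (ball z r \<times> cbox 0 1) (\<lambda>(x, v). of_real (v powr (1 - 2 * \<alpha>)) * (deriv binomial_slope (x * of_real (v\<^sup>2)) * of_real (v\<^sup>2)))"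
        unfolding case_prod_beta' by (auto intro!: continuous_on_mult continuous_intros simp del: of_real_power)
    qed simp
    then show ?thesis by simp
  qed
  then have "?I analytic_on ?S"
    unfolding analytic_on_def using open_slit_plane open_contains_ball by (metis (no_types, lifting))
  then have "?I holomorphic_on ?S" by (rule analytic_imp_holomorphic)
  then show ?thesis unfolding hypergeometric_extension_def by (intro holomorphic_intros)
qed

text \<open>
  The series of the integrand converges uniformly on the unit interval and may be integrated
  term by term.
\<close>
lemma hypergeometric_extension_sums:
  assumes w: "norm w < 1"
  shows "(\<lambda>n. pochhammer (- of_real \<alpha>) n * pochhammer (of_real \<alpha>) n / (pochhammer (1 - of_real \<alpha>) n * fact n) * w ^ n) sums hypergeometric_extension w"
proof -
  let ?c = "\<lambda>n. pochhammer (complex_of_real \<alpha>) n / fact n"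
  let ?g = "\<lambda>n v. complex_of_real (v powr (1 - 2 * \<alpha>)) * (?c (Suc n) * (w * of_real (v\<^sup>2)) ^ n)"
  have ul: "uniform_limit {0..1} (\<lambda>N v. \<Sum>n<N. ?g n v) (\<lambda>v. suminf (\<lambda>n. ?g n v)) sequentially"
  proof (rule Weierstrass_m_test)
    show "summable (\<lambda>n. norm (?c (Suc n)) * norm w ^ n)"
    proof -
      obtain K where K: "norm w < K" "K < 1" using w dense by blast
      have "norm (complex_of_real K) < 1" using K norm_ge_zero[of w] by (simp del: norm_ge_zero)
      from sums_summable[OF binomial_slope_sums[OF this]]
      have "summable (\<lambda>n. norm (?c (Suc n) * w ^ n))"
        by (rule powser_insidea) (use K in auto)
      then show ?thesis by (simp only: norm_mult norm_power)
    qed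
    fix n and v :: real assume v: "v \<in> {0..1}"
    have 1: "v powr (1 - 2 * \<alpha>) \<le> 1" using v \<alpha> by (auto intro: powr_le1)
    have 2: "norm (w * of_real (v\<^sup>2)) ^ n \<le> norm w ^ n"
      using v by (intro power_mono) (auto simp: norm_mult norm_power mult_left_le power_le_one)
    have "norm (?g n v) = v powr (1 - 2 * \<alpha>) * (norm (?c (Suc n)) * norm (w * of_real (v\<^sup>2)) ^ n)"
      by (simp only: norm_mult norm_power norm_of_real) simp
    also have "\<dots> \<le> 1 * (norm (?c (Suc n)) * norm w ^ n)"
      using 1 2 by (intro mult_mono mult_left_mono) auto
    finally show "norm (?g n v) \<le> norm (?c (Suc n)) * norm w ^ n" by simp
  qed
  have lim: "suminf (\<lambda>n. ?g n v) = of_real (v powr (1 - 2 * \<alpha>)) * binomial_slope (w * of_real (v\<^sup>2))" if v: "v \<in> {0..1}" for v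
  proof -
    have "norm (w * of_real (v\<^sup>2)) \<le> norm w"
      using v by (auto simp: norm_mult norm_power mult_left_le power_le_one)
    then have "norm (w * of_real (v\<^sup>2)) < 1" using w by linarith
    from sums_mult[OF binomial_slope_sums[OF this], of "of_real (v powr (1 - 2 * \<alpha>))"] show ?thesis
      by (simp add: sums_iff)
  qed
  have int1: "(?g n has_integral ?c (Suc n) * w ^ n / (2 * of_nat (Suc n) - 2 * of_real \<alpha>)) {0..1}" for n
  proof -
    have "((\<lambda>v::real. v powr (1 - 2 * \<alpha> + 2 * n)) has_integral (1 powr ((1 - 2 * \<alpha> + 2 * n) + 1) / ((1 - 2 * \<alpha> + 2 * n) + 1))) {0..1}"
      by (rule has_integral_powr_from_0) (use \<alpha> in auto)
    then have "((\<lambda>v::real. v powr (1 - 2 * \<alpha> + 2 * n)) has_integral (1 / (2 * real (Suc n) - 2 * \<alpha>))) {0..1}"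
      by (simp add: algebra_simps)
    then have "((\<lambda>v. v powr (1 - 2 * \<alpha>) * (v\<^sup>2) ^ n) has_integral (1 / (2 * real (Suc n) - 2 * \<alpha>))) {0..1}"
    proof (rule has_integral_spike[rotated -1])
      show "negligible {0::real}" by simp
      fix v :: real assume "v \<in> {0..1} - {0}"
      then have "v > 0" by auto
      then have "(v\<^sup>2) ^ n = v powr real (2 * n)"
        unfolding power_mult[symmetric] by (rule powr_realpow[symmetric])
      then show "v powr (1 - 2 * \<alpha>) * (v\<^sup>2) ^ n = v powr (1 - 2 * \<alpha> + 2 * n)"
        by (simp add: powr_add)
    qed
    then have "((\<lambda>v. complex_of_real (v powr (1 - 2 * \<alpha>) * (v\<^sup>2) ^ n)) has_integral complex_of_real (1 / (2 * real (Suc n) - 2 * \<alpha>))) {0..1}"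
      by (rule has_integral_of_real)
    from has_integral_mult_right[OF this, of "?c (Suc n) * w ^ n"]
    show ?thesis by (simp add: power_mult_distrib mult_ac)
  qed
  have cont: "continuous_on {0..1} (\<lambda>v. \<Sum>n<N. ?g n v)" for N
    using \<alpha> by (intro continuous_intros continuous_on_powr') auto
  obtain I J where IJ: "\<And>N. ((\<lambda>v. \<Sum>n<N. ?g n v) has_integral I N) {0..1}"
     "((\<lambda>v. suminf (\<lambda>n. ?g n v)) has_integral J) {0..1}" "I \<longlonglongrightarrow> J"
    using uniform_limit_integral[OF ul cont trivial_limit_sequentially] by blast
  have I: "I N = (\<Sum>n<N. ?c (Suc n) * w ^ n / (2 * of_nat (Suc n) - 2 * of_real \<alpha>))" for N
    by (rule has_integral_unique[OF IJ(1)]) (intro has_integral_sum finite_lessThan int1)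
  have J: "J = integral {0..1} (\<lambda>v. of_real (v powr (1 - 2 * \<alpha>)) * binomial_slope (w * of_real (v\<^sup>2)))"
    unfolding integral_unique[OF IJ(2), symmetric] by (rule integral_cong) (rule lim)
  have "(\<lambda>n. ?c (Suc n) * w ^ n / (2 * of_nat (Suc n) - 2 * of_real \<alpha>)) sums J"
    using IJ(3) unfolding sums_def I[abs_def] .
  from sums_mult[OF this, of "- 2 * of_real \<alpha> * w"]
  have s: "(\<lambda>n. - 2 * of_real \<alpha> * w * (?c (Suc n) * w ^ n / (2 * of_nat (Suc n) - 2 * of_real \<alpha>))) sums (hypergeometric_extension w - 1)"
    by (simp add: hypergeometric_extension_def J mult.assoc)
  let ?d = "\<lambda>n. pochhammer (- of_real \<alpha>) n * pochhammer (of_real \<alpha>) n / (pochhammer (1 - of_real \<alpha>) n * fact n) * w ^ n"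
  have nn: "1 - complex_of_real \<alpha> \<noteq> - of_nat n" for n
    using \<alpha> by (auto simp: complex_eq_iff)
  have "- 2 * of_real \<alpha> * w * (?c (Suc n) * w ^ n / (2 * of_nat (Suc n) - 2 * of_real \<alpha>)) = ?d (Suc n)" for n
  proof -
    have "?d (Suc n) = (pochhammer (- of_real \<alpha>) (Suc n) / pochhammer (1 - of_real \<alpha>) (Suc n)) * (?c (Suc n) * w ^ Suc n)"
      by simp
    also have "\<dots> = - of_real \<alpha> / (of_nat (Suc n) - of_real \<alpha>) * (?c (Suc n) * w ^ Suc n)"
      using hypergeometric_coeff[OF nn, of "Suc n"] \<alpha> by simp
    also have "\<dots> = - 2 * of_real \<alpha> * w * (?c (Suc n) * w ^ n / (2 * (of_nat (Suc n) - of_real \<alpha>)))"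
    proof -
      have "- a / x * (c * w ^ Suc n) = - 2 * a * w * (c * w ^ n / (2 * x))" for a x c :: complex
        by (simp add: mult_ac)
      then show ?thesis .
    qed
    finally show ?thesis by (simp add: right_diff_distrib)
  qed
  with s have "(\<lambda>n. ?d (Suc n)) sums (hypergeometric_extension w - ?d 0)" by simp
  then show ?thesis by (subst (asm) sums_Suc_iff) simp
qed

end

text \<open>
  The coefficients of the hypergeometric series with parameters \<open>1, \<alpha>; 1 - \<alpha>\<close>, into which the
  transformation \<open>hypergeometric_negative_axis\<close> turns the series of the kernel.
\<close>
definition hyp_coeff :: "real \<Rightarrow> nat \<Rightarrow> real" where
  "hyp_coeff \<alpha> n = pochhammer \<alpha> n / pochhammer (1 - \<alpha>) n"

context
  fixes \<alpha> :: real
  assumes \<alpha>: "0 < \<alpha>" "\<alpha> < 1/2"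
begin

lemma hyp_coeff_pos: "0 < hyp_coeff \<alpha> n"
  unfolding hyp_coeff_def using \<alpha> by (intro divide_pos_pos pochhammer_pos) auto

lemma hyp_coeff_0 [simp]: "hyp_coeff \<alpha> 0 = 1"
  by (simp add: hyp_coeff_def)

lemma hyp_coeff_Suc: "hyp_coeff \<alpha> (Suc n) * (real (Suc n) - \<alpha>) = hyp_coeff \<alpha> n * (real n + \<alpha>)"
proof -
  have "1 - \<alpha> + real n \<noteq> 0" using \<alpha> by auto
  moreover have "a * b / (c * x) * x = a / c * b" if "x \<noteq> 0" for a b c x :: real
    using that by simp
  moreover have "real (Suc n) - \<alpha> = 1 - \<alpha> + real n" "real n + \<alpha> = \<alpha> + real n" by simp_all
  ultimately show ?thesis
    unfolding hyp_coeff_def pochhammer_Suc by metis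
qed

lemma hyp_coeff_le_1: "hyp_coeff \<alpha> n \<le> 1"
proof (induction n)
  case (Suc n)
  have "hyp_coeff \<alpha> (Suc n) * (real (Suc n) - \<alpha>) \<le> 1 * (real n + \<alpha>)"
    unfolding hyp_coeff_Suc using Suc \<alpha> by (intro mult_right_mono) auto
  also have "\<dots> \<le> 1 * (real (Suc n) - \<alpha>)" using \<alpha> by simp
  finally show ?case using \<alpha> by (subst (asm) mult_le_cancel_right) auto
qed simp

lemma hyp_summable: "\<bar>w\<bar> < 1 \<Longrightarrow> summable (\<lambda>n. hyp_coeff \<alpha> n * w ^ n)"
proof (rule summable_comparison_test'[where N=0 and g="\<lambda>n. \<bar>w\<bar> ^ n"])
  assume "\<bar>w\<bar> < 1" then show "summable (\<lambda>n. \<bar>w\<bar> ^ n)" by (intro summable_geometric) auto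
  show "norm (hyp_coeff \<alpha> n * w ^ n) \<le> \<bar>w\<bar> ^ n" for n
    using hyp_coeff_pos[of n] hyp_coeff_le_1[of n] by (simp add: abs_mult power_abs mult_left_le_one_le)
qed

text \<open>
  The recursion \<open>hyp_coeff_Suc\<close>, read as an identity between power series.
\<close>
lemma hyp_series_ode:
  assumes w: "\<bar>w\<bar> < 1"
  obtains G' where "((\<lambda>w. \<Sum>n. hyp_coeff \<alpha> n * w ^ n) has_real_derivative G') (at w)"
    "w * (1 - w) * G' = \<alpha> * (1 + w) * (\<Sum>n. hyp_coeff \<alpha> n * w ^ n) - \<alpha>"
proof
  let ?g = "hyp_coeff \<alpha>"
  let ?G = "\<Sum>n. ?g n * w ^ n"
  let ?G' = "\<Sum>n. diffs ?g n * w ^ n"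
  show "((\<lambda>w. \<Sum>n. ?g n * w ^ n) has_real_derivative ?G') (at w)"
    by (rule termdiffs_strong'[where K=1]) (use hyp_summable w in auto)
  have sd: "summable (\<lambda>n. diffs ?g n * w ^ n)"
    by (rule termdiff_converges[where K=1]) (use hyp_summable w in auto)
  have s1: "(\<lambda>n. ?g n * w ^ n) sums ?G"
    using hyp_summable[OF w] by (rule summable_sums)
  have s2: "(\<lambda>n. real n * ?g n * w ^ n) sums (w * ?G')"
  proof -
    have "(\<lambda>n. w * (of_nat n * ?g n * w ^ (n - Suc 0))) sums (w * ?G')"
      by (rule sums_mult[OF diffs_equiv[OF sd]])
    moreover have "w * (of_nat n * ?g n * w ^ (n - Suc 0)) = real n * ?g n * w ^ n" for n
      by (cases n) auto
    ultimately show ?thesis by simp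
  qed
  have "(\<lambda>n. real n * ?g n * w ^ n - \<alpha> * (?g n * w ^ n)) sums (w * ?G' - \<alpha> * ?G)"
    by (intro sums_diff s2 sums_mult s1)
  then have "(\<lambda>n. ?g n * (real n - \<alpha>) * w ^ n) sums (w * ?G' - \<alpha> * ?G)"
    by (simp add: algebra_simps)
  then have a: "(\<lambda>n. ?g (Suc n) * (real (Suc n) - \<alpha>) * w ^ Suc n) sums (w * ?G' - \<alpha> * ?G + \<alpha>)"
    by (subst sums_Suc_iff) simp
  have "(\<lambda>n. w * (real n * ?g n * w ^ n + \<alpha> * (?g n * w ^ n))) sums (w * (w * ?G' + \<alpha> * ?G))"
    by (intro sums_add sums_mult s1 s2)
  moreover have "w * (real n * ?g n * w ^ n + \<alpha> * (?g n * w ^ n)) = ?g (Suc n) * (real (Suc n) - \<alpha>) * w ^ Suc n" for n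
    unfolding hyp_coeff_Suc by (simp add: algebra_simps)
  ultimately have "w * (w * ?G' + \<alpha> * ?G) = w * ?G' - \<alpha> * ?G + \<alpha>"
    using a sums_unique2 by simp
  then show "w * (1 - w) * ?G' = \<alpha> * (1 + w) * ?G - \<alpha>"
    by (simp add: algebra_simps)
qed

text \<open>
  On the unit disc this is a comparison of coefficients based on \<open>hypergeometric_coeff\<close>; the
  identity theorem extends it to the slit plane.
\<close>
lemma hypergeometric_ode:
  assumes hol: "f holomorphic_on slit_plane"
    and ser: "\<And>w. norm w < 1 \<Longrightarrow>
      (\<lambda>n. pochhammer (- of_real \<alpha>) n * pochhammer (of_real \<alpha>) n / (pochhammer (1 - of_real \<alpha>) n * fact n) * w ^ n) sums f w"
    and z: "z \<in> slit_plane"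
  shows "z * deriv f z - of_real \<alpha> * f z = - of_real \<alpha> * (1 - z) powr (- of_real \<alpha>)"
proof (rule analytic_continuation_open[where s="ball 0 1" and s'=slit_plane and g="\<lambda>z. - of_real \<alpha> * (1 - z) powr (- of_real \<alpha>)"
    and f="\<lambda>z. z * deriv f z - of_real \<alpha> * f z"])
  show "(\<lambda>z. z * deriv f z - of_real \<alpha> * f z) holomorphic_on slit_plane"
    by (intro holomorphic_intros holomorphic_deriv hol open_slit_plane)
  show "(\<lambda>z. - of_real \<alpha> * (1 - z) powr (- of_real \<alpha>)) holomorphic_on slit_plane"
    by (intro holomorphic_intros holomorphic_powr_slit)
  fix w :: complex assume "w \<in> ball 0 1"
  then have w: "norm w < 1" by simp
  define c where "c n = pochhammer (- complex_of_real \<alpha>) n * pochhammer (of_real \<alpha>) n / (pochhammer (1 - of_real \<alpha>) n * fact n)" for n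
  have s: "(\<lambda>n. c n * w ^ n) sums f w" if "norm w < 1" for w
    unfolding c_def using ser[OF that] .
  have "((\<lambda>w. \<Sum>n. c n * w ^ n) has_field_derivative (\<Sum>n. diffs c n * w ^ n)) (at w)"
    by (rule termdiffs_strong'[where K=1]) (use s w in \<open>auto simp: sums_iff\<close>)
  moreover have "eventually (\<lambda>w. (\<Sum>n. c n * w ^ n) = f w) (nhds w)"
    using eventually_nhds_in_open[of "ball 0 1" w] w by (auto elim!: eventually_mono simp: s sums_unique[symmetric])
  ultimately have "(f has_field_derivative (\<Sum>n. diffs c n * w ^ n)) (at w)"
    using DERIV_cong_ev[OF refl _ refl, of "\<lambda>w. \<Sum>n. c n * w ^ n" f w] by blast
  then have d: "deriv f w = (\<Sum>n. diffs c n * w ^ n)" by (rule DERIV_imp_deriv)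
  have sd: "summable (\<lambda>n. diffs c n * w ^ n)"
    by (rule termdiff_converges[where K=1]) (use s w in \<open>auto simp: sums_iff\<close>)
  have s2: "(\<lambda>n. of_nat n * c n * w ^ n) sums (w * deriv f w)"
  proof -
    have "(\<lambda>n. w * (of_nat n * c n * w ^ (n - Suc 0))) sums (w * deriv f w)"
      unfolding d by (rule sums_mult[OF diffs_equiv[OF sd]])
    moreover have "w * (of_nat n * c n * w ^ (n - Suc 0)) = of_nat n * c n * w ^ n" for n
      by (cases n) auto
    ultimately show ?thesis by simp
  qed
  have nn: "1 - complex_of_real \<alpha> \<noteq> - of_nat n" for n
    using \<alpha> by (auto simp: complex_eq_iff)
  have nn2: "of_nat n - complex_of_real \<alpha> \<noteq> 0" for n
  proof (cases n)
    case (Suc m) then show ?thesis using nn[of m] by (auto simp: algebra_simps eq_neg_iff_add_eq_0)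
  qed (use \<alpha> in auto)
  have "of_nat n * c n * w ^ n - of_real \<alpha> * (c n * w ^ n) = - of_real \<alpha> * (pochhammer (of_real \<alpha>) n / fact n * w ^ n)" for n
  proof -
    have "c n = (pochhammer (- complex_of_real \<alpha>) n / pochhammer (1 - of_real \<alpha>) n) * (pochhammer (of_real \<alpha>) n / fact n)"
      by (simp add: c_def)
    also have "\<dots> = - of_real \<alpha> / (of_nat n - of_real \<alpha>) * (pochhammer (of_real \<alpha>) n / fact n)"
      using hypergeometric_coeff[OF nn, of n] \<alpha> by simp
    finally have "(of_nat n - of_real \<alpha>) * c n = - of_real \<alpha> * (pochhammer (of_real \<alpha>) n / fact n)"
      using nn2[of n] by simp
    then show ?thesis by (metis (no_types, lifting) left_diff_distrib mult.assoc)
  qed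
  moreover have "(\<lambda>n. of_nat n * c n * w ^ n - of_real \<alpha> * (c n * w ^ n)) sums (w * deriv f w - of_real \<alpha> * f w)"
    by (intro sums_diff s2 sums_mult s w)
  ultimately have "(\<lambda>n. - of_real \<alpha> * (pochhammer (of_real \<alpha>) n / fact n * w ^ n)) sums (w * deriv f w - of_real \<alpha> * f w)"
    by simp
  moreover have "(\<lambda>n. - of_real \<alpha> * (pochhammer (of_real \<alpha>) n / fact n * w ^ n)) sums (- of_real \<alpha> * (1 - w) powr (- of_real \<alpha>))"
    by (intro sums_mult powr_one_minus_sums w)
  ultimately show "w * deriv f w - of_real \<alpha> * f w = - of_real \<alpha> * (1 - w) powr (- of_real \<alpha>)"
    by (rule sums_unique2)
qed (use z ball_subset_slit_plane open_slit_plane connected_slit_plane in auto)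

text \<open>
  Both sides satisfy the same linear first-order equation, so their difference is a multiple of
  \<open>x powr \<alpha>\<close>. It is also differentiable at 0, where it vanishes, and \<open>\<alpha> < 1\<close>; hence the multiple
  is zero. The argument moves from \<open>- x\<close>, possibly outside the disc of convergence, to a point of
  the unit interval, and all terms of the new series are positive.
\<close>
lemma hypergeometric_negative_axis:
  assumes hol: "f holomorphic_on slit_plane"
    and ser: "\<And>w. norm w < 1 \<Longrightarrow>
      (\<lambda>n. pochhammer (- of_real \<alpha>) n * pochhammer (of_real \<alpha>) n / (pochhammer (1 - of_real \<alpha>) n * fact n) * w ^ n) sums f w"
    and x: "0 < x"
  shows "Re (f (- of_real x)) = (1 + x) powr (- \<alpha>) * (\<Sum>n. hyp_coeff \<alpha> n * (x / (1 + x)) ^ n)"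
proof -
  define \<phi> where "\<phi> x = Re (f (- complex_of_real x))" for x
  define G where "G w = (\<Sum>n. hyp_coeff \<alpha> n * w ^ n)" for w
  define \<psi> where "\<psi> x = (1 + x) powr (- \<alpha>) * G (x / (1 + x))" for x
  define D where "D x = \<phi> x - \<psi> x" for x
  have neg_slit: "- complex_of_real y \<in> slit_plane" if "y \<ge> 0" for y
    using that by (auto simp: complex_eq_iff)
  have d\<phi>: "(\<phi> has_real_derivative Re (- deriv f (- of_real y))) (at y)" if y: "y \<ge> 0" for y
  proof -
    have "(f has_field_derivative deriv f (- of_real y)) (at (- of_real y))"
      using hol open_slit_plane neg_slit[OF y] by (rule holomorphic_derivI)
    then have "((\<lambda>z. f (- z)) has_field_derivative deriv f (- of_real y) * (- 1)) (at (of_real y))"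
      by (rule DERIV_chain2) (auto intro!: derivative_eq_intros)
    from has_field_derivative_Re[OF has_vector_derivative_real_field[OF this]]
    show ?thesis unfolding \<phi>_def by simp
  qed
  have ode\<phi>: "y * Re (- deriv f (- of_real y)) = \<alpha> * \<phi> y - \<alpha> * (1 + y) powr (- \<alpha>)" if y: "y \<ge> 0" for y
  proof -
    have "(1 - (- complex_of_real y)) powr (- of_real \<alpha>) = of_real ((1 + y) powr (- \<alpha>))"
      using y by (subst powr_of_real[symmetric]) auto
    with hypergeometric_ode[OF hol ser neg_slit[OF y]]
    have "Re (- complex_of_real y * deriv f (- of_real y) - of_real \<alpha> * f (- of_real y)) = Re (- of_real \<alpha> * of_real ((1 + y) powr (- \<alpha>)))"
      by simp
    then show ?thesis by (simp add: \<phi>_def)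
  qed
  have \<psi>: "\<exists>\<psi>'. (\<psi> has_real_derivative \<psi>') (at y) \<and> y * \<psi>' = \<alpha> * \<psi> y - \<alpha> * (1 + y) powr (- \<alpha>)" if y: "y \<ge> 0" for y
  proof -
    let ?w = "y / (1 + y)"
    have w: "\<bar>?w\<bar> < 1" using y by simp
    obtain G' where G': "(G has_real_derivative G') (at ?w)" "?w * (1 - ?w) * G' = \<alpha> * (1 + ?w) * G ?w - \<alpha>"
      using hyp_series_ode[OF w] unfolding G_def by blast
    have "((\<lambda>y. y / (1 + y)) has_real_derivative 1 / (1 + y)\<^sup>2) (at y)"
      using y by (auto intro!: derivative_eq_intros simp: power2_eq_square field_simps)
    with G'(1) have dG: "((\<lambda>y. G (y / (1 + y))) has_real_derivative G' * (1 / (1 + y)\<^sup>2)) (at y)"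
      by (rule DERIV_chain2)
    have dp: "((\<lambda>y. (1 + y) powr (- \<alpha>)) has_real_derivative (- \<alpha> * (1 + y) powr (- \<alpha> - 1))) (at y)"
      using y by (auto intro!: derivative_eq_intros)
    have pe: "(1 + y) powr (- \<alpha> - 1) = (1 + y) powr (- \<alpha>) / (1 + y)"
      using y by (simp add: powr_diff)
    have "y * (- \<alpha> * (1 + y) powr (- \<alpha> - 1) * G ?w + (1 + y) powr (- \<alpha>) * (G' * (1 / (1 + y)\<^sup>2)))
       = (1 + y) powr (- \<alpha>) * (- \<alpha> * ?w * G ?w + ?w * (1 - ?w) * G')"
      unfolding pe using y by (simp add: field_simps power2_eq_square)
    also have "\<dots> = \<alpha> * \<psi> y - \<alpha> * (1 + y) powr (- \<alpha>)"
      unfolding G'(2) \<psi>_def by (simp add: algebra_simps)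
    finally show ?thesis
      using DERIV_mult[OF dp dG] unfolding \<psi>_def by (intro exI conjI) (auto simp: mult_ac add_ac)
  qed
  have f0: "f 0 = 1"
    using sums_unique2[OF ser[of 0] powser_sums_zero] by simp
  have D0: "D 0 = 0"
    using f0 by (simp add: D_def \<phi>_def \<psi>_def G_def powser_zero)
  have D: "\<exists>D'. (D has_real_derivative D') (at y) \<and> y * D' = \<alpha> * D y" if y: "y \<ge> 0" for y
  proof -
    obtain \<psi>' where "(\<psi> has_real_derivative \<psi>') (at y)" "y * \<psi>' = \<alpha> * \<psi> y - \<alpha> * (1 + y) powr (- \<alpha>)"
      using \<psi>[OF y] by blast
    with d\<phi>[OF y] ode\<phi>[OF y] show ?thesis unfolding D_def
      by (intro exI[of _ "Re (- deriv f (- of_real y)) - \<psi>'"] conjI DERIV_diff) (auto simp: algebra_simps)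
  qed
  have "\<exists>c. \<forall>y\<in>{0<..}. D y * y powr (- \<alpha>) = c"
  proof (rule has_field_derivative_zero_constant)
    fix y :: real assume "y \<in> {0<..}" then have y: "y > 0" by simp
    obtain D' where D': "(D has_real_derivative D') (at y)" "y * D' = \<alpha> * D y" using D[of y] y by auto
    have pe: "y powr (- \<alpha> - 1) = y powr (- \<alpha>) / y" using y by (simp add: powr_diff)
    have "((\<lambda>y. D y * y powr (- \<alpha>)) has_real_derivative D y * (- \<alpha> * y powr (- \<alpha> - 1)) + D' * y powr (- \<alpha>)) (at y)"
      using y by (auto intro!: derivative_eq_intros D'(1))
    moreover have "D y * (- \<alpha> * y powr (- \<alpha> - 1)) + D' * y powr (- \<alpha>) = (y powr (- \<alpha>) / y) * (y * D' - \<alpha> * D y)"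
      unfolding pe using y by (simp add: field_simps)
    ultimately show "((\<lambda>y. D y * y powr (- \<alpha>)) has_real_derivative 0) (at y within {0<..})"
      using D'(2) by (simp add: has_field_derivative_at_within)
  qed simp
  then obtain c where c: "\<And>y. y > 0 \<Longrightarrow> D y * y powr (- \<alpha>) = c" by auto
  obtain D' where D': "(D has_real_derivative D') (at 0)" using D[of 0] by auto
  have l1: "((\<lambda>y. D y / y) \<longlongrightarrow> D') (at_right 0)"
    using D' D0 by (auto simp: DERIV_def intro: tendsto_mono[OF at_le])
  \<comment> \<open>Here \<open>D y / y * y powr (1 - \<alpha>)\<close> is the constant \<open>c\<close>, but its limit at 0 is \<open>D' * 0\<close>.\<close>
  have l2: "((\<lambda>y::real. y powr (1 - \<alpha>)) \<longlongrightarrow> 0) (at_right 0)"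
  proof -
    have "((\<lambda>y::real. y powr (1 - \<alpha>)) \<longlongrightarrow> 0 powr (1 - \<alpha>)) (at_right 0)"
      using \<alpha> by (intro tendsto_powr' tendsto_intros) (auto simp: eventually_at_right_less intro!: eventually_at_rightI[of 0 1])
    then show ?thesis by simp
  qed
  have "((\<lambda>y. D y / y * y powr (1 - \<alpha>)) \<longlongrightarrow> D' * 0) (at_right 0)"
    by (rule tendsto_mult[OF l1 l2])
  moreover have "eventually (\<lambda>y. D y / y * y powr (1 - \<alpha>) = c) (at_right 0)"
  proof (rule eventually_at_rightI[of 0 1])
    fix y :: real assume "y \<in> {0<..<1}"
    then have y: "y > 0" by simp
    have "D y / y * y powr (1 - \<alpha>) = D y * y powr (- \<alpha>)"
      using y by (simp add: powr_diff powr_minus field_simps)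
    then show "D y / y * y powr (1 - \<alpha>) = c" using c[OF y] by simp
  qed simp
  ultimately have "((\<lambda>y::real. c) \<longlongrightarrow> 0) (at_right 0)"
    using tendsto_cong[of "\<lambda>y. D y / y * y powr (1 - \<alpha>)" "\<lambda>_. c"] by simp
  then have "c = 0" by (simp add: tendsto_const_iff)
  with c[OF x] x have "D x = 0" by simp
  then show ?thesis by (simp add: D_def \<phi>_def \<psi>_def G_def)
qed

end

section \<open>The kernel of fractional Brownian motion\<close>

text \<open>
  The substitution \<open>s = t - (t - r) * x\<close> in Euler's Beta integral.
\<close>
lemma nn_integral_beta_scaled:
  fixes p q r t :: real
  assumes pq: "p > 0" "q > 0" and rt: "r < t"
  shows "(\<integral>\<^sup>+s\<in>{r<..<t}. ennreal ((t - s) powr (p - 1) * (s - r) powr (q - 1)) \<partial>lborel)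
       = ennreal ((t - r) powr (p + q - 1) * Beta p q)"
proof -
  let ?f = "\<lambda>s. ennreal ((t - s) powr (p - 1) * (s - r) powr (q - 1)) * indicator {r<..<t} s"
  have beta: "(\<integral>\<^sup>+x. ennreal (x powr (p - 1) * (1 - x) powr (q - 1) * indicator {0<..<1} x) \<partial>lborel) = ennreal (Beta p q)"
  proof (rule nn_integral_has_integral_lborel)
    have "((\<lambda>x. x powr (p - 1) * (1 - x) powr (q - 1)) has_integral Beta p q) {0<..<1}"
      using has_integral_Beta_real[OF pq] by (simp add: has_integral_Icc_iff_Ioo)
    then show "((\<lambda>x. x powr (p - 1) * (1 - x) powr (q - 1) * indicator {0<..<1} x) has_integral Beta p q) UNIV"
      by (subst (asm) has_integral_restrict_UNIV[symmetric])
         (auto elim!: has_integral_eq[rotated] simp: indicator_def)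
  qed auto
  have "(\<integral>\<^sup>+s. ?f s \<partial>lborel) = ennreal \<bar>- (t - r)\<bar> * (\<integral>\<^sup>+x. ?f (t + (- (t - r)) * x) \<partial>lborel)"
    by (rule nn_integral_real_affine) (use rt in auto)
  also have "\<dots> = ennreal (t - r) * (\<integral>\<^sup>+x. ennreal ((t - r) powr (p + q - 2)) *
      ennreal (x powr (p - 1) * (1 - x) powr (q - 1) * indicator {0<..<1} x) \<partial>lborel)"
  proof -
    have "?f (t + (- (t - r)) * x) = ennreal ((t - r) powr (p + q - 2)) *
      ennreal (x powr (p - 1) * (1 - x) powr (q - 1) * indicator {0<..<1} x)" for x
    proof (cases "0 < x \<and> x < 1")
      case True
      have "0 < (t - r) * x" "(t - r) * x < (t - r) * 1" using True rt by (auto intro: mult_strict_left_mono)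
      then have ind: "indicator {r<..<t} (t + (- (t - r)) * x) = (1::ennreal)"
        by (auto simp: algebra_simps)
      have e: "t - (t + (- (t - r)) * x) = (t - r) * x" "t + (- (t - r)) * x - r = (t - r) * (1 - x)"
        by (auto simp: algebra_simps)
      have "((t - r) * x) powr (p - 1) * ((t - r) * (1 - x)) powr (q - 1)
          = (t - r) powr (p + q - 2) * (x powr (p - 1) * (1 - x) powr (q - 1))"
      proof -
        have "(t - r) powr (p + q - 2) = (t - r) powr (p - 1) * (t - r) powr (q - 1)"
          by (simp add: powr_add[symmetric] algebra_simps)
        then show ?thesis using True rt by (simp add: powr_mult)
      qed
      then show ?thesis unfolding e ind using True by (simp add: ennreal_mult[symmetric])
    next
      case False
      have "t + (- (t - r)) * x \<notin> {r<..<t}"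
      proof
        assume "t + (- (t - r)) * x \<in> {r<..<t}"
        then have "0 < (t - r) * x" "(t - r) * x < (t - r) * 1" by (auto simp: algebra_simps)
        then show False using False rt by (simp add: zero_less_mult_iff)
      qed
      then show ?thesis using False by (auto simp: indicator_def)
    qed
    then show ?thesis using rt by simp
  qed
  also have "\<dots> = ennreal (t - r) * (ennreal ((t - r) powr (p + q - 2)) * ennreal (Beta p q))"
    by (subst nn_integral_cmult) (auto simp: beta)
  also have "\<dots> = ennreal ((t - r) * (t - r) powr (p + q - 2) * Beta p q)"
  proof -
    have "0 \<le> Beta p q" using pq by (auto simp: Beta_def intro!: divide_nonneg_nonneg Gamma_real_nonneg)
    then show ?thesis using rt by (simp add: ennreal_mult mult.assoc)
  qed
  also have "(t - r) * (t - r) powr (p + q - 2) = (t - r) powr (p + q - 1)"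
  proof -
    have "(t - r) powr (p + q - 1) = (t - r) powr (p + q - 2 + 1)" by (simp add: algebra_simps)
    then show ?thesis using rt by (simp only: powr_add) simp
  qed
  finally show ?thesis .
qed

context
  fixes H :: real
  assumes H: "0 < H" "H < 1/2"
begin

lemma half_minus_Hurst: "0 < 1/2 - H" "1/2 - H < 1/2"
  using H by auto

text \<open>
  The choice in the definition of the hypergeometric function has a witness, namely
  \<open>hypergeometric_extension\<close>.
\<close>
lemma gauss_hypergeometric_spec:
  defines "f \<equiv> gauss_hypergeometric (of_real (H - 1/2)) (of_real (1/2 - H)) (of_real (H + 1/2))"
  shows "f holomorphic_on slit_plane"
    and "norm w < 1 \<Longrightarrow> (\<lambda>n. pochhammer (- of_real (1/2 - H)) n * pochhammer (of_real (1/2 - H)) n /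
          (pochhammer (1 - of_real (1/2 - H)) n * fact n) * w ^ n) sums f w"
proof -
  have e: "complex_of_real (H - 1/2) = - of_real (1/2 - H)" "complex_of_real (H + 1/2) = 1 - of_real (1/2 - H)"
    by (auto simp: complex_eq_iff)
  let ?P = "\<lambda>f. f holomorphic_on slit_plane \<and> (\<forall>w\<in>ball 0 1. (\<lambda>n. pochhammer (- of_real (1/2 - H)) n * pochhammer (of_real (1/2 - H)) n /
          (pochhammer (1 - of_real (1/2 - H)) n * fact n) * w ^ n) sums f w)"
  have "?P (hypergeometric_extension (1/2 - H))"
    using hypergeometric_extension_holomorphic[OF half_minus_Hurst] hypergeometric_extension_sums[OF half_minus_Hurst] by auto
  then have "?P (SOME f. ?P f)" by (rule someI[of ?P])
  moreover have "f = (SOME f. ?P f)"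
    unfolding f_def gauss_hypergeometric_def e by (simp add: fun_eq_iff)
  ultimately have P: "?P f" by simp
  then show "f holomorphic_on slit_plane" by blast
  show "(\<lambda>n. pochhammer (- of_real (1/2 - H)) n * pochhammer (of_real (1/2 - H)) n /
          (pochhammer (1 - of_real (1/2 - H)) n * fact n) * w ^ n) sums f w" if "norm w < 1"
    using P that by simp
qed

text \<open>
  For \<open>x = t / s - 1\<close> the transformed argument \<open>x / (1 + x)\<close> is \<open>1 - s / t\<close>.
\<close>
lemma fbm_kernel_series:
  assumes st: "0 < s" "s < t"
  shows "fbm_kernel H t s = inverse (Gamma (H + 1/2)) * (t - s) powr (H - 1/2) *
     ((s / t) powr (1/2 - H) * (\<Sum>n. hyp_coeff (1/2 - H) n * (1 - s / t) ^ n))"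
proof -
  define x where "x = t / s - 1"
  have x: "0 < x" using st by (simp add: x_def)
  have x1: "1 + x = t / s" by (simp add: x_def)
  have xq: "x / (1 + x) = 1 - s / t" unfolding x1 using st by (simp add: x_def field_simps)
  have pw: "(1 + x) powr (- (1/2 - H)) = (s / t) powr (1/2 - H)"
    unfolding x1 powr_minus using st by (simp only: powr_divide less_imp_le inverse_divide)
  have "complex_of_real (1 - t / s) = - of_real x" by (simp add: x_def)
  then show ?thesis
    unfolding fbm_kernel_def
    using hypergeometric_negative_axis[OF half_minus_Hurst gauss_hypergeometric_spec x] st
    unfolding xq pw by simp
qed

lemma fbm_kernel_nonneg: "0 \<le> fbm_kernel H t s"
proof (cases "0 < s \<and> s < t")
  case True
  have w: "\<bar>1 - s / t\<bar> < 1" "0 \<le> 1 - s / t" using True by (auto simp: field_simps)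
  have "0 \<le> (\<Sum>n. hyp_coeff (1/2 - H) n * (1 - s / t) ^ n)"
    using hyp_summable[OF half_minus_Hurst w(1)] w(2)
    by (intro suminf_nonneg mult_nonneg_nonneg zero_le_power less_imp_le[OF hyp_coeff_pos[OF half_minus_Hurst]])
  then show ?thesis using True fbm_kernel_series[of s t] H
    by (auto intro!: mult_nonneg_nonneg Gamma_real_nonneg)
qed (auto simp: fbm_kernel_def)

text \<open>
  Beta integrals turn the coefficients of the kernel into those of the binomial series.
\<close>
lemma Gamma_hyp_coeff:
  "hyp_coeff (1/2 - H) n * Beta (real n + H + 1/2) (1/2 - H) =
    Gamma (H + 1/2) * Gamma (1/2 - H) * (pochhammer (1/2 - H) n / fact n)"
proof -
  have p: "pochhammer (H + 1/2) n = Gamma (H + 1/2 + real n) / Gamma (H + 1/2)"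
    using H nonpos_Ints_nonpos[of "H + 1/2"] by (intro pochhammer_Gamma) fastforce
  have pos: "Gamma (H + 1/2) > 0" "Gamma (H + 1/2 + real n) > 0" using H by (auto intro!: Gamma_real_pos)
  have e: "1 - (1/2 - H) = H + 1/2" "real n + H + 1/2 = H + 1/2 + real n"
     "H + 1/2 + real n + (1/2 - H) = 1 + real n" by auto
  have "a / (g' / g) * (g' * b / f) = g * b * (a / f)" if "g > 0" "g' > 0" for a b f g g' :: real
    using that by (simp add: field_simps)
  from this[OF pos] show ?thesis
    unfolding hyp_coeff_def Beta_def e p Gamma_fact .
qed

text \<open>
  All terms of \<open>fbm_kernel_series\<close> are nonnegative, so the series may be integrated term by
  term. Each term is a Beta integral over \<open>(r, t)\<close>, and by \<open>Gamma_hyp_coeff\<close> the sum is the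
  binomial series of \<open>(r / t) powr (H - 1/2)\<close>.
\<close>
lemma nn_integral_fbm_kernel:
  assumes rt: "0 < r" "r < t"
  shows "(\<integral>\<^sup>+s\<in>{r<..<t}. ennreal (fbm_kernel H t s * s powr (H - 1/2) * (s - r) powr (- 1/2 - H)) \<partial>lborel)
       = ennreal (Gamma (1/2 - H) * r powr (H - 1/2))"
proof -
  let ?g = "hyp_coeff (1/2 - H)"
  let ?G = "inverse (Gamma (H + 1/2))"
  have G: "?G > 0" using H by (auto intro!: Gamma_real_pos)
  define c where "c n = ?G * t powr (H - 1/2) * ?g n * inverse (t ^ n)" for n
  have c: "c n \<ge> 0" for n
    using G hyp_coeff_pos[OF half_minus_Hurst, of n] rt unfolding c_def by (auto intro!: mult_nonneg_nonneg)
  have pt: "ennreal (fbm_kernel H t s * s powr (H - 1/2) * (s - r) powr (- 1/2 - H)) * indicator {r<..<t} s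
      = (\<Sum>n. ennreal (c n) * (ennreal ((t - s) powr ((real n + H + 1/2) - 1) * (s - r) powr ((1/2 - H) - 1)) * indicator {r<..<t} s))" for s
  proof (cases "s \<in> {r<..<t}")
    case True
    then have s: "0 < s" "s < t" "r < s" using rt by auto
    have w: "\<bar>1 - s / t\<bar> < 1" using s by (auto simp: field_simps)
    have trm: "?G * (t - s) powr (H - 1/2) * ((s / t) powr (1/2 - H) * (?g n * (1 - s / t) ^ n)) * s powr (H - 1/2) * (s - r) powr (- 1/2 - H)
       = c n * ((t - s) powr ((real n + H + 1/2) - 1) * (s - r) powr ((1/2 - H) - 1))" for n
    proof -
      have 1: "(s / t) powr (1/2 - H) * s powr (H - 1/2) = t powr (H - 1/2)"
      proof -
        have "H - 1/2 = - (1/2 - H)" by simp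
        moreover have "(s / t) powr (1/2 - H) = s powr (1/2 - H) / t powr (1/2 - H)"
          by (rule powr_divide)
        moreover have "a / b * inverse a = inverse b" if "a \<noteq> 0" for a b :: real
          using that by (simp add: field_simps)
        moreover have "s powr (1/2 - H) \<noteq> 0" using s by simp
        ultimately show ?thesis by (simp only: powr_minus)
      qed
      have 2: "(t - s) powr ((real n + H + 1/2) - 1) = (t - s) powr (H - 1/2) * (t - s) ^ n"
      proof -
        have "(real n + H + 1/2) - 1 = (H - 1/2) + real n" by simp
        then show ?thesis using s by (simp only: powr_add) (simp add: powr_realpow)
      qed
      have 3: "(1 - s / t) ^ n = (t - s) ^ n * inverse (t ^ n)"
      proof -
        have "1 - s / t = (t - s) * inverse t" using s by (simp add: field_simps)
        then show ?thesis by (simp only: power_mult_distrib power_inverse)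
      qed
      have 4: "(1/2 - H) - 1 = - 1/2 - H" by simp
      show ?thesis unfolding 2 3 4 c_def 1[symmetric] by simp
    qed
    have "(\<lambda>n. ?g n * (1 - s / t) ^ n) sums (\<Sum>n. ?g n * (1 - s / t) ^ n)"
      using hyp_summable[OF half_minus_Hurst w] by (rule summable_sums)
    then have "(\<lambda>n. ?G * (t - s) powr (H - 1/2) * ((s / t) powr (1/2 - H) * (?g n * (1 - s / t) ^ n)) * s powr (H - 1/2) * (s - r) powr (- 1/2 - H))
       sums (fbm_kernel H t s * s powr (H - 1/2) * (s - r) powr (- 1/2 - H))"
      unfolding fbm_kernel_series[OF s(1,2)] by (intro sums_mult2 sums_mult)
    then have "(\<lambda>n. c n * ((t - s) powr ((real n + H + 1/2) - 1) * (s - r) powr ((1/2 - H) - 1)))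
       sums (fbm_kernel H t s * s powr (H - 1/2) * (s - r) powr (- 1/2 - H))"
      unfolding trm .
    moreover define X where "X n = (t - s) powr ((real n + H + 1/2) - 1) * (s - r) powr ((1/2 - H) - 1)" for n
    ultimately have sX: "(\<lambda>n. c n * X n) sums (fbm_kernel H t s * s powr (H - 1/2) * (s - r) powr (- 1/2 - H))"
      by simp
    have X: "0 \<le> X n" for n by (simp add: X_def)
    have "(\<Sum>n. ennreal (c n * X n)) = ennreal (fbm_kernel H t s * s powr (H - 1/2) * (s - r) powr (- 1/2 - H))"
      by (rule suminf_ennreal_eq[OF _ sX]) (intro mult_nonneg_nonneg c X)
    moreover have "ennreal (c n * X n) = ennreal (c n) * ennreal (X n)" for n
      by (rule ennreal_mult[OF c X])
    moreover have "indicator {r<..<t} s = (1 :: ennreal)" using True by simp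
    ultimately show ?thesis unfolding X_def[symmetric] by (simp only: mult_1_right)
  qed simp
  have sumb: "(\<lambda>n. pochhammer (1/2 - H) n / fact n * (1 - r / t) ^ n) sums ((r / t) powr (- (1/2 - H)))"
  proof -
    have w: "norm (complex_of_real (1 - r / t)) < 1" using rt by (simp add: norm_of_real del: of_real_diff)
    have "(1 - complex_of_real (1 - r / t)) powr (- of_real (1/2 - H)) = of_real ((r / t) powr (- (1/2 - H)))"
      using rt by (subst powr_of_real[symmetric]) auto
    with powr_one_minus_sums[OF w, of "of_real (1/2 - H)"]
    have "(\<lambda>n. complex_of_real (pochhammer (1/2 - H) n / fact n * (1 - r / t) ^ n)) sums of_real ((r / t) powr (- (1/2 - H)))"
      by (simp only: pochhammer_of_real of_real_mult of_real_divide of_real_power of_real_fact)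
    then show ?thesis by (simp only: sums_of_real_iff)
  qed
  have "(\<integral>\<^sup>+s\<in>{r<..<t}. ennreal (fbm_kernel H t s * s powr (H - 1/2) * (s - r) powr (- 1/2 - H)) \<partial>lborel)
     = (\<Sum>n. ennreal (c n) * (\<integral>\<^sup>+s. ennreal ((t - s) powr ((real n + H + 1/2) - 1) * (s - r) powr ((1/2 - H) - 1)) * indicator {r<..<t} s \<partial>lborel))"
    unfolding pt by (subst nn_integral_suminf) (auto intro!: suminf_cong nn_integral_cmult)
  also have "\<dots> = (\<Sum>n. ennreal (t powr (H - 1/2) * Gamma (1/2 - H) * (pochhammer (1/2 - H) n / fact n * (1 - r / t) ^ n)))"
  proof (rule suminf_cong)
    fix n
    have "(\<integral>\<^sup>+s. ennreal ((t - s) powr ((real n + H + 1/2) - 1) * (s - r) powr ((1/2 - H) - 1)) * indicator {r<..<t} s \<partial>lborel)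
      = ennreal ((t - r) powr ((real n + H + 1/2) + (1/2 - H) - 1) * Beta (real n + H + 1/2) (1/2 - H))"
      by (rule nn_integral_beta_scaled) (use H rt in auto)
    also have "(t - r) powr ((real n + H + 1/2) + (1/2 - H) - 1) = (t - r) ^ n"
      using rt by (simp add: powr_realpow)
    finally have i: "(\<integral>\<^sup>+s. ennreal ((t - s) powr ((real n + H + 1/2) - 1) * (s - r) powr ((1/2 - H) - 1)) * indicator {r<..<t} s \<partial>lborel)
       = ennreal ((t - r) ^ n * Beta (real n + H + 1/2) (1/2 - H))" .
    have "c n * ((t - r) ^ n * Beta (real n + H + 1/2) (1/2 - H))
       = ?G * t powr (H - 1/2) * (hyp_coeff (1/2 - H) n * Beta (real n + H + 1/2) (1/2 - H)) * ((t - r) ^ n * inverse (t ^ n))"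
      by (simp add: c_def)
    also have "\<dots> = t powr (H - 1/2) * Gamma (1/2 - H) * (pochhammer (1/2 - H) n / fact n * ((t - r) ^ n * inverse (t ^ n)))"
      unfolding Gamma_hyp_coeff using G by (simp add: field_simps)
    also have "(t - r) ^ n * inverse (t ^ n) = (1 - r / t) ^ n"
    proof -
      have "1 - r / t = (t - r) * inverse t" using rt by (simp add: field_simps)
      then show ?thesis by (simp only: power_mult_distrib power_inverse)
    qed
    finally show "ennreal (c n) * (\<integral>\<^sup>+s. ennreal ((t - s) powr ((real n + H + 1/2) - 1) * (s - r) powr ((1/2 - H) - 1)) * indicator {r<..<t} s \<partial>lborel)
       = ennreal (t powr (H - 1/2) * Gamma (1/2 - H) * (pochhammer (1/2 - H) n / fact n * (1 - r / t) ^ n))"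
      unfolding i using c[of n] by (simp add: ennreal_mult'[symmetric])
  qed
  also have "\<dots> = ennreal (t powr (H - 1/2) * Gamma (1/2 - H) * (r / t) powr (- (1/2 - H)))"
  proof (rule suminf_ennreal_eq)
    show "(\<lambda>n. t powr (H - 1/2) * Gamma (1/2 - H) * (pochhammer (1/2 - H) n / fact n * (1 - r / t) ^ n))
      sums (t powr (H - 1/2) * Gamma (1/2 - H) * (r / t) powr (- (1/2 - H)))"
      by (intro sums_mult sumb)
    show "0 \<le> t powr (H - 1/2) * Gamma (1/2 - H) * (pochhammer (1/2 - H) n / fact n * (1 - r / t) ^ n)" for n
      using H rt by (auto intro!: mult_nonneg_nonneg divide_nonneg_nonneg pochhammer_nonneg Gamma_real_nonneg zero_le_power)
  qed
  also have "t powr (H - 1/2) * Gamma (1/2 - H) * (r / t) powr (- (1/2 - H)) = Gamma (1/2 - H) * r powr (H - 1/2)"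
  proof -
    have "- (1/2 - H) = H - 1/2" by simp
    then show ?thesis using rt by (simp only: powr_divide) simp
  qed
  finally show ?thesis .
qed

end

section \<open>Inverting the kernel\<close>

text \<open>
  The density of the drift of \<open>W\<close> whose image under the kernel is the primitive of \<open>u\<close>: the
  Riemann-Liouville integral of order \<open>1/2 - H\<close>, conjugated with \<open>s powr (1/2 - H)\<close>.
\<close>
definition frac_drift :: "real \<Rightarrow> (real \<Rightarrow> real) \<Rightarrow> real \<Rightarrow> real" where
  "frac_drift H u s = inverse (Gamma (1/2 - H)) * s powr (H - 1/2) *
     (\<integral>r. indicator {0<..<s} r * (r powr (1/2 - H) * (s - r) powr (- 1/2 - H) * u r) \<partial>lborel)"

lemma borel_measurable_frac_drift:
  assumes [measurable]: "(\<lambda>(r, \<omega>). u \<omega> r) \<in> borel_measurable (borel \<Otimes>\<^sub>M N)"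
  shows "(\<lambda>(s, \<omega>). frac_drift H (u \<omega>) s) \<in> borel_measurable (borel \<Otimes>\<^sub>M N)"
proof -
  have [measurable]: "(\<lambda>p. u (snd (fst p)) (snd p)) \<in> borel_measurable ((borel \<Otimes>\<^sub>M N) \<Otimes>\<^sub>M borel)"
  proof -
    have "(\<lambda>p. (snd p, snd (fst p))) \<in> measurable ((borel \<Otimes>\<^sub>M N) \<Otimes>\<^sub>M borel) (borel \<Otimes>\<^sub>M N)"
      by measurable
    from measurable_compose[OF this assms] show ?thesis by simp
  qed
  show ?thesis
    unfolding frac_drift_def case_prod_beta' indicator_def greaterThanLessThan_iff
    by (intro borel_measurable_times lborel.borel_measurable_lebesgue_integral) measurable
qed

lemma borel_measurable_frac_drift' [measurable]:
  assumes [measurable]: "u \<in> borel_measurable borel"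
  shows "frac_drift H u \<in> borel_measurable borel"
proof -
  have "(\<lambda>(s, \<omega>). frac_drift H ((\<lambda>_::unit. u) \<omega>) s) \<in> borel_measurable (borel \<Otimes>\<^sub>M count_space UNIV)"
    by (rule borel_measurable_frac_drift) measurable
  then have "(\<lambda>s. case (s, ()) of (s, \<omega>) \<Rightarrow> frac_drift H u s) \<in> borel_measurable borel"
    by (rule measurable_compose[rotated]) simp
  then show ?thesis by simp
qed

lemma frac_drift_zero [simp]: "frac_drift H u 0 = 0"
  by (simp add: frac_drift_def)

context
  fixes H :: real
  assumes H: "0 < H" "H < 1/2"
begin

lemma nn_integral_frac_weight:
  assumes s: "0 < s"
  shows "(\<integral>\<^sup>+r\<in>{0<..<s}. ennreal (r powr (1/2 - H) * (s - r) powr (- 1/2 - H)) \<partial>lborel)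
       = ennreal (s powr (1 - 2 * H) * Beta (3/2 - H) (1/2 - H))"
proof -
  have "(\<integral>\<^sup>+r\<in>{0<..<s}. ennreal ((s - r) powr ((1/2 - H) - 1) * (r - 0) powr ((3/2 - H) - 1)) \<partial>lborel)
      = ennreal ((s - 0) powr ((1/2 - H) + (3/2 - H) - 1) * Beta (1/2 - H) (3/2 - H))"
    by (rule nn_integral_beta_scaled) (use H s in auto)
  moreover have "(1/2 - H) - 1 = - 1/2 - H" "(3/2 - H) - 1 = 1/2 - H" "(1/2 - H) + (3/2 - H) - 1 = 1 - 2 * H" by auto
  ultimately show ?thesis by (simp only: Beta_commute[of "1/2 - H"] diff_0_right mult.commute)
qed

lemma integrable_frac_weight:
  assumes [measurable]: "u \<in> borel_measurable borel" and u: "\<And>r. 0 < r \<Longrightarrow> r < s \<Longrightarrow> \<bar>u r\<bar> \<le> c" and s: "0 < s"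
  shows "integrable lborel (\<lambda>r. indicator {0<..<s} r * (r powr (1/2 - H) * (s - r) powr (- 1/2 - H) * u r))" (is "integrable _ ?f")
    and "\<bar>\<integral>r. indicator {0<..<s} r * (r powr (1/2 - H) * (s - r) powr (- 1/2 - H) * u r) \<partial>lborel\<bar>
      \<le> c * (s powr (1 - 2 * H) * Beta (3/2 - H) (1/2 - H))"
proof -
  have c: "c \<ge> 0" using u[of "s/2"] s by auto
  have B: "0 \<le> Beta (3/2 - H) (1/2 - H)"
    using H by (auto simp: Beta_def intro!: divide_nonneg_nonneg Gamma_real_nonneg)
  have nn: "(\<integral>\<^sup>+r. ennreal (norm (?f r)) \<partial>lborel) \<le> ennreal (c * (s powr (1 - 2 * H) * Beta (3/2 - H) (1/2 - H)))"
  proof -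
    have "(\<integral>\<^sup>+r. ennreal (norm (?f r)) \<partial>lborel) \<le>
       (\<integral>\<^sup>+r. ennreal c * (ennreal (r powr (1/2 - H) * (s - r) powr (- 1/2 - H)) * indicator {0<..<s} r) \<partial>lborel)"
    proof (rule nn_integral_mono)
      fix r :: real
      show "ennreal (norm (?f r)) \<le> ennreal c * (ennreal (r powr (1/2 - H) * (s - r) powr (- 1/2 - H)) * indicator {0<..<s} r)"
        using u[of r] c by (auto simp: indicator_def abs_mult ennreal_mult[symmetric] mult.commute[of c] intro!: ennreal_leI mult_left_mono)
    qed
    also have "\<dots> = ennreal c * ennreal (s powr (1 - 2 * H) * Beta (3/2 - H) (1/2 - H))"
      using nn_integral_frac_weight[OF s] by (subst nn_integral_cmult) auto
    finally show ?thesis using c by (simp add: ennreal_mult')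
  qed
  show int: "integrable lborel ?f"
  proof (rule integrableI_bounded)
    show "(\<integral>\<^sup>+r. ennreal (norm (?f r)) \<partial>lborel) < \<infinity>"
      using nn by (rule order.strict_trans1) simp
  qed measurable
  have "ennreal (norm (\<integral>r. ?f r \<partial>lborel)) \<le> ennreal (c * (s powr (1 - 2 * H) * Beta (3/2 - H) (1/2 - H)))"
    using integral_norm_bound_ennreal[OF int] nn by (rule order_trans)
  then show "\<bar>\<integral>r. ?f r \<partial>lborel\<bar> \<le> c * (s powr (1 - 2 * H) * Beta (3/2 - H) (1/2 - H))"
    using c B by (subst (asm) ennreal_le_iff) auto
qed

text \<open>
  A Beta integral, which is where the quotient of Beta and Gamma values in the constant comes
  from.
\<close>
lemma abs_frac_drift_le:
  assumes u: "u \<in> borel_measurable borel" "\<And>r. 0 < r \<Longrightarrow> r < s \<Longrightarrow> \<bar>u r\<bar> \<le> c" and s: "0 \<le> s"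
  shows "\<bar>frac_drift H u s\<bar> \<le> c * (Beta (3/2 - H) (1/2 - H) / Gamma (1/2 - H)) * s powr (1/2 - H)"
proof (cases "s = 0")
  case False
  with s have s: "0 < s" by simp
  have G: "Gamma (1/2 - H) > 0" using H by (auto intro!: Gamma_real_pos)
  let ?I = "\<integral>r. indicator {0<..<s} r * (r powr (1/2 - H) * (s - r) powr (- 1/2 - H) * u r) \<partial>lborel"
  have "\<bar>frac_drift H u s\<bar> = inverse (Gamma (1/2 - H)) * s powr (H - 1/2) * \<bar>?I\<bar>"
    unfolding frac_drift_def using G by (simp add: abs_mult)
  also have "\<dots> \<le> inverse (Gamma (1/2 - H)) * s powr (H - 1/2) * (c * (s powr (1 - 2 * H) * Beta (3/2 - H) (1/2 - H)))"
    using G integrable_frac_weight(2)[OF u s] by (intro mult_left_mono) auto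
  also have "\<dots> = c * (Beta (3/2 - H) (1/2 - H) / Gamma (1/2 - H)) * (s powr (H - 1/2) * s powr (1 - 2 * H))"
    by (simp only: divide_inverse mult_ac)
  also have "s powr (H - 1/2) * s powr (1 - 2 * H) = s powr (1/2 - H)"
    by (simp add: powr_add[symmetric])
  finally show ?thesis .
qed simp

text \<open>
  By Fubini's theorem the integral over \<open>s\<close> may be taken first, and it is evaluated by
  \<open>nn_integral_fbm_kernel\<close>. All factors besides \<open>u\<close> are nonnegative, so integrability is the same
  computation with \<open>\<bar>u\<bar>\<close> in the place of \<open>u\<close>.
\<close>
lemma integral_fbm_kernel_frac_drift:
  assumes [measurable]: "u \<in> borel_measurable borel" "fbm_kernel H t \<in> borel_measurable borel"
    and u: "\<And>r. 0 < r \<Longrightarrow> r < t \<Longrightarrow> \<bar>u r\<bar> \<le> c" and t: "0 < t"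
  shows "(\<integral>s. indicator {0<..<t} s * (fbm_kernel H t s * frac_drift H u s) \<partial>lborel) = (\<integral>r. indicator {0<..<t} r * u r \<partial>lborel)"
proof -
  have G: "Gamma (1/2 - H) > 0" using H by (auto intro!: Gamma_real_pos)
  have c: "c \<ge> 0" using u[of "t/2"] t by auto
  define w where "w s r = (if 0 < r \<and> r < s \<and> s < t then fbm_kernel H t s * s powr (H - 1/2) * (s - r) powr (- 1/2 - H) else 0)" for s r
  define g where "g s r = inverse (Gamma (1/2 - H)) * (r powr (1/2 - H) * u r) * w s r" for s r
  have wm[measurable]: "(\<lambda>p. w (fst p) (snd p)) \<in> borel_measurable (lborel \<Otimes>\<^sub>M lborel)"
    unfolding w_def by measurable
  have wm'[measurable]: "(\<lambda>s. w s r) \<in> borel_measurable borel" for r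
    unfolding w_def by measurable
  have gm[measurable]: "(\<lambda>p. g (fst p) (snd p)) \<in> borel_measurable (lborel \<Otimes>\<^sub>M lborel)"
    unfolding g_def by measurable
  have w0: "0 \<le> w s r" for s r
    unfolding w_def using fbm_kernel_nonneg[OF H] by auto
  have nw: "(\<integral>\<^sup>+s. ennreal (w s r) \<partial>lborel) = ennreal (Gamma (1/2 - H) * r powr (H - 1/2)) * indicator {0<..<t} r" for r
  proof (cases "0 < r \<and> r < t")
    case True
    then have "ennreal (w s r) = ennreal (fbm_kernel H t s * s powr (H - 1/2) * (s - r) powr (- 1/2 - H)) * indicator {r<..<t} s" for s
      by (auto simp: w_def indicator_def)
    then show ?thesis using nn_integral_fbm_kernel[OF H, of r t] True by simp
  next
    case False
    then have "w s r = 0" for s by (auto simp: w_def)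
    then show ?thesis using False by (simp add: indicator_def)
  qed
  have int_w: "integrable lborel (\<lambda>s. w s r)" and iw: "(\<integral>s. w s r \<partial>lborel) = Gamma (1/2 - H) * r powr (H - 1/2) * indicator {0<..<t} r" for r
  proof -
    have "(\<integral>\<^sup>+s. ennreal (w s r) \<partial>lborel) = ennreal (Gamma (1/2 - H) * r powr (H - 1/2) * indicator {0<..<t} r)"
      unfolding nw by (auto simp: indicator_def)
    then have "has_bochner_integral lborel (\<lambda>s. w s r) (Gamma (1/2 - H) * r powr (H - 1/2) * indicator {0<..<t} r)"
      using G w0 by (intro has_bochner_integral_nn_integral) (auto intro: mult_nonneg_nonneg)
    then show "integrable lborel (\<lambda>s. w s r)" "(\<integral>s. w s r \<partial>lborel) = Gamma (1/2 - H) * r powr (H - 1/2) * indicator {0<..<t} r"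
      by (auto simp: has_bochner_integral_iff)
  qed
  have cancel: "inverse (Gamma (1/2 - H)) * r powr (1/2 - H) * (Gamma (1/2 - H) * r powr (H - 1/2)) = 1" if "r > 0" for r
  proof -
    have "r powr (1/2 - H) * r powr (H - 1/2) = 1" using that by (simp add: powr_add[symmetric])
    then show ?thesis using G by (simp add: field_simps)
  qed
  have int: "integrable (lborel \<Otimes>\<^sub>M lborel) (\<lambda>(s, r). g s r)"
  proof (rule integrableI_bounded)
    have "(\<integral>\<^sup>+p. ennreal (norm (case p of (s, r) \<Rightarrow> g s r)) \<partial>(lborel \<Otimes>\<^sub>M lborel))
        = (\<integral>\<^sup>+r. \<integral>\<^sup>+s. ennreal (norm (g s r)) \<partial>lborel \<partial>lborel)"
      by (subst lborel_pair.nn_integral_snd[symmetric]) (auto simp: case_prod_beta')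
    also have "\<dots> = (\<integral>\<^sup>+r. ennreal (\<bar>u r\<bar>) * indicator {0<..<t} r \<partial>lborel)"
    proof (rule nn_integral_cong)
      fix r :: real
      have "(\<integral>\<^sup>+s. ennreal (norm (g s r)) \<partial>lborel) = (\<integral>\<^sup>+s. ennreal (inverse (Gamma (1/2 - H)) * (r powr (1/2 - H) * \<bar>u r\<bar>)) * ennreal (w s r) \<partial>lborel)"
        unfolding g_def using G w0 by (intro nn_integral_cong) (simp add: abs_mult ennreal_mult[symmetric])
      also have "\<dots> = ennreal (inverse (Gamma (1/2 - H)) * (r powr (1/2 - H) * \<bar>u r\<bar>)) * (\<integral>\<^sup>+s. ennreal (w s r) \<partial>lborel)"
        by (rule nn_integral_cmult) (simp add: w_def)
      also have "\<dots> = ennreal (\<bar>u r\<bar>) * indicator {0<..<t} r"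
      proof (cases "0 < r \<and> r < t")
        case True
        have "inverse (Gamma (1/2 - H)) * (r powr (1/2 - H) * \<bar>u r\<bar>) * (Gamma (1/2 - H) * r powr (H - 1/2)) = \<bar>u r\<bar>"
          using cancel[of r] True by (simp add: mult_ac)
        then show ?thesis unfolding nw using True G by (simp add: ennreal_mult[symmetric])
      qed (auto simp: nw indicator_def)
      finally show "(\<integral>\<^sup>+s. ennreal (norm (g s r)) \<partial>lborel) = ennreal (\<bar>u r\<bar>) * indicator {0<..<t} r" .
    qed
    also have "\<dots> \<le> (\<integral>\<^sup>+r. ennreal c * indicator {0<..<t} r \<partial>lborel)"
      using u by (intro nn_integral_mono) (auto simp: indicator_def intro!: ennreal_leI)
    also have "\<dots> < \<infinity>"
      using t by (subst nn_integral_cmult_indicator) (auto simp: ennreal_mult_less_top)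
    finally show "(\<integral>\<^sup>+p. ennreal (norm (case p of (s, r) \<Rightarrow> g s r)) \<partial>(lborel \<Otimes>\<^sub>M lborel)) < \<infinity>" .
  qed (simp add: case_prod_beta')
  have "(\<integral>s. indicator {0<..<t} s * (fbm_kernel H t s * frac_drift H u s) \<partial>lborel) = (\<integral>s. (\<integral>r. g s r \<partial>lborel) \<partial>lborel)"
  proof (rule Bochner_Integration.integral_cong[OF refl])
    fix s :: real
    have "indicator {0<..<t} s * (fbm_kernel H t s * frac_drift H u s)
       = (\<integral>r. indicator {0<..<t} s * (fbm_kernel H t s * (inverse (Gamma (1/2 - H)) * s powr (H - 1/2) * 
           (indicator {0<..<s} r * (r powr (1/2 - H) * (s - r) powr (- 1/2 - H) * u r)))) \<partial>lborel)"
      unfolding frac_drift_def by simp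
    also have "\<dots> = (\<integral>r. g s r \<partial>lborel)"
      by (rule Bochner_Integration.integral_cong) (auto simp: g_def w_def indicator_def)
    finally show "indicator {0<..<t} s * (fbm_kernel H t s * frac_drift H u s) = (\<integral>r. g s r \<partial>lborel)" .
  qed
  also have "\<dots> = (\<integral>r. (\<integral>s. g s r \<partial>lborel) \<partial>lborel)"
    by (rule lborel_pair.Fubini_integral[OF int, symmetric])
  also have "\<dots> = (\<integral>r. indicator {0<..<t} r * u r \<partial>lborel)"
  proof (rule Bochner_Integration.integral_cong[OF refl])
    fix r :: real
    have "(\<integral>s. g s r \<partial>lborel) = inverse (Gamma (1/2 - H)) * (r powr (1/2 - H) * u r) * (Gamma (1/2 - H) * r powr (H - 1/2) * indicator {0<..<t} r)"
      unfolding g_def iw[symmetric] by simp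
    also have "\<dots> = (inverse (Gamma (1/2 - H)) * r powr (1/2 - H) * (Gamma (1/2 - H) * r powr (H - 1/2))) * (indicator {0<..<t} r * u r)"
      by (simp only: mult_ac)
    also have "\<dots> = indicator {0<..<t} r * u r"
      using cancel[of r] by (cases "r > 0") (auto simp: indicator_def)
    finally show "(\<integral>s. g s r \<partial>lborel) = indicator {0<..<t} r * u r" .
  qed
  finally show ?thesis .
qed

end

text \<open>
  The bound \<open>\<bar>x\<bar> \<le> e + x\<^sup>2 / e\<close> estimates an \<open>L\<^sup>1\<close> distance on a bounded interval by the \<open>L\<^sup>2\<close>
  distance; it is used with \<open>e\<close> slightly larger than the \<open>L\<^sup>2\<close> distance.
\<close>
lemma tendsto_integral_mult_of_L2:
  fixes g v :: "real \<Rightarrow> real" and \<phi> :: "nat \<Rightarrow> real \<Rightarrow> real"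
  assumes L2: "(\<lambda>n. \<integral>\<^sup>+s\<in>{0..t}. ennreal ((g s - \<phi> n s)\<^sup>2) \<partial>lborel) \<longlonglongrightarrow> 0"
    and [measurable]: "(\<lambda>s. indicator {0..t} s * g s) \<in> borel_measurable borel" "\<And>n. \<phi> n \<in> borel_measurable borel" "v \<in> borel_measurable borel"
    and v: "\<And>s. 0 \<le> s \<Longrightarrow> s \<le> t \<Longrightarrow> \<bar>v s\<bar> \<le> k" and t: "0 \<le> t"
    and int: "\<And>n. integrable lborel (\<lambda>s. indicator {0..t} s * (\<phi> n s * v s))"
  shows "(\<lambda>n. \<integral>s. indicator {0..t} s * (\<phi> n s * v s) \<partial>lborel) \<longlonglongrightarrow> (\<integral>s. indicator {0..t} s * (g s * v s) \<partial>lborel)"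
proof -
  have k: "k \<ge> 0" using v[of 0] t by auto
  let ?d = "\<lambda>n s. indicator {0..t} s * ((g s - \<phi> n s) * v s)"
  have gv[measurable]: "(\<lambda>s. indicator {0..t} s * (g s * v s)) \<in> borel_measurable borel"
  proof -
    have "(\<lambda>s. (indicator {0..t} s * g s) * v s) \<in> borel_measurable borel" by measurable
    then show ?thesis by (simp add: mult.assoc)
  qed
  have dm[measurable]: "?d n \<in> borel_measurable borel" for n
  proof -
    have "(\<lambda>s. indicator {0..t} s * (g s * v s) - indicator {0..t} s * (\<phi> n s * v s)) \<in> borel_measurable borel" by measurable
    then show ?thesis by (simp add: algebra_simps)
  qed
  have dsqm[measurable]: "(\<lambda>s. ennreal ((g s - \<phi> n s)\<^sup>2) * indicator {0..t} s) \<in> borel_measurable borel" for n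
  proof -
    have "(\<lambda>s. ennreal ((indicator {0..t} s * g s - indicator {0..t} s * \<phi> n s)\<^sup>2)) \<in> borel_measurable borel" by measurable
    also have "(\<lambda>s. ennreal ((indicator {0..t} s * g s - indicator {0..t} s * \<phi> n s)\<^sup>2)) = (\<lambda>s. ennreal ((g s - \<phi> n s)\<^sup>2) * indicator {0..t} s)"
      by (auto simp: indicator_def)
    finally show ?thesis .
  qed
  have bound: "(\<integral>\<^sup>+s. ennreal (norm (?d n s)) \<partial>lborel) \<le> ennreal (k * e * t) + ennreal (k / e) * (\<integral>\<^sup>+s\<in>{0..t}. ennreal ((g s - \<phi> n s)\<^sup>2) \<partial>lborel)"
    if e: "e > 0" for n e
  proof -
    have "(\<integral>\<^sup>+s. ennreal (norm (?d n s)) \<partial>lborel) \<le> (\<integral>\<^sup>+s. ennreal (k * e) * indicator {0..t} s + ennreal (k / e) * (ennreal ((g s - \<phi> n s)\<^sup>2) * indicator {0..t} s) \<partial>lborel)"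
    proof (rule nn_integral_mono)
      fix s :: real
      have am: "\<bar>x\<bar> \<le> e + x\<^sup>2 / e" for x :: real
      proof (cases "\<bar>x\<bar> \<le> e")
        case False
        then have "\<bar>x\<bar> * e \<le> \<bar>x\<bar> * \<bar>x\<bar>" by (intro mult_left_mono) auto
        then have "\<bar>x\<bar> \<le> x\<^sup>2 / e" using e by (simp add: field_simps power2_eq_square)
        then show ?thesis using e by simp
      qed (use e in \<open>simp add: add_increasing2\<close>)
      have "\<bar>(g s - \<phi> n s) * v s\<bar> \<le> k * e + k / e * (g s - \<phi> n s)\<^sup>2" if "s \<in> {0..t}"
      proof -
        have "\<bar>(g s - \<phi> n s) * v s\<bar> \<le> (e + (g s - \<phi> n s)\<^sup>2 / e) * k"
          unfolding abs_mult using v[of s] that e am[of "g s - \<phi> n s"] by (intro mult_mono) auto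
        then show ?thesis by (simp add: algebra_simps)
      qed
      then show "ennreal (norm (?d n s)) \<le> ennreal (k * e) * indicator {0..t} s + ennreal (k / e) * (ennreal ((g s - \<phi> n s)\<^sup>2) * indicator {0..t} s)"
        using k e by (auto simp: indicator_def ennreal_mult[symmetric] ennreal_plus[symmetric] simp del: ennreal_plus intro!: ennreal_leI)
    qed
    also have "\<dots> = ennreal (k * e) * ennreal t + ennreal (k / e) * (\<integral>\<^sup>+s\<in>{0..t}. ennreal ((g s - \<phi> n s)\<^sup>2) \<partial>lborel)"
      using t by (subst nn_integral_add) (auto simp: nn_integral_cmult nn_integral_cmult_indicator)
    finally show ?thesis using k e t by (simp add: ennreal_mult)
  qed
  define S where "S n = (\<integral>\<^sup>+s\<in>{0..t}. ennreal ((g s - \<phi> n s)\<^sup>2) \<partial>lborel)" for n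
  \<comment> \<open>The summand \<open>1 / real (Suc n)\<close> keeps \<open>e n\<close> positive when the \<open>L\<^sup>2\<close> distance vanishes.\<close>
  define e where "e n = sqrt (enn2real (S n)) + 1 / real (Suc n)" for n
  have S0: "S \<longlonglongrightarrow> 0" using L2 unfolding S_def .
  have e0: "e n > 0" for n unfolding e_def by (intro add_nonneg_pos) auto
  have "(\<lambda>n. sqrt (enn2real (S n))) \<longlonglongrightarrow> sqrt (enn2real 0)"
    by (intro tendsto_real_sqrt tendsto_enn2real) (use S0 in simp_all)
  then have elim0: "e \<longlonglongrightarrow> 0"
    unfolding e_def using tendsto_add[OF _ LIMSEQ_inverse_real_of_nat] by (fastforce simp: inverse_eq_divide)
  have le: "eventually (\<lambda>n. (\<integral>\<^sup>+s. ennreal (norm (?d n s)) \<partial>lborel) \<le> ennreal (k * (t + 1) * e n)) sequentially"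
  proof -
    have "eventually (\<lambda>n. S n < \<infinity>) sequentially"
      using S0 by (rule order_tendstoD) simp
    then show ?thesis
    proof (rule eventually_mono)
      fix n assume "S n < \<infinity>"
      then have S: "S n = ennreal (enn2real (S n))" by simp
      have "enn2real (S n) = sqrt (enn2real (S n)) * sqrt (enn2real (S n))" by simp
      also have "\<dots> \<le> e n * e n" unfolding e_def by (intro mult_mono) auto
      finally have q: "enn2real (S n) / e n \<le> e n" using e0[of n] by (simp add: field_simps)
      have "(\<integral>\<^sup>+s. ennreal (norm (?d n s)) \<partial>lborel) \<le> ennreal (k * e n * t) + ennreal (k / e n) * ennreal (enn2real (S n))"
        using bound[OF e0[of n], of n] unfolding S_def[symmetric] S[symmetric] .
      also have "\<dots> = ennreal (k * e n * t + k * (enn2real (S n) / e n))"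
        using k t e0[of n] by (simp add: ennreal_mult[symmetric] ennreal_plus[symmetric] del: ennreal_plus)
      also have "\<dots> \<le> ennreal (k * (t + 1) * e n)"
        using mult_left_mono[OF q k] by (intro ennreal_leI) (simp add: algebra_simps)
      finally show "(\<integral>\<^sup>+s. ennreal (norm (?d n s)) \<partial>lborel) \<le> ennreal (k * (t + 1) * e n)" .
    qed
  qed
  have "(\<lambda>n. (\<integral>s. indicator {0..t} s * (g s * v s) \<partial>lborel) - (\<integral>s. indicator {0..t} s * (\<phi> n s * v s) \<partial>lborel)) \<longlonglongrightarrow> 0"
  proof (rule tendsto_rabs_zero_cancel, rule tendsto_sandwich[OF always_eventually _ tendsto_const])
    show "(\<lambda>n. k * (t + 1) * e n) \<longlonglongrightarrow> 0"
      using tendsto_mult_right_zero[OF elim0] .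
    show "eventually (\<lambda>n. \<bar>(\<integral>s. indicator {0..t} s * (g s * v s) \<partial>lborel) - (\<integral>s. indicator {0..t} s * (\<phi> n s * v s) \<partial>lborel)\<bar> \<le> k * (t + 1) * e n) sequentially"
      using le
    proof (rule eventually_mono)
      fix n assume le: "(\<integral>\<^sup>+s. ennreal (norm (?d n s)) \<partial>lborel) \<le> ennreal (k * (t + 1) * e n)"
      then have "(\<integral>\<^sup>+s. ennreal (norm (?d n s)) \<partial>lborel) < \<infinity>" by (rule order.strict_trans1) simp
      then have id: "integrable lborel (?d n)" by (intro integrableI_bounded) auto
      have "(\<lambda>s. indicator {0..t} s * (g s * v s)) = (\<lambda>s. ?d n s + indicator {0..t} s * (\<phi> n s * v s))"
        by (auto simp: algebra_simps)
      then have "(\<integral>s. indicator {0..t} s * (g s * v s) \<partial>lborel) = (\<integral>s. ?d n s \<partial>lborel) + (\<integral>s. indicator {0..t} s * (\<phi> n s * v s) \<partial>lborel)"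
        using id int[of n] by simp
      moreover have "ennreal (norm (\<integral>s. ?d n s \<partial>lborel)) \<le> ennreal (k * (t + 1) * e n)"
        using integral_norm_bound_ennreal[OF id] le by (rule order_trans)
      moreover have "0 \<le> k * (t + 1) * e n" using k t e0[of n] by (intro mult_nonneg_nonneg) auto
      ultimately show "\<bar>(\<integral>s. indicator {0..t} s * (g s * v s) \<partial>lborel) - (\<integral>s. indicator {0..t} s * (\<phi> n s * v s) \<partial>lborel)\<bar> \<le> k * (t + 1) * e n"
        by (simp add: ennreal_le_iff)
    qed
  qed simp
  from tendsto_diff[OF tendsto_const this, of "\<integral>s. indicator {0..t} s * (g s * v s) \<partial>lborel"]
  show ?thesis by simp
qed

section \<open>The Euler scheme\<close>

definition drift_step :: "(real \<Rightarrow> real \<Rightarrow> real) \<Rightarrow> real \<Rightarrow> real \<Rightarrow> real \<Rightarrow> real" where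
  "drift_step b r t x = (\<integral>s. indicator {r<..t} s * b s x \<partial>lborel)"

text \<open>
  In each step the state is frozen but the drift is integrated exactly in time, because \<open>b\<close> is
  merely measurable in time. The driving path enters through its values \<open>w j\<close> on the grid.
\<close>
primrec euler :: "(real \<Rightarrow> real \<Rightarrow> real) \<Rightarrow> real \<Rightarrow> real \<Rightarrow> (nat \<Rightarrow> real) \<Rightarrow> nat \<Rightarrow> real" where
  "euler b \<delta> x w 0 = x + w 0"
| "euler b \<delta> x w (Suc k) =
     euler b \<delta> x w k + drift_step b (real k * \<delta>) (real (Suc k) * \<delta>) (euler b \<delta> x w k) + (w (Suc k) - w k)"

text \<open>
  The conditions are imposed for all times; a drift given on \<open>[0, T]\<close> is extended by 0.
\<close>
locale lipschitz_drift =
  fixes b :: "real \<Rightarrow> real \<Rightarrow> real" and K c0 :: real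
  assumes b_measurable: "(\<lambda>p. b (fst p) (snd p)) \<in> borel_measurable (borel \<Otimes>\<^sub>M borel)"
    and K_pos: "0 < K"
    and b_lipschitz: "\<bar>b t x - b t y\<bar> \<le> K * \<bar>x - y\<bar>"
    and b_zero: "\<bar>b t 0\<bar> \<le> c0"
begin

lemma b_comp_measurable [measurable (raw)]:
  assumes "f \<in> borel_measurable N" "g \<in> borel_measurable N"
  shows "(\<lambda>x. b (f x) (g x)) \<in> borel_measurable N"
  using measurable_compose[OF measurable_Pair[OF assms] b_measurable] by simp

lemma b_bound: "\<bar>b t x\<bar> \<le> c0 + K * \<bar>x\<bar>"
  using b_lipschitz[of t x 0] b_zero[of t] by simp

lemma integrable_drift:
  assumes [measurable]: "z \<in> borel_measurable borel" "A \<in> sets borel"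
    and A: "emeasure lborel A < \<infinity>" and R: "\<And>s. s \<in> A \<Longrightarrow> \<bar>z s\<bar> \<le> R"
  shows "integrable lborel (\<lambda>s. indicator A s * b s (z s))"
proof (rule Bochner_Integration.integrable_bound)
  show "integrable lborel (\<lambda>s. indicator A s * (c0 + K * R))"
    using A by simp
  show "AE s in lborel. norm (indicator A s * b s (z s)) \<le> norm (indicator A s * (c0 + K * R))"
  proof (rule AE_I2)
    fix s
    show "norm (indicator A s * b s (z s)) \<le> norm (indicator A s * (c0 + K * R))"
    proof (cases "s \<in> A")
      case True
      have "\<bar>b s (z s)\<bar> \<le> c0 + K * \<bar>z s\<bar>" by (rule b_bound)
      also have "\<dots> \<le> c0 + K * R" using R[OF True] K_pos by simp
      finally show ?thesis using True by simp
    qed simp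
  qed
qed measurable

lemma drift_step_lipschitz:
  assumes "r \<le> t"
  shows "\<bar>drift_step b r t x - drift_step b r t y\<bar> \<le> K * (t - r) * \<bar>x - y\<bar>"
proof -
  have ix: "integrable lborel (\<lambda>s. indicator {r<..t} s * b s x)" for x
    by (rule integrable_drift[of "\<lambda>_. x" _ "\<bar>x\<bar>"]) (use assms in auto)
  have "drift_step b r t x - drift_step b r t y = (\<integral>s. indicator {r<..t} s * (b s x - b s y) \<partial>lborel)"
    unfolding drift_step_def using ix[of x] ix[of y] by (simp add: right_diff_distrib)
  also have "\<bar>\<dots>\<bar> \<le> (\<integral>s. indicator {r<..t} s * (K * \<bar>x - y\<bar>) \<partial>lborel)"
  proof (rule order_trans[OF integral_abs_bound integral_mono])
    show "integrable lborel (\<lambda>s. \<bar>indicator {r<..t} s * (b s x - b s y)\<bar>)"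
      using ix[of x] ix[of y] by (intro integrable_abs) (simp add: right_diff_distrib)
    show "integrable lborel (\<lambda>s. indicator {r<..t} s * (K * \<bar>x - y\<bar>))" using assms by simp
    show "\<bar>indicator {r<..t} s * (b s x - b s y)\<bar> \<le> indicator {r<..t} s * (K * \<bar>x - y\<bar>)" for s
      using b_lipschitz by (simp add: indicator_def)
  qed
  also have "\<dots> = K * (t - r) * \<bar>x - y\<bar>" using assms by simp
  finally show ?thesis .
qed

lemma continuous_drift_step: assumes "r \<le> t" shows "continuous_on UNIV (drift_step b r t)"
proof (rule continuous_on_subset[OF lipschitz_on_continuous_on[of "K * (t - r)"]])
  show "(K * (t - r))-lipschitz_on UNIV (drift_step b r t)"
    using drift_step_lipschitz[OF assms] K_pos assms by (intro lipschitz_onI) (auto simp: dist_real_def)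
qed simp

lemma borel_measurable_drift_step [measurable]: assumes "r \<le> t" shows "drift_step b r t \<in> borel_measurable borel"
  using continuous_drift_step[OF assms] by (rule borel_measurable_continuous_onI)

lemma tendsto_euler:
  assumes \<delta>: "0 \<le> \<delta>" and w: "\<And>j. j \<le> k \<Longrightarrow> ((\<lambda>m. w' m j) \<longlongrightarrow> w j) F"
  shows "((\<lambda>m. euler b \<delta> x (w' m) k) \<longlongrightarrow> euler b \<delta> x w k) F"
  using w
proof (induction k)
  case 0
  then show ?case by (auto intro!: tendsto_intros)
next
  case (Suc k)
  have le: "real k * \<delta> \<le> real (Suc k) * \<delta>" using \<delta> by (intro mult_right_mono) auto
  have IH: "((\<lambda>m. euler b \<delta> x (w' m) k) \<longlongrightarrow> euler b \<delta> x w k) F" using Suc by auto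
  have "((\<lambda>m. drift_step b (real k * \<delta>) (real (Suc k) * \<delta>) (euler b \<delta> x (w' m) k)) \<longlongrightarrow>
     drift_step b (real k * \<delta>) (real (Suc k) * \<delta>) (euler b \<delta> x w k)) F"
    using continuous_on_tendsto_compose[OF continuous_drift_step[OF le] IH] by simp
  with IH Suc.prems show ?case unfolding euler.simps by (intro tendsto_intros) auto
qed

lemma borel_measurable_euler:
  assumes \<delta>: "0 \<le> \<delta>" and w: "\<And>j. j \<le> k \<Longrightarrow> w j \<in> borel_measurable N" and x: "x \<in> borel_measurable N"
  shows "(\<lambda>\<omega>. euler b \<delta> (x \<omega>) (\<lambda>j. w j \<omega>) k) \<in> borel_measurable N"
  using w
proof (induction k)
  case 0
  then show ?case using x by simp
next
  case (Suc k)
  have le: "real k * \<delta> \<le> real (Suc k) * \<delta>" using \<delta> by (intro mult_right_mono) auto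
  have IH: "(\<lambda>\<omega>. euler b \<delta> (x \<omega>) (\<lambda>j. w j \<omega>) k) \<in> borel_measurable N" using Suc by auto
  from measurable_compose[OF IH borel_measurable_drift_step[OF le]] IH Suc.prems[of k] Suc.prems[of "Suc k"]
  show ?case unfolding euler.simps by (intro borel_measurable_add borel_measurable_diff) auto
qed

lemma integrable_drift_path:
  assumes z: "continuous_on {0..T} z" and A: "A \<in> sets borel" "A \<subseteq> {0..T}"
  shows "integrable lborel (\<lambda>s. indicator A s * b s (z s))"
proof -
  define z' where "z' s = indicator {0..T} s * z s" for s
  have [measurable]: "z' \<in> borel_measurable borel"
    unfolding z'_def using borel_measurable_continuous_on_indicator[OF _ z] by simp
  have "compact (z ` {0..T})" by (intro compact_continuous_image z) simp
  then have "bounded (z ` {0..T})" by (rule compact_imp_bounded)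
  then obtain R where "\<forall>y\<in>z ` {0..T}. norm y \<le> R" unfolding bounded_iff by blast
  then have R: "\<And>s. s \<in> {0..T} \<Longrightarrow> \<bar>z s\<bar> \<le> R" by auto
  have "\<bar>z' s\<bar> \<le> R" if "s \<in> A" for s
    using R[of s] A that by (auto simp: z'_def)
  note R' = this
  have "emeasure lborel A \<le> emeasure lborel {0..T}" using A by (intro emeasure_mono) auto
  also have "\<dots> < \<infinity>" by (simp add: emeasure_lborel_Icc_eq)
  finally have "integrable lborel (\<lambda>s. indicator A s * b s (z' s))"
    using A R' by (intro integrable_drift[where R=R]) auto
  moreover have "indicator A s * b s (z' s) = indicator A s * b s (z s)" for s
    using A by (auto simp: z'_def indicator_def)
  ultimately show ?thesis by simp
qed

lemma integral_drift_increment: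
  assumes z: "continuous_on {0..T} z" and rt: "0 \<le> r" "r \<le> t" "t \<le> T"
  shows "(LINT s:{0..t}|lborel. b s (z s)) - (LINT s:{0..r}|lborel. b s (z s)) = (\<integral>s. indicator {r<..t} s * b s (z s) \<partial>lborel)"
proof -
  have "(LINT s:{0..t}|lborel. b s (z s)) - (LINT s:{0..r}|lborel. b s (z s))
     = (\<integral>s. indicator {0..t} s * b s (z s) - indicator {0..r} s * b s (z s) \<partial>lborel)"
    unfolding set_lebesgue_integral_def
    using integrable_drift_path[OF z, of "{0..t}"] integrable_drift_path[OF z, of "{0..r}"] rt by simp
  also have "\<dots> = (\<integral>s. indicator {r<..t} s * b s (z s) \<partial>lborel)"
    using rt by (intro Bochner_Integration.integral_cong) (auto simp: indicator_def)
  finally show ?thesis .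
qed

text \<open>
  Discrete Gronwall argument: a step multiplies the error by at most \<open>1 + K * \<delta>\<close> and adds
  \<open>K * \<delta> * \<eta>\<close>, where \<open>\<eta>\<close> bounds the oscillation of the solution within a step.
\<close>
lemma euler_error:
  assumes z: "continuous_on {0..T} z"
    and sol: "\<And>t. t \<in> {0..T} \<Longrightarrow> z t = x + (LINT s:{0..t}|lborel. b s (z s)) + \<beta> t"
    and \<delta>: "0 \<le> \<delta>" and osc: "\<And>s s'. s \<in> {0..T} \<Longrightarrow> s' \<in> {0..T} \<Longrightarrow> \<bar>s - s'\<bar> \<le> \<delta> \<Longrightarrow> \<bar>z s - z s'\<bar> \<le> \<eta>"
    and k: "real k * \<delta> \<le> T"
  shows "\<bar>z (real k * \<delta>) - euler b \<delta> x (\<lambda>i. \<beta> (real i * \<delta>)) k\<bar> \<le> ((1 + K * \<delta>) ^ k - 1) * \<eta>"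
  using k
proof (induction k)
  case 0
  have "(LINT s:{0..0}|lborel. b s (z s)) = 0"
  proof -
    have "(\<lambda>s. indicator {0..0} s *\<^sub>R b s (z s)) = (\<lambda>s. indicator {0} s *\<^sub>R b 0 (z 0))"
      by (auto simp: indicator_def fun_eq_iff)
    then show ?thesis unfolding set_lebesgue_integral_def by simp
  qed
  then show ?case using sol[of 0] 0 by simp
next
  case (Suc k)
  let ?r = "real k * \<delta>" and ?t = "real (Suc k) * \<delta>"
  let ?e = "euler b \<delta> x (\<lambda>i. \<beta> (real i * \<delta>)) k"
  have r0: "0 \<le> ?r" and rt: "?r \<le> ?t" using \<delta> by (auto simp: algebra_simps)
  have rT: "?r \<in> {0..T}" "?t \<in> {0..T}" using r0 rt Suc.prems by auto
  have IH: "\<bar>z ?r - ?e\<bar> \<le> ((1 + K * \<delta>) ^ k - 1) * \<eta>" using Suc rT by simp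
  have iz: "integrable lborel (\<lambda>s. indicator {?r<..?t} s * b s (z s))"
    by (rule integrable_drift_path[OF z]) (use rT in auto)
  have ie: "integrable lborel (\<lambda>s. indicator {?r<..?t} s * b s ?e)"
    by (rule integrable_drift[of "\<lambda>_. ?e" _ "\<bar>?e\<bar>"]) (use rt in auto)
  have "z ?t - euler b \<delta> x (\<lambda>i. \<beta> (real i * \<delta>)) (Suc k)
     = (z ?r - ?e) + ((\<integral>s. indicator {?r<..?t} s * b s (z s) \<partial>lborel) - drift_step b ?r ?t ?e)"
    using sol[OF rT(1)] sol[OF rT(2)] integral_drift_increment[OF z r0 rt] rT by simp
  also have "(\<integral>s. indicator {?r<..?t} s * b s (z s) \<partial>lborel) - drift_step b ?r ?t ?e
     = (\<integral>s. indicator {?r<..?t} s * (b s (z s) - b s ?e) \<partial>lborel)"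
    unfolding drift_step_def using iz ie by (simp add: right_diff_distrib)
  finally have eq: "z ?t - euler b \<delta> x (\<lambda>i. \<beta> (real i * \<delta>)) (Suc k) = (z ?r - ?e) + \<dots>" .
  have "\<bar>\<integral>s. indicator {?r<..?t} s * (b s (z s) - b s ?e) \<partial>lborel\<bar> \<le> (\<integral>s. indicator {?r<..?t} s * (K * (\<eta> + \<bar>z ?r - ?e\<bar>)) \<partial>lborel)"
  proof (rule order_trans[OF integral_abs_bound integral_mono])
    show "integrable lborel (\<lambda>s. \<bar>indicator {?r<..?t} s * (b s (z s) - b s ?e)\<bar>)"
      using iz ie by (intro integrable_abs) (simp add: right_diff_distrib)
    show "integrable lborel (\<lambda>s. indicator {?r<..?t} s * (K * (\<eta> + \<bar>z ?r - ?e\<bar>)))" using rt by simp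
    fix s
    show "\<bar>indicator {?r<..?t} s * (b s (z s) - b s ?e)\<bar> \<le> indicator {?r<..?t} s * (K * (\<eta> + \<bar>z ?r - ?e\<bar>))"
    proof (cases "s \<in> {?r<..?t}")
      case True
      have "s \<in> {0..T}" using True r0 rT by auto
      then have "\<bar>z s - z ?r\<bar> \<le> \<eta>" using True rT by (intro osc) (auto simp: algebra_simps)
      then have "\<bar>z s - ?e\<bar> \<le> \<eta> + \<bar>z ?r - ?e\<bar>" by linarith
      then have "\<bar>b s (z s) - b s ?e\<bar> \<le> K * (\<eta> + \<bar>z ?r - ?e\<bar>)"
        using b_lipschitz[of s "z s" ?e] K_pos by (meson mult_left_mono less_imp_le order_trans)
      then show ?thesis using True by simp
    qed simp
  qed
  also have "\<dots> = K * \<delta> * (\<eta> + \<bar>z ?r - ?e\<bar>)"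
    using rt by (simp add: algebra_simps)
  finally have "\<bar>z ?t - euler b \<delta> x (\<lambda>i. \<beta> (real i * \<delta>)) (Suc k)\<bar> \<le> (1 + K * \<delta>) * \<bar>z ?r - ?e\<bar> + K * \<delta> * \<eta>"
    unfolding eq by (simp add: algebra_simps)
  also have "\<dots> \<le> (1 + K * \<delta>) * (((1 + K * \<delta>) ^ k - 1) * \<eta>) + K * \<delta> * \<eta>"
    using IH K_pos \<delta> by (intro add_right_mono mult_left_mono) auto
  also have "\<dots> = ((1 + K * \<delta>) ^ Suc k - 1) * \<eta>" by (simp add: algebra_simps)
  finally show ?case .
qed

text \<open>
  The factor in \<open>euler_error\<close> stays below \<open>exp (K * T)\<close>, while the oscillation of the continuous
  solution over one step tends to 0.
\<close>
lemma euler_convergence: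
  assumes T: "0 < T" and z: "continuous_on {0..T} z"
    and sol: "\<And>t. t \<in> {0..T} \<Longrightarrow> z t = x + (LINT s:{0..t}|lborel. b s (z s)) + \<beta> t"
  shows "(\<lambda>n. euler b (T / real n) x (\<lambda>i. \<beta> (real i * (T / real n))) n) \<longlonglongrightarrow> z T"
proof (rule LIMSEQ_I)
  fix e :: real assume e: "0 < e"
  define \<eta> where "\<eta> = e / (2 * exp (K * T))"
  have \<eta>: "0 < \<eta>" using e by (simp add: \<eta>_def)
  have "uniformly_continuous_on {0..T} z" using z by (intro compact_uniformly_continuous) auto
  then obtain d where d: "d > 0" "\<And>s s'. s \<in> {0..T} \<Longrightarrow> s' \<in> {0..T} \<Longrightarrow> dist s' s < d \<Longrightarrow> dist (z s') (z s) < \<eta>"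
    using \<eta> unfolding uniformly_continuous_on_def by metis
  obtain N where N: "T / d < real N" using reals_Archimedean2 by blast
  have N0: "0 < N" using N T d by (metis divide_pos_pos gr0I less_asym of_nat_0)
  show "\<exists>no. \<forall>n\<ge>no. norm (euler b (T / real n) x (\<lambda>i. \<beta> (real i * (T / real n))) n - z T) < e"
  proof (intro exI[of _ N] allI impI)
    fix n assume n: "N \<le> n"
    have n0: "0 < n" using N0 n by simp
    have "T / d < real n" using N n by (meson less_le_trans of_nat_le_iff)
    then have dn: "T / real n < d" using d n0 by (simp add: field_simps)
    have "\<bar>z (real n * (T / real n)) - euler b (T / real n) x (\<lambda>i. \<beta> (real i * (T / real n))) n\<bar> \<le> ((1 + K * (T / real n)) ^ n - 1) * \<eta>"
    proof (rule euler_error[OF z sol])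
      fix s s' assume "s \<in> {0..T}" "s' \<in> {0..T}" "\<bar>s - s'\<bar> \<le> T / real n"
      then show "\<bar>z s - z s'\<bar> \<le> \<eta>" using d(2)[of s' s] dn by (simp add: dist_real_def)
    qed (use T n0 in auto)
    also have "\<dots> \<le> exp (K * T) * \<eta>"
    proof (rule mult_right_mono)
      have "(1 + K * (T / real n)) ^ n \<le> exp (K * (T / real n)) ^ n"
        using K_pos T by (intro power_mono exp_ge_add_one_self) auto
      also have "\<dots> = exp (K * T)" using n0 by (simp add: exp_of_nat_mult[symmetric])
      finally show "(1 + K * (T / real n)) ^ n - 1 \<le> exp (K * T)" by simp
    qed (use \<eta> in simp)
    also have "\<dots> < e" using e by (simp add: \<eta>_def)
    finally show "norm (euler b (T / real n) x (\<lambda>i. \<beta> (real i * (T / real n))) n - z T) < e"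
      using n0 by (simp add: abs_minus_commute)
  qed
qed

end

section \<open>Wiener processes with drift\<close>

text \<open>
  Dominated convergence on both sides.
\<close>
lemma (in prob_space) entropy_bound_limit:
  fixes U U' :: "nat \<Rightarrow> 'a \<Rightarrow> real" and \<psi> :: "real \<Rightarrow> real" and c :: real
  assumes meas[measurable]: "\<And>k. U k \<in> borel_measurable M" "\<And>k. U' k \<in> borel_measurable M"
      "V \<in> borel_measurable M" "V' \<in> borel_measurable M"
    and lim: "AE \<omega> in M. (\<lambda>k. U k \<omega>) \<longlonglongrightarrow> V \<omega>" "AE \<omega> in M. (\<lambda>k. U' k \<omega>) \<longlonglongrightarrow> V' \<omega>"
    and \<psi>: "continuous_on UNIV \<psi>" "\<And>x. \<bar>\<psi> x\<bar> \<le> c"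
    and le: "\<And>k. expectation (\<lambda>\<omega>. \<psi> (U' k \<omega>)) \<le> ln (expectation (\<lambda>\<omega>. exp (\<psi> (U k \<omega>)))) + C"
  shows "expectation (\<lambda>\<omega>. \<psi> (V' \<omega>)) \<le> ln (expectation (\<lambda>\<omega>. exp (\<psi> (V \<omega>)))) + C"
proof -
  have [measurable]: "\<psi> \<in> borel_measurable borel" using \<psi>(1) by (rule borel_measurable_continuous_onI)
  have c\<psi>: "(\<lambda>k. \<psi> (f k)) \<longlonglongrightarrow> \<psi> l" if "f \<longlonglongrightarrow> l" for f l
    using continuous_on_tendsto_compose[OF \<psi>(1) that] by simp
  have "(\<lambda>k. expectation (\<lambda>\<omega>. \<psi> (U' k \<omega>))) \<longlonglongrightarrow> expectation (\<lambda>\<omega>. \<psi> (V' \<omega>))"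
    by (rule integral_dominated_convergence[where w="\<lambda>_. c"]) (use lim(2) \<psi>(2) c\<psi> in \<open>auto elim!: eventually_mono\<close>)
  moreover have E: "(\<lambda>k. expectation (\<lambda>\<omega>. exp (\<psi> (U k \<omega>)))) \<longlonglongrightarrow> expectation (\<lambda>\<omega>. exp (\<psi> (V \<omega>)))"
    by (rule integral_dominated_convergence[where w="\<lambda>_. exp c"])
       (use lim(1) \<psi>(2) c\<psi> in \<open>auto elim!: eventually_mono intro!: tendsto_exp simp: abs_le_iff\<close>)
  have "expectation (\<lambda>\<omega>. exp (- c)) \<le> expectation (\<lambda>\<omega>. exp (\<psi> (V \<omega>)))"
  proof (rule integral_mono)
    show "integrable M (\<lambda>\<omega>. exp (\<psi> (V \<omega>)))"
      by (rule integrable_const_bound[where B="exp c"]) (use \<psi>(2) in \<open>auto simp: abs_le_iff\<close>)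
    show "exp (- c) \<le> exp (\<psi> (V \<omega>))" for \<omega> using \<psi>(2)[of "V \<omega>"] by (simp add: abs_le_iff)
  qed simp
  then have "0 < expectation (\<lambda>\<omega>. exp (\<psi> (V \<omega>)))"
    using exp_gt_zero[of "- c"] by (simp add: prob_space del: exp_gt_zero)
  then have "(\<lambda>k. ln (expectation (\<lambda>\<omega>. exp (\<psi> (U k \<omega>)))) + C) \<longlonglongrightarrow> ln (expectation (\<lambda>\<omega>. exp (\<psi> (V \<omega>)))) + C"
    using E by (intro tendsto_intros) auto
  ultimately show ?thesis by (rule LIMSEQ_le) (use le in auto)
qed

text \<open>
  Cauchy-Schwarz, from the nonnegativity of the integral of the squared deviation of \<open>v\<close> from its
  mean.
\<close>
lemma square_integral_le:
  fixes v k :: "real \<Rightarrow> real"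
  assumes ab: "a \<le> b" and v[measurable]: "v \<in> borel_measurable borel"
    and vk: "\<And>s. a \<le> s \<Longrightarrow> s < b \<Longrightarrow> \<bar>v s\<bar> \<le> k s"
    and k: "integrable lborel (\<lambda>s. indicator {a..<b} s * (k s)\<^sup>2)"
  shows "(\<integral>s. indicator {a..<b} s * v s \<partial>lborel)\<^sup>2 \<le> (b - a) * (\<integral>s. indicator {a..<b} s * (k s)\<^sup>2 \<partial>lborel)"
proof (cases "a = b")
  case False
  with ab have ab: "a < b" by simp
  have v2k: "(v s)\<^sup>2 \<le> (k s)\<^sup>2" if "s \<in> {a..<b}" for s
    using power_mono[OF vk[of s], of 2] that by simp
  have i2: "integrable lborel (\<lambda>s. indicator {a..<b} s * (v s)\<^sup>2)"
    by (rule Bochner_Integration.integrable_bound[OF k]) (use v2k in \<open>auto simp: indicator_def\<close>)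
  have i1: "integrable lborel (\<lambda>s. indicator {a..<b} s * v s)"
  proof (rule Bochner_Integration.integrable_bound)
    show "integrable lborel (\<lambda>s. indicator {a..<b} s * 1 + indicator {a..<b} s * (v s)\<^sup>2)"
      using i2 ab by (intro Bochner_Integration.integrable_add) auto
    show "AE s in lborel. norm (indicator {a..<b} s * v s) \<le> norm (indicator {a..<b} s * 1 + indicator {a..<b} s * (v s)\<^sup>2)"
    proof (rule AE_I2)
      fix s
      have "\<bar>v s\<bar> \<le> 1 + (v s)\<^sup>2"
        using sum_squares_bound[of "\<bar>v s\<bar>" 1] abs_ge_zero[of "v s"] by (simp add: add_increasing)
      then show "norm (indicator {a..<b} s * v s) \<le> norm (indicator {a..<b} s * 1 + indicator {a..<b} s * (v s)\<^sup>2)"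
        by (auto simp: indicator_def)
    qed
  qed measurable
  define I where "I = (\<integral>s. indicator {a..<b} s * v s \<partial>lborel)"
  define m where "m = I / (b - a)"
  have "0 \<le> (\<integral>s. indicator {a..<b} s * (v s - m)\<^sup>2 \<partial>lborel)"
    by (intro integral_nonneg_AE) auto
  also have "\<dots> = (\<integral>s. indicator {a..<b} s * (v s)\<^sup>2 - 2 * m * (indicator {a..<b} s * v s) + m\<^sup>2 * indicator {a..<b} s \<partial>lborel)"
    by (intro Bochner_Integration.integral_cong) (auto simp: power2_diff algebra_simps)
  also have "\<dots> = (\<integral>s. indicator {a..<b} s * (v s)\<^sup>2 \<partial>lborel) - 2 * m * I + m\<^sup>2 * (b - a)"
    unfolding I_def using i1 i2 ab by simp
  also have "\<dots> = (\<integral>s. indicator {a..<b} s * (v s)\<^sup>2 \<partial>lborel) - I\<^sup>2 / (b - a)"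
  proof -
    have "x - 2 * (I / l) * I + (I / l)\<^sup>2 * l = x - I\<^sup>2 / l" if "l \<noteq> 0" for x l
      using that by (simp add: field_simps power2_eq_square)
    then show ?thesis using ab unfolding m_def by simp
  qed
  finally have "I\<^sup>2 / (b - a) \<le> (\<integral>s. indicator {a..<b} s * (v s)\<^sup>2 \<partial>lborel)" by simp
  also have "\<dots> \<le> (\<integral>s. indicator {a..<b} s * (k s)\<^sup>2 \<partial>lborel)"
    using i2 k v2k by (intro integral_mono) (auto simp: indicator_def)
  finally show ?thesis using ab by (simp add: I_def field_simps)
qed simp

definition grid_index :: "real \<Rightarrow> nat \<Rightarrow> real \<Rightarrow> nat" where
  "grid_index T N t = nat \<lfloor>t * real N / T\<rfloor>"

lemma grid_index_le: "0 < T \<Longrightarrow> 0 \<le> t \<Longrightarrow> t \<le> T \<Longrightarrow> grid_index T N t \<le> N"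
proof -
  assume "0 < T" "0 \<le> t" "t \<le> T"
  then have "t * real N / T \<le> real N" by (simp add: field_simps mult_right_mono)
  then show ?thesis unfolding grid_index_def by (simp add: nat_le_iff floor_le_iff)
qed

lemma grid_index_bounds:
  assumes "0 < T" "0 \<le> t" "0 < N"
  shows "real (grid_index T N t) * (T / real N) \<le> t" "t - T / real N \<le> real (grid_index T N t) * (T / real N)"
proof -
  have nn: "0 \<le> t * real N / T" using assms by simp
  then have "real (grid_index T N t) = of_int \<lfloor>t * real N / T\<rfloor>" unfolding grid_index_def by simp
  then have "real (grid_index T N t) \<le> t * real N / T" "t * real N / T - 1 \<le> real (grid_index T N t)"
    by linarith+
  note b = this
  have p: "0 \<le> T / real N" using assms by simp
  have "real (grid_index T N t) * (T / real N) \<le> t * real N / T * (T / real N)"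
    "(t * real N / T - 1) * (T / real N) \<le> real (grid_index T N t) * (T / real N)"
    by (rule mult_right_mono[OF b(1) p], rule mult_right_mono[OF b(2) p])
  moreover have "t * real N / T * (T / real N) = t" "(t * real N / T - 1) * (T / real N) = t - T / real N"
    using assms by (simp_all add: field_simps)
  ultimately show "real (grid_index T N t) * (T / real N) \<le> t" "t - T / real N \<le> real (grid_index T N t) * (T / real N)"
    by (simp_all only:)
qed

lemma grid_index_tendsto:
  assumes "0 < T" "0 \<le> t"
  shows "(\<lambda>N. real (grid_index T N t) * (T / real N)) \<longlonglongrightarrow> t"
proof (rule tendsto_sandwich[where f="\<lambda>N. t - T / real N" and h="\<lambda>_. t"])
  show "(\<lambda>N. t - T / real N) \<longlonglongrightarrow> t"
    using tendsto_diff[OF tendsto_const lim_const_over_n[of T], of t] by simp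
qed (use grid_index_bounds[OF assms] in \<open>auto intro!: eventually_sequentiallyI[of 1]\<close>)

text \<open>
  On the grid with mesh \<open>\<delta> = T / N\<close> the drift \<open>A t\<close> is replaced by \<open>A (t - \<delta>)\<close>. The increment of
  the delayed drift over the cell that starts at \<open>t\<close> is \<open>A t - A (t - \<delta>)\<close>, which is known at time
  \<open>t\<close>, so that \<open>gaussian_drift_entropy_bound\<close> applies. By Cauchy-Schwarz the energy of these
  increments is at most that of \<open>k\<close>. As \<open>N\<close> tends to infinity, the values on the grid converge by
  continuity of the paths of \<open>W\<close> and of \<open>A\<close>. The functional \<open>\<Theta>\<close> stands for a function of finitely
  many values of a path, so pointwise convergence of paths is enough.
\<close>
lemma (in prob_space) wiener_drift_entropy_bound:
  fixes W :: "real \<Rightarrow> 'a \<Rightarrow> real" and v :: "'a \<Rightarrow> real \<Rightarrow> real" and \<Theta> :: "(real \<Rightarrow> real) \<Rightarrow> real"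
    and \<psi> :: "real \<Rightarrow> real" and c :: real
  defines "A \<equiv> \<lambda>t \<omega>. \<integral>s. indicator {0..<t} s * v \<omega> s \<partial>lborel"
  assumes T: "0 < T" and F: "filtered_prob_space M F T" and W: "wiener_process M F T W"
    and A: "\<And>t. t \<in> {0..T} \<Longrightarrow> A t \<in> borel_measurable (F t)"
    and v[measurable]: "\<And>\<omega>. v \<omega> \<in> borel_measurable borel"
    and vk: "\<And>\<omega> s. 0 \<le> s \<Longrightarrow> s \<le> T \<Longrightarrow> \<bar>v \<omega> s\<bar> \<le> k s"
    and kk: "\<And>s. 0 \<le> s \<Longrightarrow> s \<le> T \<Longrightarrow> k s \<le> k1"
    and k2: "integrable lborel (\<lambda>s. indicator {0..<T} s * (k s)\<^sup>2)"
    and \<Theta>_meas: "\<And>N. (\<lambda>p. \<Theta> (\<lambda>t. p (grid_index T N t))) \<in> borel_measurable (PiM UNIV (\<lambda>_::nat. borel :: real measure))"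
       "\<And>R. (\<And>t. t \<in> {0..T} \<Longrightarrow> R t \<in> borel_measurable M) \<Longrightarrow> (\<lambda>\<omega>. \<Theta> (\<lambda>t. R t \<omega>)) \<in> borel_measurable M"
    and \<Theta>_cont: "\<And>\<rho>' \<rho>. (\<And>t. t \<in> {0..T} \<Longrightarrow> (\<lambda>N. \<rho>' N t) \<longlonglongrightarrow> \<rho> t) \<Longrightarrow> (\<lambda>N. \<Theta> (\<rho>' N)) \<longlonglongrightarrow> \<Theta> \<rho>"
    and \<psi>: "continuous_on UNIV \<psi>" "\<And>x. \<bar>\<psi> x\<bar> \<le> c"
  shows "expectation (\<lambda>\<omega>. \<psi> (\<Theta> (\<lambda>t. W t \<omega> + A t \<omega>)))
      \<le> ln (expectation (\<lambda>\<omega>. exp (\<psi> (\<Theta> (\<lambda>t. W t \<omega>))))) + (\<integral>s. indicator {0..<T} s * (k s)\<^sup>2 \<partial>lborel) / 2"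
proof -
  define J where "J t = (\<integral>s. indicator {0..<t} s * (k s)\<^sup>2 \<partial>lborel)" for t
  have sub: "subalgebra M (F t)" if "t \<in> {0..T}" for t
    using F that by (simp add: filtered_prob_space_def)
  have Fmono: "sets (F s) \<subseteq> sets (F t)" if "0 \<le> s" "s \<le> t" "t \<le> T" for s t
    using F that by (simp add: filtered_prob_space_def)
  have up: "f \<in> borel_measurable (F t)" if "f \<in> borel_measurable (F s)" "0 \<le> s" "s \<le> t" "t \<le> T" for s t and f :: "'a \<Rightarrow> real"
  proof -
    have "subalgebra (F t) (F s)"
      using sub[of s] sub[of t] Fmono[of s t] that by (auto simp: subalgebra_def)
    from measurable_from_subalg[OF this that(1)] show ?thesis .
  qed
  have Wm: "W t \<in> borel_measurable (F t)" if "t \<in> {0..T}" for t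
    using W that by (simp add: wiener_process_def adapted_def)
  have WmM: "W t \<in> borel_measurable M" if "t \<in> {0..T}" for t
    using measurable_from_subalg[OF sub[OF that] Wm[OF that]] .
  have AmM: "A t \<in> borel_measurable M" if "t \<in> {0..T}" for t
    using measurable_from_subalg[OF sub[OF that] A[OF that]] .
  have k0: "0 \<le> k s" if "0 \<le> s" "s \<le> T" for s
    using vk[OF that] by (meson abs_ge_zero order_trans)
  have k2i: "integrable lborel (\<lambda>s. indicator {a..<b} s * (k s)\<^sup>2)" if "0 \<le> a" "b \<le> T" for a b
  proof -
    have "integrable lborel (\<lambda>s. indicator {a..<b} s *\<^sub>R (indicator {0..<T} s * (k s)\<^sup>2))"
      by (rule integrable_mult_indicator[OF _ k2]) simp
    then show ?thesis
      by (rule Bochner_Integration.integrable_cong[THEN iffD1, rotated -1]) (use that in \<open>auto simp: indicator_def\<close>)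
  qed
  have vint: "integrable lborel (\<lambda>s. indicator {a..<b} s * v \<omega> s)" if "0 \<le> a" "b \<le> T" for a b \<omega>
  proof (rule Bochner_Integration.integrable_bound)
    show "integrable lborel (\<lambda>s. indicator {a..<b} s * k1)" 
      by (cases "a \<le> b") auto
    show "AE s in lborel. norm (indicator {a..<b} s * v \<omega> s) \<le> norm (indicator {a..<b} s * k1)"
    proof (rule AE_I2)
      fix s
      show "norm (indicator {a..<b} s * v \<omega> s) \<le> norm (indicator {a..<b} s * k1)"
      proof (cases "s \<in> {a..<b}")
        case True
        then have "\<bar>v \<omega> s\<bar> \<le> k1" using vk[of s \<omega>] kk[of s] that by auto
        then show ?thesis using True by simp
      qed simp
    qed
  qed measurable
  have A_diff: "A b \<omega> - A a \<omega> = (\<integral>s. indicator {max 0 a..<b} s * v \<omega> s \<partial>lborel)" if "a \<le> b" "b \<le> T" for a b \<omega>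
  proof -
    have "A b \<omega> - A a \<omega> = (\<integral>s. indicator {0..<b} s * v \<omega> s - indicator {0..<a} s * v \<omega> s \<partial>lborel)"
      unfolding A_def using vint[of 0 b \<omega>] vint[of 0 a \<omega>] that by simp
    also have "\<dots> = (\<integral>s. indicator {max 0 a..<b} s * v \<omega> s \<partial>lborel)"
      using that by (intro Bochner_Integration.integral_cong) (auto simp: indicator_def)
    finally show ?thesis .
  qed
  have J_diff: "J b - J a = (\<integral>s. indicator {max 0 a..<b} s * (k s)\<^sup>2 \<partial>lborel)" if "a \<le> b" "b \<le> T" for a b
  proof -
    have "J b - J a = (\<integral>s. indicator {0..<b} s * (k s)\<^sup>2 - indicator {0..<a} s * (k s)\<^sup>2 \<partial>lborel)"
      unfolding J_def using k2i[of 0 b] k2i[of 0 a] that by simp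
    also have "\<dots> = (\<integral>s. indicator {max 0 a..<b} s * (k s)\<^sup>2 \<partial>lborel)"
      using that by (intro Bochner_Integration.integral_cong) (auto simp: indicator_def)
    finally show ?thesis .
  qed
  have J_mono: "J a \<le> J b" if "a \<le> b" "b \<le> T" for a b
    using J_diff[OF that] by (smt (verit) integral_nonneg_AE AE_I2 mult_nonneg_nonneg indicator_pos_le zero_le_power2)
  have A2: "(A b \<omega> - A a \<omega>)\<^sup>2 \<le> (b - a) * (J b - J a)" if "a \<le> b" "b \<le> T" for a b \<omega>
  proof (cases "max 0 a \<le> b")
    case True
    have "(A b \<omega> - A a \<omega>)\<^sup>2 \<le> (b - max 0 a) * (J b - J a)"
      unfolding A_diff[OF that] J_diff[OF that]
      by (rule square_integral_le) (use True that vk k2i in auto)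
    also have "\<dots> \<le> (b - a) * (J b - J a)"
      using J_mono[OF that] by (intro mult_right_mono) auto
    finally show ?thesis .
  next
    case False
    then have "A b \<omega> = 0" "A a \<omega> = 0" using that by (auto simp: A_def)
    then show ?thesis using J_mono[OF that] that by simp
  qed
  have A_cont: "(\<lambda>N. A (f N) \<omega>) \<longlonglongrightarrow> A t \<omega>" if f: "f \<longlonglongrightarrow> t" "\<And>N. f N \<le> T" "t \<le> T" for f t \<omega>
  proof -
    have lip: "\<bar>A b \<omega> - A a \<omega>\<bar>\<^sup>2 \<le> (b - a) * J T" if ab: "a \<le> b" "b \<le> T" for a b
    proof -
      have J0: "J a = 0 \<or> 0 \<le> J a" for a unfolding J_def by (auto intro!: integral_nonneg_AE)
      have "\<bar>A b \<omega> - A a \<omega>\<bar>\<^sup>2 \<le> (b - a) * (J b - J a)" using A2[OF ab] by simp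
      also have "\<dots> \<le> (b - a) * J T"
        using J_mono[of b T] J0[of a] ab by (intro mult_left_mono) auto
      finally show ?thesis .
    qed
    have lip': "\<bar>A b \<omega> - A a \<omega>\<bar> \<le> sqrt (\<bar>b - a\<bar> * J T)" if ab: "a \<le> T" "b \<le> T" for a b
    proof (cases "a \<le> b")
      case True then show ?thesis using lip[of a b] ab by (intro real_le_rsqrt) auto
    next
      case False then show ?thesis using lip[of b a] ab by (intro real_le_rsqrt) (auto simp: abs_minus_commute power2_commute)
    qed
    have "(\<lambda>N. A (f N) \<omega> - A t \<omega>) \<longlonglongrightarrow> 0"
    proof (rule Lim_null_comparison)
      show "eventually (\<lambda>N. norm (A (f N) \<omega> - A t \<omega>) \<le> sqrt (\<bar>f N - t\<bar> * J T)) sequentially"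
        using lip' f by auto
      have "(\<lambda>N. sqrt (\<bar>f N - t\<bar> * J T)) \<longlonglongrightarrow> sqrt (\<bar>t - t\<bar> * J T)"
        by (intro tendsto_intros f(1))
      then show "(\<lambda>N. sqrt (\<bar>f N - t\<bar> * J T)) \<longlonglongrightarrow> 0" by simp
    qed
    then show ?thesis by (simp add: LIM_zero_iff)
  qed
  \<comment> \<open>The process and the delayed drift, read at the last grid point before \<open>t\<close>.\<close>
  define \<rho> where "\<rho> N t \<omega> = W (real (grid_index T N t) * (T / real N)) \<omega>" for N t \<omega>
  define \<rho>' where "\<rho>' N t \<omega> = W (real (grid_index T N t) * (T / real N)) \<omega> +
      A (real (grid_index T N t) * (T / real N) - T / real N) \<omega>" for N t \<omega>
  have gT: "real (grid_index T N t) * (T / real N) \<in> {0..T}" if "t \<in> {0..T}" "0 < N" for N t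
    using grid_index_bounds(1)[OF T, of t N] that T by auto
  \<comment> \<open>Continuity along constant sequences: \<open>\<Theta>\<close> depends only on the path over \<open>{0..T}\<close>.\<close>
  have \<Theta>_cong: "\<Theta> \<rho>1 = \<Theta> \<rho>2" if "\<And>t. t \<in> {0..T} \<Longrightarrow> \<rho>1 t = \<rho>2 t" for \<rho>1 \<rho>2
    using \<Theta>_cont[of "\<lambda>_. \<rho>1" \<rho>2] that by (simp add: LIMSEQ_const_iff)
  have step: "expectation (\<lambda>\<omega>. \<psi> (\<Theta> (\<lambda>t. \<rho>' N t \<omega>))) \<le> ln (expectation (\<lambda>\<omega>. exp (\<psi> (\<Theta> (\<lambda>t. \<rho> N t \<omega>))))) + J T / 2" if N: "0 < N" for N
  proof -
    define \<delta> where "\<delta> = T / real N"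
    have \<delta>: "0 < \<delta>" using T N by (simp add: \<delta>_def)
    have le_T: "real i * \<delta> \<le> T" if "i \<le> N" for i
    proof -
      have "real i * \<delta> \<le> real N * \<delta>" using that \<delta> by (intro mult_right_mono) auto
      then show ?thesis using N by (simp add: \<delta>_def)
    qed
    have mem: "real i * \<delta> \<in> {0..T}" if "i \<le> N" for i using le_T[OF that] \<delta> by simp
    define w where "w i = W (real i * \<delta>)" for i
    define V where "V i \<omega> = A (real i * \<delta>) \<omega> - A (real i * \<delta> - \<delta>) \<omega>" for i \<omega>
    define m where "m i = sqrt (\<delta> * (J (real i * \<delta>) - J (real i * \<delta> - \<delta>)))" for i
    \<comment> \<open>The delayed drift is read at negative times in the first cell.\<close>
    have neg: "A t \<omega> = 0" "J t = 0" if "t \<le> 0" for t \<omega> using that by (auto simp: A_def J_def)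
    have \<psi>m[measurable]: "\<psi> \<in> borel_measurable borel" using \<psi>(1) by (rule borel_measurable_continuous_onI)
    have "expectation (\<lambda>\<omega>. (\<lambda>p. \<psi> (\<Theta> (\<lambda>t. p (grid_index T N t)))) (\<lambda>i. if i \<le> N then w i \<omega> + (\<Sum>j<i. V j \<omega>) else 0))
     \<le> ln (expectation (\<lambda>\<omega>. exp ((\<lambda>p. \<psi> (\<Theta> (\<lambda>t. p (grid_index T N t)))) (\<lambda>i. if i \<le> N then w i \<omega> else 0))))
       + (\<Sum>i<N. (m i)\<^sup>2 / (2 * (sqrt \<delta>)\<^sup>2))"
    proof (rule gaussian_drift_entropy_bound[where \<G>="\<lambda>i. F (real i * \<delta>)" and c=c])
      show "0 < sqrt \<delta>" using \<delta> by simp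
      show "subalgebra M (F (real i * \<delta>))" if "i \<le> N" for i using sub[OF mem[OF that]] .
      show "sets (F (real i * \<delta>)) \<subseteq> sets (F (real j * \<delta>))" if "i \<le> j" "j \<le> N" for i j
        using that \<delta> le_T[of j] by (intro Fmono) (auto intro: mult_right_mono)
      show "w i \<in> borel_measurable (F (real i * \<delta>))" if "i \<le> N" for i
        unfolding w_def by (rule Wm[OF mem[OF that]])
      show "V i \<in> borel_measurable (F (real i * \<delta>))" if "i < N" for i
      proof (cases i)
        case 0
        then show ?thesis using \<delta> by (simp add: V_def[abs_def] neg)
      next
        case (Suc j)
        have e: "real i * \<delta> - \<delta> = real j * \<delta>" using Suc by (simp add: algebra_simps)
        have "A (real j * \<delta>) \<in> borel_measurable (F (real i * \<delta>))"
          using that Suc \<delta> le_T[of i] by (intro up[OF A[OF mem]]) (auto intro: mult_right_mono)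
        then show ?thesis unfolding V_def e using A[OF mem[of i]] that by simp
      qed
      show "distributed M lborel (\<lambda>\<omega>. w (Suc i) \<omega> - w i \<omega>) (normal_density 0 (sqrt \<delta>))"
        "indep_set (sets (F (real i * \<delta>))) {(\<lambda>\<omega>. w (Suc i) \<omega> - w i \<omega>) -` B \<inter> space M |B. B \<in> sets borel}" if "i < N" for i
      proof -
        have "0 \<le> real i * \<delta>" "real i * \<delta> < real (Suc i) * \<delta>" "real (Suc i) * \<delta> \<le> T"
          using \<delta> le_T[of "Suc i"] that by (auto simp: algebra_simps)
        note * = this
        have e: "real (Suc i) * \<delta> - real i * \<delta> = \<delta>" by (simp add: algebra_simps)
        have "distributed M lborel (\<lambda>\<omega>. W t \<omega> - W s \<omega>) (normal_density 0 (sqrt (t - s))) \<and>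
          indep_set (sets (F s)) {(\<lambda>\<omega>. W t \<omega> - W s \<omega>) -` B \<inter> space M |B. B \<in> sets borel}"
          if "0 \<le> s" "s < t" "t \<le> T" for s t
          using W that unfolding wiener_process_def by blast
        from this[OF *] show "distributed M lborel (\<lambda>\<omega>. w (Suc i) \<omega> - w i \<omega>) (normal_density 0 (sqrt \<delta>))"
        "indep_set (sets (F (real i * \<delta>))) {(\<lambda>\<omega>. w (Suc i) \<omega> - w i \<omega>) -` B \<inter> space M |B. B \<in> sets borel}"
          unfolding w_def e by (rule conjunct1, rule conjunct2)
      qed
      show "\<bar>V i \<omega>\<bar> \<le> m i" if "i < N" for i \<omega>
        unfolding m_def V_def using A2[of "real i * \<delta> - \<delta>" "real i * \<delta>" \<omega>] \<delta> le_T[of i] that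
        by (intro real_le_rsqrt) auto
      show "(\<lambda>p. \<psi> (\<Theta> (\<lambda>t. p (grid_index T N t)))) \<in> borel_measurable (PiM UNIV (\<lambda>_::nat. borel :: real measure))"
        using measurable_compose[OF \<Theta>_meas(1) \<psi>m] .
    qed (use \<psi>(2) in auto)
    also have "(\<Sum>i<N. (m i)\<^sup>2 / (2 * (sqrt \<delta>)\<^sup>2)) = (\<Sum>i<N. (\<lambda>i. J (real i * \<delta> - \<delta>) / 2) (Suc i) - (\<lambda>i. J (real i * \<delta> - \<delta>) / 2) i)"
    proof (rule sum.cong[OF refl])
      fix i assume "i \<in> {..<N}"
      then have "J (real i * \<delta> - \<delta>) \<le> J (real i * \<delta>)" using \<delta> le_T[of i] by (intro J_mono) auto
      then show "(m i)\<^sup>2 / (2 * (sqrt \<delta>)\<^sup>2) = (\<lambda>i. J (real i * \<delta> - \<delta>) / 2) (Suc i) - (\<lambda>i. J (real i * \<delta> - \<delta>) / 2) i"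
        using \<delta> by (simp add: m_def field_simps)
    qed
    also have "\<dots> = J (real N * \<delta> - \<delta>) / 2"
      using sum_lessThan_telescope[of "\<lambda>i. J (real i * \<delta> - \<delta>) / 2" N] \<delta> by (simp add: neg)
    also have "\<dots> \<le> J T / 2"
      using \<delta> le_T[of N] by (intro divide_right_mono J_mono) auto
    also have "(\<lambda>\<omega>. \<psi> (\<Theta> (\<lambda>t. (\<lambda>i. if i \<le> N then w i \<omega> + (\<Sum>j<i. V j \<omega>) else 0) (grid_index T N t)))) = (\<lambda>\<omega>. \<psi> (\<Theta> (\<lambda>t. \<rho>' N t \<omega>)))"
    proof (rule ext)
      fix \<omega>
      have V: "(\<Sum>j<i. V j \<omega>) = A (real i * \<delta> - \<delta>) \<omega>" for i
      proof -
        have "(\<Sum>j<i. V j \<omega>) = (\<Sum>j<i. (\<lambda>j. A (real j * \<delta> - \<delta>) \<omega>) (Suc j) - (\<lambda>j. A (real j * \<delta> - \<delta>) \<omega>) j)"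
          by (intro sum.cong) (auto simp: V_def algebra_simps)
        then show ?thesis
          using sum_lessThan_telescope[of "\<lambda>j. A (real j * \<delta> - \<delta>) \<omega>" i] \<delta> by (simp add: neg)
      qed
      show "\<psi> (\<Theta> (\<lambda>t. (\<lambda>i. if i \<le> N then w i \<omega> + (\<Sum>j<i. V j \<omega>) else 0) (grid_index T N t))) = \<psi> (\<Theta> (\<lambda>t. \<rho>' N t \<omega>))"
        by (rule arg_cong[where f=\<psi>], rule \<Theta>_cong)
           (auto simp: \<rho>'_def w_def \<delta>_def[symmetric] V grid_index_le[OF T])
    qed
    also have "(\<lambda>\<omega>. exp (\<psi> (\<Theta> (\<lambda>t. (\<lambda>i. if i \<le> N then w i \<omega> else 0) (grid_index T N t))))) = (\<lambda>\<omega>. exp (\<psi> (\<Theta> (\<lambda>t. \<rho> N t \<omega>))))"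
    proof (rule ext)
      fix \<omega>
      have "\<Theta> (\<lambda>t. (\<lambda>i. if i \<le> N then w i \<omega> else 0) (grid_index T N t)) = \<Theta> (\<lambda>t. \<rho> N t \<omega>)"
        by (rule \<Theta>_cong) (auto simp: \<rho>_def w_def \<delta>_def[symmetric] grid_index_le[OF T])
      then show "exp (\<psi> (\<Theta> (\<lambda>t. (\<lambda>i. if i \<le> N then w i \<omega> else 0) (grid_index T N t)))) = exp (\<psi> (\<Theta> (\<lambda>t. \<rho> N t \<omega>)))"
        by simp
    qed
    finally show ?thesis by simp
  qed
  have gl: "(\<lambda>N. real (grid_index T (Suc N) t) * (T / real (Suc N))) \<longlonglongrightarrow> t" if "t \<in> {0..T}" for t
    using LIMSEQ_Suc[OF grid_index_tendsto[OF T, of t]] that by simp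
  have \<delta>l: "(\<lambda>N. T / real (Suc N)) \<longlonglongrightarrow> 0"
    using LIMSEQ_Suc[OF lim_const_over_n[of T]] by simp
  have Wl: "AE \<omega> in M. \<forall>t\<in>{0..T}. (\<lambda>N. \<rho> (Suc N) t \<omega>) \<longlonglongrightarrow> W t \<omega>"
  proof -
    have "AE \<omega> in M. continuous_on {0..T} (\<lambda>t. W t \<omega>)"
      using W by (simp add: wiener_process_def continuous_paths_def)
    then show ?thesis
    proof (rule eventually_mono)
      fix \<omega> assume c: "continuous_on {0..T} (\<lambda>t. W t \<omega>)"
      show "\<forall>t\<in>{0..T}. (\<lambda>N. \<rho> (Suc N) t \<omega>) \<longlonglongrightarrow> W t \<omega>"
        unfolding \<rho>_def
      proof
        fix t assume t: "t \<in> {0..T}"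
        show "(\<lambda>N. W (real (grid_index T (Suc N) t) * (T / real (Suc N))) \<omega>) \<longlonglongrightarrow> W t \<omega>"
          by (rule continuous_on_tendsto_compose[OF c gl[OF t] t]) (intro always_eventually allI gT[OF t] zero_less_Suc)
      qed
    qed
  qed
  have Al: "(\<lambda>N. A (real (grid_index T (Suc N) t) * (T / real (Suc N)) - T / real (Suc N)) \<omega>) \<longlonglongrightarrow> A t \<omega>" if t: "t \<in> {0..T}" for t \<omega>
  proof (rule A_cont)
    show "(\<lambda>N. real (grid_index T (Suc N) t) * (T / real (Suc N)) - T / real (Suc N)) \<longlonglongrightarrow> t"
      using tendsto_diff[OF gl[OF t] \<delta>l] by simp
    show "real (grid_index T (Suc N) t) * (T / real (Suc N)) - T / real (Suc N) \<le> T" for N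
    proof -
      have "0 \<le> T / real (Suc N)" using T by simp
      moreover have "real (grid_index T (Suc N) t) * (T / real (Suc N)) \<le> T"
        using gT[OF t, of "Suc N"] by simp
      ultimately show ?thesis by linarith
    qed
  qed (use t in auto)
  have Am0: "A s \<in> borel_measurable M" if "s \<le> T" for s
    by (cases "0 \<le> s") (use AmM[of s] that in \<open>auto simp: A_def\<close>)
  show ?thesis
    unfolding J_def[symmetric]
  proof (rule entropy_bound_limit[where U="\<lambda>N \<omega>. \<Theta> (\<lambda>t. \<rho> (Suc N) t \<omega>)" and U'="\<lambda>N \<omega>. \<Theta> (\<lambda>t. \<rho>' (Suc N) t \<omega>)"
      and V="\<lambda>\<omega>. \<Theta> (\<lambda>t. W t \<omega>)" and V'="\<lambda>\<omega>. \<Theta> (\<lambda>t. W t \<omega> + A t \<omega>)" and \<psi>=\<psi> and c=c])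
    show "(\<lambda>\<omega>. \<Theta> (\<lambda>t. \<rho> (Suc N) t \<omega>)) \<in> borel_measurable M" for N
      unfolding \<rho>_def by (intro \<Theta>_meas(2) WmM gT zero_less_Suc)
    show "(\<lambda>\<omega>. \<Theta> (\<lambda>t. \<rho>' (Suc N) t \<omega>)) \<in> borel_measurable M" for N
    proof (rule \<Theta>_meas(2))
      fix t assume t: "t \<in> {0..T}"
      have g: "real (grid_index T (Suc N) t) * (T / real (Suc N)) \<in> {0..T}" by (intro gT[OF t] zero_less_Suc)
      have "0 \<le> T / real (Suc N)" using T by simp
      then have "real (grid_index T (Suc N) t) * (T / real (Suc N)) - T / real (Suc N) \<le> T"
        using g unfolding atLeastAtMost_iff by linarith
      then show "\<rho>' (Suc N) t \<in> borel_measurable M"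
        unfolding \<rho>'_def by (intro borel_measurable_add WmM Am0 g)
    qed
    show "(\<lambda>\<omega>. \<Theta> (\<lambda>t. W t \<omega>)) \<in> borel_measurable M" by (intro \<Theta>_meas(2) WmM)
    show "(\<lambda>\<omega>. \<Theta> (\<lambda>t. W t \<omega> + A t \<omega>)) \<in> borel_measurable M" by (intro \<Theta>_meas(2) borel_measurable_add WmM AmM)
    show "AE \<omega> in M. (\<lambda>N. \<Theta> (\<lambda>t. \<rho> (Suc N) t \<omega>)) \<longlonglongrightarrow> \<Theta> (\<lambda>t. W t \<omega>)"
      using Wl by (rule eventually_mono) (auto intro!: \<Theta>_cont)
    show "AE \<omega> in M. (\<lambda>N. \<Theta> (\<lambda>t. \<rho>' (Suc N) t \<omega>)) \<longlonglongrightarrow> \<Theta> (\<lambda>t. W t \<omega> + A t \<omega>)"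
      using Wl
    proof (rule eventually_mono)
      fix \<omega> assume w: "\<forall>t\<in>{0..T}. (\<lambda>N. \<rho> (Suc N) t \<omega>) \<longlonglongrightarrow> W t \<omega>"
      show "(\<lambda>N. \<Theta> (\<lambda>t. \<rho>' (Suc N) t \<omega>)) \<longlonglongrightarrow> \<Theta> (\<lambda>t. W t \<omega> + A t \<omega>)"
      proof (rule \<Theta>_cont)
        fix t assume t: "t \<in> {0..T}"
        show "(\<lambda>N. \<rho>' (Suc N) t \<omega>) \<longlonglongrightarrow> W t \<omega> + A t \<omega>"
          using tendsto_add[OF bspec[OF w t] Al[OF t, of \<omega>]] unfolding \<rho>'_def \<rho>_def .
      qed
    qed
    show "expectation (\<lambda>\<omega>. \<psi> (\<Theta> (\<lambda>t. \<rho>' (Suc N) t \<omega>)))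
      \<le> ln (expectation (\<lambda>\<omega>. exp (\<psi> (\<Theta> (\<lambda>t. \<rho> (Suc N) t \<omega>))))) + J T / 2" for N
      by (rule step) simp
  qed (use \<psi> in auto)
qed

section \<open>Fractional Brownian motion with drift\<close>

text \<open>
  The step integral of a single path, for use with \<open>W\<close>, with a drift and with their sum.
\<close>
definition step_value :: "(real \<times> real \<times> real) list \<Rightarrow> (real \<Rightarrow> real) \<Rightarrow> real" where
  "step_value \<phi> \<rho> = (\<Sum>(c, a, b)\<leftarrow>\<phi>. c * (\<rho> b - \<rho> a))"

lemma step_integral_eq_step_value: "step_integral W \<phi> \<omega> = step_value \<phi> (\<lambda>t. W t \<omega>)"
  by (simp add: step_integral_def step_value_def)

lemma step_value_Nil [simp]: "step_value [] \<rho> = 0"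
  and step_value_Cons [simp]: "step_value ((c, a, b) # \<phi>) \<rho> = c * (\<rho> b - \<rho> a) + step_value \<phi> \<rho>"
  by (simp_all add: step_value_def)

lemma step_fun_Nil [simp]: "step_fun [] s = 0"
  and step_fun_Cons [simp]: "step_fun ((c, a, b) # \<phi>) s = c * indicator {a<..b} s + step_fun \<phi> s"
  by (simp_all add: step_fun_def)

lemma step_value_add: "step_value \<phi> (\<lambda>t. \<rho> t + \<rho>' t) = step_value \<phi> \<rho> + step_value \<phi> \<rho>'"
  by (induction \<phi>) (auto simp: algebra_simps)

lemma borel_measurable_step_fun [measurable]: "step_fun \<phi> \<in> borel_measurable borel"
  by (induction \<phi>) (auto simp: step_fun_def[abs_def] split: prod.splits)

lemma borel_measurable_step_value:
  assumes "\<And>t. t \<in> S \<Longrightarrow> R t \<in> borel_measurable N" "\<forall>(c, a, b)\<in>set \<phi>. a \<in> S \<and> b \<in> S"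
  shows "(\<lambda>\<omega>. step_value \<phi> (\<lambda>t. R t \<omega>)) \<in> borel_measurable N"
  using assms(2)
proof (induction \<phi>)
  case (Cons z \<phi>)
  obtain c a b where z: "z = (c, a, b)" by (cases z)
  then have "R a \<in> borel_measurable N" "R b \<in> borel_measurable N" using assms(1) Cons.prems by auto
  moreover have "(\<lambda>\<omega>. step_value \<phi> (\<lambda>t. R t \<omega>)) \<in> borel_measurable N" using Cons by auto
  ultimately show ?case unfolding z by simp
qed simp

lemma tendsto_step_value:
  assumes "\<And>t. t \<in> S \<Longrightarrow> ((\<lambda>N. \<rho>' N t) \<longlongrightarrow> \<rho> t) F" "\<forall>(c, a, b)\<in>set \<phi>. a \<in> S \<and> b \<in> S"
  shows "((\<lambda>N. step_value \<phi> (\<rho>' N)) \<longlongrightarrow> step_value \<phi> \<rho>) F"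
  using assms(2)
proof (induction \<phi>)
  case (Cons z \<phi>)
  obtain c a b where z: "z = (c, a, b)" by (cases z)
  have "((\<lambda>N. step_value \<phi> (\<rho>' N)) \<longlongrightarrow> step_value \<phi> \<rho>) F" using Cons by auto
  then show ?case unfolding z using assms(1) Cons.prems z by (auto intro!: tendsto_intros)
qed simp

lemma step_value_integral:
  assumes [measurable]: "v \<in> borel_measurable borel" and k: "\<And>s. 0 \<le> s \<Longrightarrow> s \<le> t \<Longrightarrow> \<bar>v s\<bar> \<le> k"
    and \<phi>: "\<forall>(c, a, b)\<in>set \<phi>. 0 \<le> a \<and> a \<le> b \<and> b \<le> t" and t: "0 \<le> t"
  shows "integrable lborel (\<lambda>s. indicator {0..t} s * (step_fun \<phi> s * v s))"
    and "(\<integral>s. indicator {0..t} s * (step_fun \<phi> s * v s) \<partial>lborel) = step_value \<phi> (\<lambda>\<tau>. \<integral>s. indicator {0..<\<tau>} s * v s \<partial>lborel)"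
proof -
  have int: "integrable lborel (\<lambda>s. indicator D s * v s)" if [measurable]: "D \<in> sets borel" and D: "D \<subseteq> {0..t}" for D
  proof (rule Bochner_Integration.integrable_bound)
    show "integrable lborel (\<lambda>s. indicator {0..t} s * k)" using t by simp
    show "AE s in lborel. norm (indicator D s * v s) \<le> norm (indicator {0..t} s * k)"
      using k D by (intro AE_I2) (force simp: indicator_def)
  qed measurable
  have inc: "(\<integral>s. indicator {a<..b} s * v s \<partial>lborel) = (\<integral>s. indicator {0..<b} s * v s \<partial>lborel) - (\<integral>s. indicator {0..<a} s * v s \<partial>lborel)"
    if "0 \<le> a" "a \<le> b" "b \<le> t" for a b
  proof -
    have "(\<integral>s. indicator {a<..b} s * v s \<partial>lborel) = (\<integral>s. indicator {0..<b} s * v s - indicator {0..<a} s * v s \<partial>lborel)"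
    proof (rule integral_cong_AE)
      have "AE s in lborel. s \<noteq> a" "AE s in lborel. s \<noteq> b" by (rule AE_lborel_singleton)+
      then show "AE s in lborel. indicator {a<..b} s * v s = indicator {0..<b} s * v s - indicator {0..<a} s * v s"
        by eventually_elim (use that in \<open>auto simp: indicator_def\<close>)
    qed measurable
    also have "\<dots> = (\<integral>s. indicator {0..<b} s * v s \<partial>lborel) - (\<integral>s. indicator {0..<a} s * v s \<partial>lborel)"
      using that by (intro Bochner_Integration.integral_diff int) auto
    finally show ?thesis .
  qed
  have "integrable lborel (\<lambda>s. indicator {0..t} s * (step_fun \<phi> s * v s)) \<and>
    (\<integral>s. indicator {0..t} s * (step_fun \<phi> s * v s) \<partial>lborel) = step_value \<phi> (\<lambda>\<tau>. \<integral>s. indicator {0..<\<tau>} s * v s \<partial>lborel)"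
    using \<phi>
  proof (induction \<phi>)
    case (Cons z \<phi>)
    obtain c a b where z: "z = (c, a, b)" by (cases z)
    have ab: "0 \<le> a" "a \<le> b" "b \<le> t" using Cons.prems z by auto
    have IH: "integrable lborel (\<lambda>s. indicator {0..t} s * (step_fun \<phi> s * v s))"
      "(\<integral>s. indicator {0..t} s * (step_fun \<phi> s * v s) \<partial>lborel) = step_value \<phi> (\<lambda>\<tau>. \<integral>s. indicator {0..<\<tau>} s * v s \<partial>lborel)"
      using Cons by auto
    have e: "indicator {0..t} s * (step_fun (z # \<phi>) s * v s) = c * (indicator {a<..b} s * v s) + indicator {0..t} s * (step_fun \<phi> s * v s)" for s
      unfolding z using ab by (auto simp: indicator_def algebra_simps)
    have i: "integrable lborel (\<lambda>s. c * (indicator {a<..b} s * v s))"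
      using ab by (intro integrable_mult_right int) auto
    show ?case unfolding e using i IH inc[OF ab] z by simp
  qed simp
  then show "integrable lborel (\<lambda>s. indicator {0..t} s * (step_fun \<phi> s * v s))"
    "(\<integral>s. indicator {0..t} s * (step_fun \<phi> s * v s) \<partial>lborel) = step_value \<phi> (\<lambda>\<tau>. \<integral>s. indicator {0..<\<tau>} s * v s \<partial>lborel)"
    by auto
qed

lemma integral_powr_sq:
  fixes H T \<kappa> :: real
  assumes H: "0 < H" "H < 1/2" and T: "0 \<le> T"
  shows "integrable lborel (\<lambda>s. indicator {0..<T} s * (\<kappa> * s powr (1/2 - H))\<^sup>2)"
    and "(\<integral>s. indicator {0..<T} s * (\<kappa> * s powr (1/2 - H))\<^sup>2 \<partial>lborel) = \<kappa>\<^sup>2 * (T powr (2 - 2 * H) / (2 - 2 * H))"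
proof -
  have "((\<lambda>s. s powr (1 - 2 * H)) has_integral (T powr (2 - 2 * H) / (2 - 2 * H))) {0..T}"
    using has_integral_powr_from_0[of "1 - 2 * H" T] H T by (simp add: algebra_simps)
  then have "((\<lambda>s. indicator {0..T} s * s powr (1 - 2 * H)) has_integral (T powr (2 - 2 * H) / (2 - 2 * H))) UNIV"
    by (subst (asm) has_integral_restrict_UNIV[symmetric]) (auto elim!: has_integral_eq[rotated] simp: indicator_def)
  then have "(\<integral>\<^sup>+s. ennreal (indicator {0..T} s * s powr (1 - 2 * H)) \<partial>lborel) = ennreal (T powr (2 - 2 * H) / (2 - 2 * H))"
    by (intro nn_integral_has_integral_lborel) auto
  then have "has_bochner_integral lborel (\<lambda>s. indicator {0..T} s * s powr (1 - 2 * H)) (T powr (2 - 2 * H) / (2 - 2 * H))"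
    using H by (intro has_bochner_integral_nn_integral) auto
  then have "has_bochner_integral lborel (\<lambda>s. \<kappa>\<^sup>2 * (indicator {0..T} s * s powr (1 - 2 * H))) (\<kappa>\<^sup>2 * (T powr (2 - 2 * H) / (2 - 2 * H)))"
    by (intro has_bochner_integral_mult_right)
  then have "has_bochner_integral lborel (\<lambda>s. indicator {0..<T} s * (\<kappa> * s powr (1/2 - H))\<^sup>2) (\<kappa>\<^sup>2 * (T powr (2 - 2 * H) / (2 - 2 * H)))"
  proof (rule has_bochner_integral_cong_AE[THEN iffD1, rotated -1])
    have "AE s in lborel. s \<noteq> T" by (rule AE_lborel_singleton)
    then show "AE s in lborel. \<kappa>\<^sup>2 * (indicator {0..T} s * s powr (1 - 2 * H)) = indicator {0..<T} s * (\<kappa> * s powr (1/2 - H))\<^sup>2"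
    proof eventually_elim
      fix s :: real assume s: "s \<noteq> T"
      have "(s powr (1/2 - H))\<^sup>2 = s powr (1 - 2 * H)"
        by (simp add: power2_eq_square powr_add[symmetric])
      then show "\<kappa>\<^sup>2 * (indicator {0..T} s * s powr (1 - 2 * H)) = indicator {0..<T} s * (\<kappa> * s powr (1/2 - H))\<^sup>2"
        using s by (auto simp: indicator_def power_mult_distrib)
    qed
  qed measurable
  then show "integrable lborel (\<lambda>s. indicator {0..<T} s * (\<kappa> * s powr (1/2 - H))\<^sup>2)"
    and "(\<integral>s. indicator {0..<T} s * (\<kappa> * s powr (1/2 - H))\<^sup>2 \<partial>lborel) = \<kappa>\<^sup>2 * (T powr (2 - 2 * H) / (2 - 2 * H))"
    by (auto simp: has_bochner_integral_iff)
qed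

lemma frac_drift_cong:
  assumes "\<And>r. 0 < r \<Longrightarrow> r < s \<Longrightarrow> u r = u' r"
  shows "frac_drift H u s = frac_drift H u' s"
proof -
  have "indicator {0<..<s} r * (r powr (1/2 - H) * (s - r) powr (- 1/2 - H) * u r)
      = indicator {0<..<s} r * (r powr (1/2 - H) * (s - r) powr (- 1/2 - H) * u' r)" for r
    using assms[of r] by (auto simp: indicator_def)
  then show ?thesis unfolding frac_drift_def by (simp only:)
qed

text \<open>
  The variable \<open>B (\<tau> j)\<close> is an \<open>L\<^sup>2\<close> limit of step integrals of \<open>W\<close>. Integrated against the drift
  with density \<open>v = frac_drift H (u \<omega>)\<close>, the same step functions converge to the integral of the
  kernel times \<open>v\<close>, which is the integral of \<open>u\<close>. So both sides are limits of the two sides of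
  \<open>wiener_drift_entropy_bound\<close>, with the functional that sends a path to the Euler scheme driven by
  its step integrals.
\<close>
lemma (in lipschitz_drift) fractional_drift_entropy_bound:
  fixes W B :: "real \<Rightarrow> 'a \<Rightarrow> real" and u :: "'a \<Rightarrow> real \<Rightarrow> real" and \<psi> :: "real \<Rightarrow> real" and c cu :: real
  assumes H: "0 < H" "H < 1/2" and T: "0 < T" and F: "filtered_prob_space M F T"
    and B: "fractional_brownian_motion M F T H W B"
    and u[measurable]: "\<And>\<omega>. u \<omega> \<in> borel_measurable borel" and ub: "\<And>\<omega> r. 0 \<le> r \<Longrightarrow> r \<le> T \<Longrightarrow> \<bar>u \<omega> r\<bar> \<le> cu"
    and prog: "\<And>t. t \<in> {0..T} \<Longrightarrow> (\<lambda>(r, \<omega>). indicator {0..t} r * u \<omega> r) \<in> borel_measurable (borel \<Otimes>\<^sub>M F t)"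
    and \<tau>: "\<And>j. j \<le> n \<Longrightarrow> \<tau> j \<in> {0..T}" and \<delta>: "0 \<le> \<delta>"
    and \<psi>: "continuous_on UNIV \<psi>" "\<And>x. \<bar>\<psi> x\<bar> \<le> c"
  shows "(\<integral>\<omega>. \<psi> (euler b \<delta> x (\<lambda>j. B (\<tau> j) \<omega> + (\<integral>r. indicator {0<..<\<tau> j} r * u \<omega> r \<partial>lborel)) n) \<partial>M)
     \<le> ln (\<integral>\<omega>. exp (\<psi> (euler b \<delta> x (\<lambda>j. B (\<tau> j) \<omega>) n)) \<partial>M)
       + (cu * (Beta (3/2 - H) (1/2 - H) / Gamma (1/2 - H)))\<^sup>2 * (T powr (2 - 2 * H) / (2 - 2 * H)) / 2"
proof -
  interpret prob_space M using F by (simp add: filtered_prob_space_def)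
  define \<kappa> where "\<kappa> = cu * (Beta (3/2 - H) (1/2 - H) / Gamma (1/2 - H))"
  define k where "k s = \<kappa> * s powr (1/2 - H)" for s
  define v where "v \<omega> = frac_drift H (u \<omega>)" for \<omega>
  define A where "A t \<omega> = (\<integral>s. indicator {0..<t} s * v \<omega> s \<partial>lborel)" for t \<omega>
  have W: "wiener_process M F T W" and wi: "\<And>t. t \<in> {0..T} \<Longrightarrow> has_wiener_integral M W t (fbm_kernel H t) (B t)"
    using B by (auto simp: fractional_brownian_motion_def)
  have sub: "subalgebra M (F t)" if "t \<in> {0..T}" for t
    using F that by (simp add: filtered_prob_space_def)
  have WmM: "W t \<in> borel_measurable M" if "t \<in> {0..T}" for t
    using measurable_from_subalg[OF sub[OF that], of "W t"] W that by (simp add: wiener_process_def adapted_def)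
  have BmM: "B t \<in> borel_measurable M" if "t \<in> {0..T}" for t
    using wi[OF that] by (simp add: has_wiener_integral_def)
  have Km: "(\<lambda>s. indicator {0..t} s * fbm_kernel H t s) \<in> borel_measurable borel" if "t \<in> {0..T}" for t
    using wi[OF that] by (simp add: has_wiener_integral_def set_borel_measurable_def)
  have Km': "fbm_kernel H t \<in> borel_measurable borel" if "t \<in> {0..T}" for t
  proof -
    have "fbm_kernel H t = (\<lambda>s. indicator {0..t} s * fbm_kernel H t s)"
      by (auto simp: fbm_kernel_def indicator_def)
    then show ?thesis using Km[OF that] by simp
  qed
  have vm[measurable]: "v \<omega> \<in> borel_measurable borel" for \<omega> unfolding v_def by measurable
  have vk: "\<bar>v \<omega> s\<bar> \<le> k s" if "0 \<le> s" "s \<le> T" for \<omega> s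
    unfolding v_def k_def \<kappa>_def by (rule abs_frac_drift_le[OF H u]) (use ub that in auto)
  have \<kappa>0: "0 \<le> \<kappa>"
    using vk[of T undefined] T by (auto simp: k_def zero_le_mult_iff dest: order_trans[OF abs_ge_zero])
  have kk: "k s \<le> \<kappa> * T powr (1/2 - H)" if "0 \<le> s" "s \<le> T" for s
    unfolding k_def using that H \<kappa>0 by (intro mult_left_mono powr_mono2) auto
  have Am: "A t \<in> borel_measurable (F t)" if t: "t \<in> {0..T}" for t
  proof -
    have "(\<lambda>(s, \<omega>). frac_drift H (\<lambda>r. indicator {0..t} r * u \<omega> r) s) \<in> borel_measurable (borel \<Otimes>\<^sub>M F t)"
      by (rule borel_measurable_frac_drift[OF prog[OF t]])
    from measurable_compose[OF measurable_pair_swap' this]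
    have [measurable]: "(\<lambda>p. frac_drift H (\<lambda>r. indicator {0..t} r * u (fst p) r) (snd p)) \<in> borel_measurable (F t \<Otimes>\<^sub>M borel)"
      by (simp add: case_prod_beta')
    have "(\<lambda>\<omega>. \<integral>s. indicator {0..<t} s * frac_drift H (\<lambda>r. indicator {0..t} r * u \<omega> r) s \<partial>lborel) \<in> borel_measurable (F t)"
      by (rule lborel.borel_measurable_lebesgue_integral) (simp add: case_prod_beta')
    also have "(\<lambda>\<omega>. \<integral>s. indicator {0..<t} s * frac_drift H (\<lambda>r. indicator {0..t} r * u \<omega> r) s \<partial>lborel) = A t"
    proof (rule ext)
      fix \<omega>
      show "(\<integral>s. indicator {0..<t} s * frac_drift H (\<lambda>r. indicator {0..t} r * u \<omega> r) s \<partial>lborel) = A t \<omega>"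
        unfolding A_def v_def
      proof (rule Bochner_Integration.integral_cong[OF refl])
        fix s :: real
        have "frac_drift H (\<lambda>r. indicator {0..t} r * u \<omega> r) s = frac_drift H (u \<omega>) s" if "s < t"
          by (rule frac_drift_cong) (use that in auto)
        then show "indicator {0..<t} s * frac_drift H (\<lambda>r. indicator {0..t} r * u \<omega> r) s = indicator {0..<t} s * frac_drift H (u \<omega>) s"
          by (auto simp: indicator_def)
      qed
    qed
    finally show ?thesis .
  qed
  have AmM: "A t \<in> borel_measurable M" if "t \<in> {0..T}" for t
    using measurable_from_subalg[OF sub[OF that] Am[OF that]] .
  have "\<forall>j\<in>{..n}. \<exists>\<phi>. (\<forall>m. \<forall>(c, a, b)\<in>set (\<phi> m). 0 \<le> a \<and> a \<le> b \<and> b \<le> \<tau> j) \<and>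
        (\<lambda>m. \<integral>\<^sup>+s\<in>{0..\<tau> j}. ennreal ((fbm_kernel H (\<tau> j) s - step_fun (\<phi> m) s)\<^sup>2) \<partial>lborel) \<longlonglongrightarrow> 0 \<and>
        (\<lambda>m. \<integral>\<^sup>+\<omega>. ennreal ((B (\<tau> j) \<omega> - step_integral W (\<phi> m) \<omega>)\<^sup>2) \<partial>M) \<longlonglongrightarrow> 0"
    using wi[OF \<tau>] unfolding has_wiener_integral_def by blast
  from bchoice[OF this] obtain \<phi> where \<phi>0: "\<forall>j\<in>{..n}. (\<forall>m. \<forall>(c, a, b)\<in>set (\<phi> j m). 0 \<le> a \<and> a \<le> b \<and> b \<le> \<tau> j) \<and>
        (\<lambda>m. \<integral>\<^sup>+s\<in>{0..\<tau> j}. ennreal ((fbm_kernel H (\<tau> j) s - step_fun (\<phi> j m) s)\<^sup>2) \<partial>lborel) \<longlonglongrightarrow> 0 \<and>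
        (\<lambda>m. \<integral>\<^sup>+\<omega>. ennreal ((B (\<tau> j) \<omega> - step_integral W (\<phi> j m) \<omega>)\<^sup>2) \<partial>M) \<longlonglongrightarrow> 0" by blast
  then have \<phi>: "\<And>j m. j \<le> n \<Longrightarrow> \<forall>(c, a, b)\<in>set (\<phi> j m). 0 \<le> a \<and> a \<le> b \<and> b \<le> \<tau> j"
    "\<And>j. j \<le> n \<Longrightarrow> (\<lambda>m. \<integral>\<^sup>+s\<in>{0..\<tau> j}. ennreal ((fbm_kernel H (\<tau> j) s - step_fun (\<phi> j m) s)\<^sup>2) \<partial>lborel) \<longlonglongrightarrow> 0"
    "\<And>j. j \<le> n \<Longrightarrow> (\<lambda>m. \<integral>\<^sup>+\<omega>. ennreal ((B (\<tau> j) \<omega> - step_integral W (\<phi> j m) \<omega>)\<^sup>2) \<partial>M) \<longlonglongrightarrow> 0"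
    by blast+
  have \<phi>T: "\<forall>(c, a, b)\<in>set (\<phi> j m). a \<in> {0..T} \<and> b \<in> {0..T}" if "j \<le> n" for j m
    using \<phi>(1)[OF that, of m] \<tau>[OF that] by fastforce
  define Y where "Y j m \<omega> = step_value (\<phi> j m) (\<lambda>t. W t \<omega>)" for j m \<omega>
  have Ym: "Y j m \<in> borel_measurable M" if "j \<le> n" for j m
    unfolding Y_def using borel_measurable_step_value[of "{0..T}" W M, OF WmM \<phi>T[OF that]] .
  have L2: "(\<lambda>m. \<integral>\<^sup>+\<omega>. ennreal ((B (\<tau> j) \<omega> - Y j m \<omega>)\<^sup>2) \<partial>M) \<longlonglongrightarrow> 0" if "j \<le> n" for j
    using \<phi>(3)[OF that] by (simp add: Y_def step_integral_eq_step_value)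
  obtain r where r: "strict_mono r" "AE \<omega> in M. \<forall>j\<le>n. (\<lambda>m. Y j (r m) \<omega>) \<longlonglongrightarrow> B (\<tau> j) \<omega>"
  proof -
    \<comment> \<open>The sum of the squared errors tends to 0 in \<open>L\<^sup>1\<close>, hence almost surely along a subsequence, which
       serves all \<open>j\<close> simultaneously.\<close>
    define D where "D m \<omega> = (\<Sum>j\<le>n. (B (\<tau> j) \<omega> - Y j m \<omega>)\<^sup>2)" for m \<omega>
    have Dm[measurable]: "D m \<in> borel_measurable M" for m
      unfolding D_def using Ym BmM[OF \<tau>] by (intro borel_measurable_sum borel_measurable_power borel_measurable_diff) auto
    have D0: "0 \<le> D m \<omega>" for m \<omega> unfolding D_def by (intro sum_nonneg) auto
    have "(\<lambda>m. \<Sum>j\<le>n. \<integral>\<^sup>+\<omega>. ennreal ((B (\<tau> j) \<omega> - Y j m \<omega>)\<^sup>2) \<partial>M) \<longlonglongrightarrow> (\<Sum>j\<le>n. 0)"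
      using L2 by (intro tendsto_sum) auto
    moreover have "(\<Sum>j\<le>n. \<integral>\<^sup>+\<omega>. ennreal ((B (\<tau> j) \<omega> - Y j m \<omega>)\<^sup>2) \<partial>M) = (\<integral>\<^sup>+\<omega>. ennreal (D m \<omega>) \<partial>M)" for m
    proof -
      have "(\<integral>\<^sup>+\<omega>. ennreal (D m \<omega>) \<partial>M) = (\<integral>\<^sup>+\<omega>. (\<Sum>j\<le>n. ennreal ((B (\<tau> j) \<omega> - Y j m \<omega>)\<^sup>2)) \<partial>M)"
        unfolding D_def by (intro nn_integral_cong) (simp add: sum_ennreal)
      also have "\<dots> = (\<Sum>j\<le>n. \<integral>\<^sup>+\<omega>. ennreal ((B (\<tau> j) \<omega> - Y j m \<omega>)\<^sup>2) \<partial>M)"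
      proof (rule nn_integral_sum)
        fix j assume "j \<in> {..n}"
        then have [measurable]: "B (\<tau> j) \<in> borel_measurable M" "Y j m \<in> borel_measurable M"
          using Ym BmM[OF \<tau>] by auto
        show "(\<lambda>\<omega>. ennreal ((B (\<tau> j) \<omega> - Y j m \<omega>)\<^sup>2)) \<in> borel_measurable M" by measurable
      qed
      finally show ?thesis by simp
    qed
    ultimately have Dl: "(\<lambda>m. \<integral>\<^sup>+\<omega>. ennreal (D m \<omega>) \<partial>M) \<longlonglongrightarrow> 0" by simp
    \<comment> \<open>The convergence makes \<open>D m\<close> integrable from some index on.\<close>
    then have "eventually (\<lambda>m. (\<integral>\<^sup>+\<omega>. ennreal (D m \<omega>) \<partial>M) < \<infinity>) sequentially"
      by (rule order_tendstoD) simp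
    then obtain m0 where m0: "\<And>m. m \<ge> m0 \<Longrightarrow> (\<integral>\<^sup>+\<omega>. ennreal (D m \<omega>) \<partial>M) < \<infinity>"
      unfolding eventually_sequentially by blast
    have Di: "integrable M (D (m + m0))" for m
      using m0[of "m + m0"] D0 by (intro integrableI_nonneg) auto
    have "(\<lambda>m. \<integral>\<omega>. norm (D (m + m0) \<omega>) \<partial>M) \<longlonglongrightarrow> 0"
    proof -
      have "(\<lambda>m. enn2real (\<integral>\<^sup>+\<omega>. ennreal (D (m + m0) \<omega>) \<partial>M)) \<longlonglongrightarrow> 0"
        by (rule tendsto_enn2real) (use LIMSEQ_ignore_initial_segment[OF Dl] in auto)
      then show ?thesis using D0 by (simp add: integral_eq_nn_integral)
    qed
    from tendsto_L1_AE_subseq[OF Di this] obtain r' where r': "strict_mono r'" "AE \<omega> in M. (\<lambda>m. D (r' m + m0) \<omega>) \<longlonglongrightarrow> 0"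
      by blast
    show thesis
    proof (rule that[of "\<lambda>m. r' m + m0"])
      show "strict_mono (\<lambda>m. r' m + m0)" using r'(1) by (simp add: strict_mono_def)
      show "AE \<omega> in M. \<forall>j\<le>n. (\<lambda>m. Y j (r' m + m0) \<omega>) \<longlonglongrightarrow> B (\<tau> j) \<omega>"
        using r'(2)
      proof (rule eventually_mono, intro allI impI)
        fix \<omega> j assume l: "(\<lambda>m. D (r' m + m0) \<omega>) \<longlonglongrightarrow> 0" and j: "j \<le> n"
        have le: "(B (\<tau> j) \<omega> - Y j m \<omega>)\<^sup>2 \<le> D m \<omega>" for m
          unfolding D_def using j by (intro member_le_sum[of j "{..n}" "\<lambda>j. (B (\<tau> j) \<omega> - Y j m \<omega>)\<^sup>2"]) auto
        have "(\<lambda>m. (B (\<tau> j) \<omega> - Y j (r' m + m0) \<omega>)\<^sup>2) \<longlonglongrightarrow> 0"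
          by (rule tendsto_sandwich[OF _ _ tendsto_const l]) (use le in auto)
        then have "(\<lambda>m. B (\<tau> j) \<omega> - Y j (r' m + m0) \<omega>) \<longlonglongrightarrow> 0"
          by simp
        from tendsto_diff[OF tendsto_const this, of "B (\<tau> j) \<omega>"]
        show "(\<lambda>m. Y j (r' m + m0) \<omega>) \<longlonglongrightarrow> B (\<tau> j) \<omega>" by simp
      qed
    qed
  qed
  have drift: "(\<lambda>m. step_value (\<phi> j (r m)) (\<lambda>t. A t \<omega>)) \<longlonglongrightarrow> (\<integral>r. indicator {0<..<\<tau> j} r * u \<omega> r \<partial>lborel)" if j: "j \<le> n" for j \<omega>
  proof -
    have t: "\<tau> j \<in> {0..T}" using \<tau>[OF j] .
    have vb: "\<bar>v \<omega> s\<bar> \<le> \<kappa> * T powr (1/2 - H)" if "0 \<le> s" "s \<le> \<tau> j" for s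
      using vk[of s \<omega>] kk[of s] that t by auto
    note si = step_value_integral[OF vm vb \<phi>(1)[OF j]]
    have "(\<lambda>m. \<integral>s. indicator {0..\<tau> j} s * (step_fun (\<phi> j m) s * v \<omega> s) \<partial>lborel) \<longlonglongrightarrow>
        (\<integral>s. indicator {0..\<tau> j} s * (fbm_kernel H (\<tau> j) s * v \<omega> s) \<partial>lborel)"
      by (rule tendsto_integral_mult_of_L2[OF \<phi>(2)[OF j] Km[OF t] borel_measurable_step_fun vm vb]) (use si(1) t in auto)
    then have "(\<lambda>m. step_value (\<phi> j m) (\<lambda>t. A t \<omega>)) \<longlonglongrightarrow> (\<integral>s. indicator {0..\<tau> j} s * (fbm_kernel H (\<tau> j) s * v \<omega> s) \<partial>lborel)"
      using si(2) t by (simp add: A_def)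
    moreover have "(\<integral>s. indicator {0..\<tau> j} s * (fbm_kernel H (\<tau> j) s * v \<omega> s) \<partial>lborel) = (\<integral>r. indicator {0<..<\<tau> j} r * u \<omega> r \<partial>lborel)"
    proof (cases "\<tau> j = 0")
      case True
      moreover have "fbm_kernel H 0 s = 0" for s by (simp add: fbm_kernel_def)
      ultimately show ?thesis by simp
    next
      case False
      have "(\<lambda>s. indicator {0..\<tau> j} s * (fbm_kernel H (\<tau> j) s * v \<omega> s)) = (\<lambda>s. indicator {0<..<\<tau> j} s * (fbm_kernel H (\<tau> j) s * frac_drift H (u \<omega>) s))"
        by (auto simp: fbm_kernel_def indicator_def v_def)
      then show ?thesis
        using integral_fbm_kernel_frac_drift[OF H u[of \<omega>] Km'[OF t], of cu] ub[of _ \<omega>] False t by simp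
    qed
    ultimately show ?thesis
      using r(1) by (auto intro: LIMSEQ_subseq_LIMSEQ[unfolded comp_def])
  qed
  have Yb: "(\<lambda>m. step_value (\<phi> j (r m)) (\<lambda>t. W t \<omega> + A t \<omega>)) = (\<lambda>m. Y j (r m) \<omega> + step_value (\<phi> j (r m)) (\<lambda>t. A t \<omega>))" for j \<omega>
    by (simp add: step_value_add Y_def)
  have im: "(\<lambda>\<omega>. \<integral>r. indicator {0<..<\<tau> j} r * u \<omega> r \<partial>lborel) \<in> borel_measurable M" if j: "j \<le> n" for j
  proof (rule borel_measurable_LIMSEQ_real)
    show "(\<lambda>m. step_value (\<phi> j (r m)) (\<lambda>t. A t \<omega>)) \<longlonglongrightarrow> (\<integral>r. indicator {0<..<\<tau> j} r * u \<omega> r \<partial>lborel)" for \<omega>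
      by (rule drift[OF j])
    show "(\<lambda>\<omega>. step_value (\<phi> j (r m)) (\<lambda>t. A t \<omega>)) \<in> borel_measurable M" for m
      by (rule borel_measurable_step_value[OF AmM \<phi>T[OF j]])
  qed
  have J: "(\<integral>s. indicator {0..<T} s * (k s)\<^sup>2 \<partial>lborel) = \<kappa>\<^sup>2 * (T powr (2 - 2 * H) / (2 - 2 * H))"
    unfolding k_def using integral_powr_sq(2)[OF H, of T \<kappa>] T by simp
  show ?thesis
    unfolding \<kappa>_def[symmetric]
  proof (rule entropy_bound_limit[where U="\<lambda>m \<omega>. euler b \<delta> x (\<lambda>j. Y j (r m) \<omega>) n"
        and U'="\<lambda>m \<omega>. euler b \<delta> x (\<lambda>j. step_value (\<phi> j (r m)) (\<lambda>t. W t \<omega> + A t \<omega>)) n"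
        and V="\<lambda>\<omega>. euler b \<delta> x (\<lambda>j. B (\<tau> j) \<omega>) n"
        and V'="\<lambda>\<omega>. euler b \<delta> x (\<lambda>j. B (\<tau> j) \<omega> + (\<integral>r. indicator {0<..<\<tau> j} r * u \<omega> r \<partial>lborel)) n"
        and \<psi>=\<psi> and c=c])
    show "(\<lambda>\<omega>. euler b \<delta> x (\<lambda>j. Y j (r m) \<omega>) n) \<in> borel_measurable M" for m
      by (rule borel_measurable_euler[OF \<delta> Ym]) auto
    show "(\<lambda>\<omega>. euler b \<delta> x (\<lambda>j. step_value (\<phi> j (r m)) (\<lambda>t. W t \<omega> + A t \<omega>)) n) \<in> borel_measurable M" for m
      by (intro borel_measurable_euler[OF \<delta>] borel_measurable_step_value[OF _ \<phi>T] borel_measurable_add WmM AmM borel_measurable_const)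
    show "(\<lambda>\<omega>. euler b \<delta> x (\<lambda>j. B (\<tau> j) \<omega>) n) \<in> borel_measurable M"
      by (intro borel_measurable_euler[OF \<delta>] BmM \<tau> borel_measurable_const)
    show "(\<lambda>\<omega>. euler b \<delta> x (\<lambda>j. B (\<tau> j) \<omega> + (\<integral>r. indicator {0<..<\<tau> j} r * u \<omega> r \<partial>lborel)) n) \<in> borel_measurable M"
      by (intro borel_measurable_euler[OF \<delta>] borel_measurable_add BmM \<tau> im borel_measurable_const)
    show "AE \<omega> in M. (\<lambda>m. euler b \<delta> x (\<lambda>j. Y j (r m) \<omega>) n) \<longlonglongrightarrow> euler b \<delta> x (\<lambda>j. B (\<tau> j) \<omega>) n"
      using r(2) by (rule eventually_mono) (auto intro!: tendsto_euler[OF \<delta>])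
    show "AE \<omega> in M. (\<lambda>m. euler b \<delta> x (\<lambda>j. step_value (\<phi> j (r m)) (\<lambda>t. W t \<omega> + A t \<omega>)) n)
       \<longlonglongrightarrow> euler b \<delta> x (\<lambda>j. B (\<tau> j) \<omega> + (\<integral>r. indicator {0<..<\<tau> j} r * u \<omega> r \<partial>lborel)) n"
      using r(2)
    proof (rule eventually_mono)
      fix \<omega> assume "\<forall>j\<le>n. (\<lambda>m. Y j (r m) \<omega>) \<longlonglongrightarrow> B (\<tau> j) \<omega>"
      then show "(\<lambda>m. euler b \<delta> x (\<lambda>j. step_value (\<phi> j (r m)) (\<lambda>t. W t \<omega> + A t \<omega>)) n)
       \<longlonglongrightarrow> euler b \<delta> x (\<lambda>j. B (\<tau> j) \<omega> + (\<integral>r. indicator {0<..<\<tau> j} r * u \<omega> r \<partial>lborel)) n"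
        by (intro tendsto_euler[OF \<delta>]) (auto simp: Yb intro!: tendsto_add drift)
    qed
    show "expectation (\<lambda>\<omega>. \<psi> (euler b \<delta> x (\<lambda>j. step_value (\<phi> j (r m)) (\<lambda>t. W t \<omega> + A t \<omega>)) n))
      \<le> ln (expectation (\<lambda>\<omega>. exp (\<psi> (euler b \<delta> x (\<lambda>j. Y j (r m) \<omega>) n)))) + \<kappa>\<^sup>2 * (T powr (2 - 2 * H) / (2 - 2 * H)) / 2" for m
      unfolding J[symmetric] Y_def A_def
    proof (rule wiener_drift_entropy_bound[OF T F W, where \<Theta>="\<lambda>\<rho>. euler b \<delta> x (\<lambda>j. step_value (\<phi> j (r m)) \<rho>) n" and \<psi>=\<psi> and c=c])
      show "(\<lambda>\<omega>. \<integral>s. indicator {0..<t} s * v \<omega> s \<partial>lborel) \<in> borel_measurable (F t)" if "t \<in> {0..T}" for t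
        using Am[OF that] unfolding A_def[abs_def] .
      show "(\<lambda>p. euler b \<delta> x (\<lambda>j. step_value (\<phi> j (r m)) (\<lambda>t. p (grid_index T N t))) n) \<in> borel_measurable (PiM UNIV (\<lambda>_::nat. borel :: real measure))" for N
        by (intro borel_measurable_euler[OF \<delta>] borel_measurable_step_value[OF _ \<phi>T] measurable_component_singleton UNIV_I borel_measurable_const)
      show "(\<lambda>\<omega>. euler b \<delta> x (\<lambda>j. step_value (\<phi> j (r m)) (\<lambda>t. R t \<omega>)) n) \<in> borel_measurable M" if "\<And>t. t \<in> {0..T} \<Longrightarrow> R t \<in> borel_measurable M" for R
        by (intro borel_measurable_euler[OF \<delta>] borel_measurable_step_value[OF _ \<phi>T] that borel_measurable_const)
      show "(\<lambda>N. euler b \<delta> x (\<lambda>j. step_value (\<phi> j (r m)) (\<rho>' N)) n) \<longlonglongrightarrow> euler b \<delta> x (\<lambda>j. step_value (\<phi> j (r m)) \<rho>) n"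
        if "\<And>t. t \<in> {0..T} \<Longrightarrow> (\<lambda>N. \<rho>' N t) \<longlonglongrightarrow> \<rho> t" for \<rho>' \<rho>
        by (intro tendsto_euler[OF \<delta>] tendsto_step_value[OF _ \<phi>T] that)
      show "integrable lborel (\<lambda>s. indicator {0..<T} s * (k s)\<^sup>2)"
        unfolding k_def using integral_powr_sq(1)[OF H, of T \<kappa>] T by simp
    qed (use vk kk \<psi> in auto)
  qed (use \<psi> in auto)
qed

section \<open>The coupling of two solutions\<close>

text \<open>
  The paths of a solution are continuous only outside a null set, which need not belong to the
  filtration. This version of \<open>Y\<close> is progressively measurable without exceptional set and agrees
  with \<open>Y\<close> along every continuous path.
\<close>
definition grid_limit :: "(real \<Rightarrow> 'a \<Rightarrow> real) \<Rightarrow> 'a \<Rightarrow> real \<Rightarrow> real" where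
  "grid_limit Y \<omega> r = lim (\<lambda>n. Y (real (nat \<lfloor>r * real (Suc n)\<rfloor>) / real (Suc n)) \<omega>)"

lemma floor_grid:
  assumes "0 \<le> r"
  shows "real (nat \<lfloor>r * real (Suc n)\<rfloor>) / real (Suc n) \<le> r" "0 \<le> real (nat \<lfloor>r * real (Suc n)\<rfloor>) / real (Suc n)"
    "r - 1 / real (Suc n) \<le> real (nat \<lfloor>r * real (Suc n)\<rfloor>) / real (Suc n)"
proof -
  have "real (nat \<lfloor>r * real (Suc n)\<rfloor>) = of_int \<lfloor>r * real (Suc n)\<rfloor>" using assms by simp
  then have b: "real (nat \<lfloor>r * real (Suc n)\<rfloor>) \<le> r * real (Suc n)" "r * real (Suc n) - 1 \<le> real (nat \<lfloor>r * real (Suc n)\<rfloor>)"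
    by linarith+
  show "real (nat \<lfloor>r * real (Suc n)\<rfloor>) / real (Suc n) \<le> r"
    using b(1) by (simp only: pos_divide_le_eq of_nat_0_less_iff zero_less_Suc)
  have "(r - 1 / real (Suc n)) * real (Suc n) \<le> real (nat \<lfloor>r * real (Suc n)\<rfloor>)"
    using b(2) by (simp add: left_diff_distrib del: of_nat_Suc)
  then show "r - 1 / real (Suc n) \<le> real (nat \<lfloor>r * real (Suc n)\<rfloor>) / real (Suc n)"
    by (simp only: pos_le_divide_eq of_nat_0_less_iff zero_less_Suc)
qed simp

lemma grid_limit_eq:
  assumes c: "continuous_on {0..T} (\<lambda>t. Y t \<omega>)" and r: "r \<in> {0..T}"
  shows "grid_limit Y \<omega> r = Y r \<omega>"
proof -
  have "(\<lambda>n. real (nat \<lfloor>r * real (Suc n)\<rfloor>) / real (Suc n)) \<longlonglongrightarrow> r"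
  proof (rule tendsto_sandwich[where f="\<lambda>n. r - 1 / real (Suc n)" and h="\<lambda>_. r"])
    show "(\<lambda>n. r - 1 / real (Suc n)) \<longlonglongrightarrow> r"
      using tendsto_diff[OF tendsto_const LIMSEQ_Suc[OF lim_const_over_n[of 1]], of r] by simp
  qed (use floor_grid[of r] r in auto)
  moreover have "real (nat \<lfloor>r * real (Suc n)\<rfloor>) / real (Suc n) \<in> {0..T}" for n
  proof -
    have "0 \<le> r" "r \<le> T" using r by auto
    then show ?thesis using floor_grid(2)[of r n] order_trans[OF floor_grid(1)[of r n], of T] by (simp only: atLeastAtMost_iff)
  qed
  ultimately have "(\<lambda>n. Y (real (nat \<lfloor>r * real (Suc n)\<rfloor>) / real (Suc n)) \<omega>) \<longlonglongrightarrow> Y r \<omega>"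
    by (intro continuous_on_tendsto_compose[OF c _ r] always_eventually allI)
  then show ?thesis unfolding grid_limit_def by (rule limI)
qed

lemma borel_measurable_grid_limit: "grid_limit Y \<omega> \<in> borel_measurable borel"
proof -
  have "(\<lambda>r. Y (real (nat \<lfloor>r * real (Suc n)\<rfloor>) / real (Suc n)) \<omega>) \<in> borel_measurable borel" for n
    by (rule measurable_compose[of "\<lambda>r. nat \<lfloor>r * real (Suc n)\<rfloor>" borel "count_space UNIV" "\<lambda>k. Y (real k / real (Suc n)) \<omega>" borel]) measurable
  then show ?thesis unfolding grid_limit_def[abs_def] by (intro borel_measurable_lim_metric)
qed

text \<open>
  For \<open>r \<le> t\<close> only values of \<open>Y\<close> at countably many times up to \<open>t\<close> enter. The times are cut off
  at \<open>t\<close> to make \<open>Z\<close> measurable for all \<open>r\<close>.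
\<close>
lemma grid_limit_progressive:
  assumes Y: "\<And>s. s \<in> {0..t} \<Longrightarrow> Y s \<in> borel_measurable N" and t: "0 \<le> t"
  obtains Z where "(\<lambda>(r, \<omega>). Z r \<omega>) \<in> borel_measurable (borel \<Otimes>\<^sub>M N)"
    "\<And>r \<omega>. r \<in> {0..t} \<Longrightarrow> Z r \<omega> = grid_limit Y \<omega> r"
proof
  let ?Z = "\<lambda>r \<omega>. lim (\<lambda>n. Y (min (real (nat \<lfloor>r * real (Suc n)\<rfloor>) / real (Suc n)) t) \<omega>)"
  show "?Z r \<omega> = grid_limit Y \<omega> r" if "r \<in> {0..t}" for r \<omega>
  proof -
    have "min (real (nat \<lfloor>r * real (Suc n)\<rfloor>) / real (Suc n)) t = real (nat \<lfloor>r * real (Suc n)\<rfloor>) / real (Suc n)" for n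
    proof (rule min_absorb1)
      have "0 \<le> r" "r \<le> t" using that by auto
      then show "real (nat \<lfloor>r * real (Suc n)\<rfloor>) / real (Suc n) \<le> t" by (rule order_trans[OF floor_grid(1)])
    qed
    then show ?thesis unfolding grid_limit_def by (simp only:)
  qed
  have "(\<lambda>p. Y (min (real (nat \<lfloor>fst p * real (Suc n)\<rfloor>) / real (Suc n)) t) (snd p)) \<in> borel_measurable (borel \<Otimes>\<^sub>M N)" for n
  proof (rule measurable_compose_countable[where f="\<lambda>k p. Y (min (real k / real (Suc n)) t) (snd p)" and g="\<lambda>p. nat \<lfloor>fst p * real (Suc n)\<rfloor>"])
    show "(\<lambda>p. Y (min (real k / real (Suc n)) t) (snd p)) \<in> borel_measurable (borel \<Otimes>\<^sub>M N)" for k :: nat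
      by (rule measurable_compose[OF measurable_snd Y]) (use t in auto)
  qed measurable
  then show "(\<lambda>(r, \<omega>). ?Z r \<omega>) \<in> borel_measurable (borel \<Otimes>\<^sub>M N)"
    unfolding case_prod_beta' by (intro borel_measurable_lim_metric)
qed

lemma integral_open_closed_interval:
  fixes g :: "real \<Rightarrow> real"
  assumes "integrable lborel (\<lambda>s. indicator {0..t} s * g s)"
  shows "(\<integral>s. indicator {0<..<t} s * g s \<partial>lborel) = (\<integral>s. indicator {0..t} s * g s \<partial>lborel)"
proof (rule integral_cong_AE)
  have 1: "(\<lambda>s. indicator {0..t} s * g s) \<in> borel_measurable lborel" using assms by (rule borel_measurable_integrable)
  then have "(\<lambda>s. indicator {0<..<t} s * (indicator {0..t} s * g s)) \<in> borel_measurable lborel" by measurable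
  also have "(\<lambda>s. indicator {0<..<t} s * (indicator {0..t} s * g s)) = (\<lambda>s. indicator {0<..<t} s * g s)"
    by (auto simp: indicator_def)
  finally show "(\<lambda>s. indicator {0<..<t} s * g s) \<in> borel_measurable lborel" .
  show "(\<lambda>s. indicator {0..t} s * g s) \<in> borel_measurable lborel" by (rule 1)
  have "AE s in lborel. s \<noteq> 0" "AE s in lborel. s \<noteq> t" by (rule AE_lborel_singleton)+
  then show "AE s in lborel. indicator {0<..<t} s * g s = indicator {0..t} s * g s"
    by eventually_elim (auto simp: indicator_def)
qed

context lipschitz_drift
begin

lemma solution_euler_limit:
  assumes T: "0 < T" and X: "sde_solution M F T b B x X"
  shows "AE \<omega> in M. (\<lambda>n. euler b (T / real n) x (\<lambda>i. B (real i * (T / real n)) \<omega>) n) \<longlonglongrightarrow> X T \<omega>"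
proof -
  have "AE \<omega> in M. continuous_on {0..T} (\<lambda>t. X t \<omega>)"
    "AE \<omega> in M. \<forall>t\<in>{0..T}. X t \<omega> = x + (LINT s:{0..t}|lborel. b s (X s \<omega>)) + B t \<omega>"
    using X by (auto simp: sde_solution_def continuous_paths_def)
  then show ?thesis
    by eventually_elim (rule euler_convergence[OF T], auto)
qed

text \<open>
  The path \<open>Z t = Y t + (1 - t / T) * (x - y)\<close> leads from \<open>x\<close> to \<open>Y T\<close> and solves the equation
  driven by \<open>B\<close> plus the primitive of \<open>u\<close>. The Euler scheme started at \<open>x\<close> therefore tends to \<open>X T\<close>
  when driven by \<open>B\<close> and to \<open>Y T\<close> when driven by \<open>B\<close> plus the primitive of \<open>u\<close>, and
  \<open>fractional_drift_entropy_bound\<close> compares the two.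
\<close>
lemma solution_entropy_bound:
  fixes W B X Y :: "real \<Rightarrow> 'a \<Rightarrow> real" and \<psi> :: "real \<Rightarrow> real" and c :: real
  assumes H: "0 < H" "H < 1/2" and T: "0 < T" and F: "filtered_prob_space M F T"
    and B: "fractional_brownian_motion M F T H W B"
    and X: "sde_solution M F T b B x X" and Y: "sde_solution M F T b B y Y"
    and \<psi>: "continuous_on UNIV \<psi>" "\<And>x. \<bar>\<psi> x\<bar> \<le> c"
  shows "(\<integral>\<omega>. \<psi> (Y T \<omega>) \<partial>M) \<le> ln (\<integral>\<omega>. exp (\<psi> (X T \<omega>)) \<partial>M)
       + ((K + 1 / T) * \<bar>x - y\<bar> * (Beta (3/2 - H) (1/2 - H) / Gamma (1/2 - H)))\<^sup>2 * (T powr (2 - 2 * H) / (2 - 2 * H)) / 2"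
proof -
  interpret prob_space M using F by (simp add: filtered_prob_space_def)
  define d where "d = x - y"
  define u where "u \<omega> r = b r (grid_limit Y \<omega> r) - b r (grid_limit Y \<omega> r + (1 - r / T) * d) - d / T" for \<omega> r
  have sub: "subalgebra M (F t)" if "t \<in> {0..T}" for t
    using F that by (simp add: filtered_prob_space_def)
  have Fmono: "sets (F s) \<subseteq> sets (F t)" if "0 \<le> s" "s \<le> t" "t \<le> T" for s t
    using F that by (simp add: filtered_prob_space_def)
  have Ym: "Y s \<in> borel_measurable (F t)" if "0 \<le> s" "s \<le> t" "t \<le> T" for s t
  proof -
    have "subalgebra (F t) (F s)"
      using sub[of s] sub[of t] Fmono[of s t] that by (auto simp: subalgebra_def)
    then show ?thesis
      using Y that by (intro measurable_from_subalg[of "F t" "F s"]) (auto simp: sde_solution_def adapted_def)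
  qed
  have XT: "X T \<in> borel_measurable M" "Y T \<in> borel_measurable M"
    using X Y T by (auto intro!: measurable_from_subalg[OF sub[of T]] simp: sde_solution_def adapted_def)
  have BmM: "B t \<in> borel_measurable M" if "t \<in> {0..T}" for t
    using B that by (auto simp: fractional_brownian_motion_def has_wiener_integral_def)
  have um: "u \<omega> \<in> borel_measurable borel" for \<omega>
  proof -
    note borel_measurable_grid_limit[of Y \<omega>, measurable]
    show ?thesis unfolding u_def[abs_def] by measurable
  qed
  have ub: "\<bar>u \<omega> r\<bar> \<le> (K + 1 / T) * \<bar>x - y\<bar>" if r: "0 \<le> r" "r \<le> T" for \<omega> r
  proof -
    have h: "0 \<le> 1 - r / T" "1 - r / T \<le> 1" using r T by auto
    have "\<bar>b r (grid_limit Y \<omega> r) - b r (grid_limit Y \<omega> r + (1 - r / T) * d)\<bar> \<le> K * \<bar>(1 - r / T) * d\<bar>"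
      using b_lipschitz[of r "grid_limit Y \<omega> r" "grid_limit Y \<omega> r + (1 - r / T) * d"] by (simp add: abs_minus_commute)
    also have "\<dots> \<le> K * \<bar>d\<bar>"
      using h K_pos by (intro mult_left_mono) (auto simp: abs_mult mult_left_le_one_le)
    finally have "\<bar>u \<omega> r\<bar> \<le> K * \<bar>d\<bar> + \<bar>d / T\<bar>" unfolding u_def by linarith
    also have "\<dots> = (K + 1 / T) * \<bar>x - y\<bar>" using T by (simp add: d_def algebra_simps)
    finally show ?thesis .
  qed
  have prog: "(\<lambda>(r, \<omega>). indicator {0..t} r * u \<omega> r) \<in> borel_measurable (borel \<Otimes>\<^sub>M F t)" if t: "t \<in> {0..T}" for t
  proof -
    obtain Z where Zm: "(\<lambda>(r, \<omega>). Z r \<omega>) \<in> borel_measurable (borel \<Otimes>\<^sub>M F t)"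
      and Z: "\<And>r \<omega>. r \<in> {0..t} \<Longrightarrow> Z r \<omega> = grid_limit Y \<omega> r"
      using grid_limit_progressive[of t Y "F t"] Ym t by auto
    have [measurable]: "(\<lambda>p. Z (fst p) (snd p)) \<in> borel_measurable (borel \<Otimes>\<^sub>M F t)"
      using Zm by (simp add: case_prod_beta')
    have "(\<lambda>p. indicator {0..t} (fst p) * (b (fst p) (Z (fst p) (snd p)) - b (fst p) (Z (fst p) (snd p) + (1 - fst p / T) * d) - d / T)) \<in> borel_measurable (borel \<Otimes>\<^sub>M F t)"
      by measurable
    also have "(\<lambda>p. indicator {0..t} (fst p) * (b (fst p) (Z (fst p) (snd p)) - b (fst p) (Z (fst p) (snd p) + (1 - fst p / T) * d) - d / T))
       = (\<lambda>(r, \<omega>). indicator {0..t} r * u \<omega> r)"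
      by (auto simp: u_def fun_eq_iff indicator_def Z)
    finally show ?thesis .
  qed
  have im: "(\<lambda>\<omega>. \<integral>r. indicator {0<..<t} r * u \<omega> r \<partial>lborel) \<in> borel_measurable M" if t: "t \<in> {0..T}" for t
  proof -
    from measurable_compose[OF measurable_pair_swap' prog[OF t]]
    have [measurable]: "(\<lambda>p. indicator {0..t} (snd p) * u (fst p) (snd p)) \<in> borel_measurable (F t \<Otimes>\<^sub>M borel)"
      by (simp add: case_prod_beta')
    have "(\<lambda>\<omega>. \<integral>r. indicator {0<..<t} r * (indicator {0..t} r * u \<omega> r) \<partial>lborel) \<in> borel_measurable (F t)"
      by (rule lborel.borel_measurable_lebesgue_integral) (simp add: case_prod_beta')
    also have "(\<lambda>\<omega>. \<integral>r. indicator {0<..<t} r * (indicator {0..t} r * u \<omega> r) \<partial>lborel) = (\<lambda>\<omega>. \<integral>r. indicator {0<..<t} r * u \<omega> r \<partial>lborel)"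
      by (intro ext Bochner_Integration.integral_cong) (auto simp: indicator_def)
    finally show ?thesis using measurable_from_subalg[OF sub[OF t]] by blast
  qed
  have tau: "real j * (T / real (Suc n)) \<in> {0..T}" if "j \<le> Suc n" for j n
  proof -
    have "real j * (T / real (Suc n)) \<le> real (Suc n) * (T / real (Suc n))"
      using that T by (intro mult_right_mono) auto
    then show ?thesis using T by simp
  qed
  have d0: "0 \<le> T / real (Suc n)" for n using T by simp
  have lim: "AE \<omega> in M. (\<lambda>n. euler b (T / real n) x (\<lambda>i. B (real i * (T / real n)) \<omega> +
        (\<integral>r. indicator {0<..<real i * (T / real n)} r * u \<omega> r \<partial>lborel)) n) \<longlonglongrightarrow> Y T \<omega>"
  proof -
    have "AE \<omega> in M. continuous_on {0..T} (\<lambda>t. Y t \<omega>)"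
      "AE \<omega> in M. \<forall>t\<in>{0..T}. Y t \<omega> = y + (LINT s:{0..t}|lborel. b s (Y s \<omega>)) + B t \<omega>"
      using Y by (auto simp: sde_solution_def continuous_paths_def)
    then show ?thesis
    proof eventually_elim
      fix \<omega> assume c: "continuous_on {0..T} (\<lambda>t. Y t \<omega>)"
        and sol: "\<forall>t\<in>{0..T}. Y t \<omega> = y + (LINT s:{0..t}|lborel. b s (Y s \<omega>)) + B t \<omega>"
      define Z where "Z t = Y t \<omega> + (1 - t / T) * d" for t
      have Zc: "continuous_on {0..T} Z" unfolding Z_def using T by (intro continuous_intros c) auto
      have "Z t = x + (LINT s:{0..t}|lborel. b s (Z s)) + (B t \<omega> + (\<integral>r. indicator {0<..<t} r * u \<omega> r \<partial>lborel))" if t: "t \<in> {0..T}" for t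
      proof -
        have iY: "integrable lborel (\<lambda>s. indicator {0..t} s * b s (Y s \<omega>))" "integrable lborel (\<lambda>s. indicator {0..t} s * b s (Z s))"
          using integrable_drift_path[OF c, of "{0..t}"] integrable_drift_path[OF Zc, of "{0..t}"] t by auto
        have eu: "indicator {0..t} r * u \<omega> r = indicator {0..t} r * b r (Y r \<omega>) - indicator {0..t} r * b r (Z r) - indicator {0..t} r * (d / T)" for r
          using grid_limit_eq[where Y=Y and \<omega>=\<omega>, OF c, of r] t by (auto simp: u_def Z_def indicator_def)
        have iu: "integrable lborel (\<lambda>r. indicator {0..t} r * u \<omega> r)"
          unfolding eu using iY t by (intro Bochner_Integration.integrable_diff) auto
        have "(\<integral>r. indicator {0<..<t} r * u \<omega> r \<partial>lborel) = (\<integral>r. indicator {0..t} r * u \<omega> r \<partial>lborel)"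
          by (rule integral_open_closed_interval[OF iu])
        also have "\<dots> = (\<integral>s. indicator {0..t} s * b s (Y s \<omega>) \<partial>lborel) - (\<integral>s. indicator {0..t} s * b s (Z s) \<partial>lborel) - t * (d / T)"
          unfolding eu using iY t by simp
        finally have "(\<integral>r. indicator {0<..<t} r * u \<omega> r \<partial>lborel) = (LINT s:{0..t}|lborel. b s (Y s \<omega>)) - (LINT s:{0..t}|lborel. b s (Z s)) - t * (d / T)"
          by (simp add: set_lebesgue_integral_def)
        then show ?thesis using bspec[OF sol t] by (simp add: Z_def d_def algebra_simps)
      qed
      from euler_convergence[OF T Zc this]
      show "(\<lambda>n. euler b (T / real n) x (\<lambda>i. B (real i * (T / real n)) \<omega> +
        (\<integral>r. indicator {0<..<real i * (T / real n)} r * u \<omega> r \<partial>lborel)) n) \<longlonglongrightarrow> Y T \<omega>"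
        using T by (simp add: Z_def)
    qed
  qed
  show ?thesis
  proof (rule entropy_bound_limit[where V="X T" and V'="Y T" and \<psi>=\<psi> and c=c
        and U="\<lambda>n \<omega>. euler b (T / real (Suc n)) x (\<lambda>i. B (real i * (T / real (Suc n))) \<omega>) (Suc n)"
        and U'="\<lambda>n \<omega>. euler b (T / real (Suc n)) x (\<lambda>i. B (real i * (T / real (Suc n))) \<omega> +
          (\<integral>r. indicator {0<..<real i * (T / real (Suc n))} r * u \<omega> r \<partial>lborel)) (Suc n)"])
    show "(\<lambda>\<omega>. euler b (T / real (Suc n)) x (\<lambda>i. B (real i * (T / real (Suc n))) \<omega>) (Suc n)) \<in> borel_measurable M" for n
      by (intro borel_measurable_euler[OF d0] BmM tau borel_measurable_const)
    show "(\<lambda>\<omega>. euler b (T / real (Suc n)) x (\<lambda>i. B (real i * (T / real (Suc n))) \<omega> +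
          (\<integral>r. indicator {0<..<real i * (T / real (Suc n))} r * u \<omega> r \<partial>lborel)) (Suc n)) \<in> borel_measurable M" for n
      by (intro borel_measurable_euler[OF d0] borel_measurable_add BmM im tau borel_measurable_const)
    show "AE \<omega> in M. (\<lambda>n. euler b (T / real (Suc n)) x (\<lambda>i. B (real i * (T / real (Suc n))) \<omega>) (Suc n)) \<longlonglongrightarrow> X T \<omega>"
      using solution_euler_limit[OF T X] by (rule eventually_mono) (rule LIMSEQ_Suc)
    show "AE \<omega> in M. (\<lambda>n. euler b (T / real (Suc n)) x (\<lambda>i. B (real i * (T / real (Suc n))) \<omega> +
          (\<integral>r. indicator {0<..<real i * (T / real (Suc n))} r * u \<omega> r \<partial>lborel)) (Suc n)) \<longlonglongrightarrow> Y T \<omega>"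
      using lim by (rule eventually_mono) (rule LIMSEQ_Suc)
    show "expectation (\<lambda>\<omega>. \<psi> (euler b (T / real (Suc n)) x (\<lambda>i. B (real i * (T / real (Suc n))) \<omega> +
          (\<integral>r. indicator {0<..<real i * (T / real (Suc n))} r * u \<omega> r \<partial>lborel)) (Suc n)))
      \<le> ln (expectation (\<lambda>\<omega>. exp (\<psi> (euler b (T / real (Suc n)) x (\<lambda>i. B (real i * (T / real (Suc n))) \<omega>) (Suc n)))))
       + ((K + 1 / T) * \<bar>x - y\<bar> * (Beta (3/2 - H) (1/2 - H) / Gamma (1/2 - H)))\<^sup>2 * (T powr (2 - 2 * H) / (2 - 2 * H)) / 2" for n
      by (rule fractional_drift_entropy_bound[OF H T F B um ub prog tau d0 \<psi>])
  qed (use XT \<psi> in auto)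
qed

end

text \<open>
  With \<open>a = K * T\<close> this amounts to \<open>tanh a \<le> a\<close>, in the form \<open>(1 - a) * exp (2 * a) \<le> 1 + a\<close>.
  The difference of the two sides, times \<open>exp (- a)\<close>, vanishes at 0 and is increasing in \<open>a\<close>.
\<close>
lemma drift_constant_bound:
  fixes K T :: real
  assumes "0 < K" "0 < T"
  shows "K + 1 / T \<le> 2 * K / (1 - exp (- 2 * K * T))"
proof -
  define a where "a = K * T"
  have a: "0 < a" using assms by (simp add: a_def)
  have "(1 - a) * exp (2 * a) \<le> 1 + a"
  proof -
    define g where "g x = (1 + x) * exp (- x) - (1 - x) * exp x" for x :: real
    have "g 0 \<le> g a"
    proof (rule DERIV_nonneg_imp_nondecreasing[of 0 a])
      fix x :: real assume x: "0 \<le> x" "x \<le> a"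
      have "(g has_real_derivative x * (exp x - exp (- x))) (at x)"
        unfolding g_def[abs_def] by (auto intro!: derivative_eq_intros simp: algebra_simps)
      moreover have "0 \<le> x * (exp x - exp (- x))" using x by simp
      ultimately show "\<exists>y. (g has_real_derivative y) (at x) \<and> 0 \<le> y" by blast
    qed (use a in simp)
    then have "0 \<le> g a" by (simp add: g_def)
    then have "0 \<le> g a * exp a" by simp
    also have "g a * exp a = 1 + a - (1 - a) * exp (2 * a)"
      unfolding g_def by (simp add: left_diff_distrib mult.assoc exp_add[symmetric])
    finally show ?thesis by simp
  qed
  then have "(1 - a) * exp (2 * a) * exp (- (2 * a)) \<le> (1 + a) * exp (- (2 * a))"
    by (intro mult_right_mono) auto
  then have "1 - a \<le> (1 + a) * exp (- (2 * a))"
    by (simp add: mult.assoc exp_add[symmetric])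
  then have key: "(a + 1) * (1 - exp (- (2 * a))) \<le> 2 * a" by (simp add: algebra_simps)
  have e: "exp (- (2 * a)) < 1" using a by simp
  have "K + 1 / T = (a + 1) / T" using assms by (simp add: a_def field_simps)
  also have "\<dots> \<le> (2 * a / (1 - exp (- (2 * a)))) / T"
    using key e assms by (intro divide_right_mono) (auto simp: pos_le_divide_eq)
  also have "\<dots> = 2 * K / (1 - exp (- 2 * K * T))" using assms by (simp add: a_def mult.assoc)
  finally show ?thesis .
qed

section \<open>From continuous to Borel test functions\<close>

lemma bounded_range_real_iff: "bounded (range f) \<longleftrightarrow> (\<exists>c. \<forall>x. \<bar>f x\<bar> \<le> c)" for f :: "'b \<Rightarrow> real"
  unfolding bounded_iff by auto

text \<open>
  Approximation in several \<open>L\<^sup>1\<close> spaces at once, because \<open>entropy_bound_borel\<close> involves two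
  measures.
\<close>
definition cont_approximable :: "real measure set \<Rightarrow> (real \<Rightarrow> real) \<Rightarrow> bool" where
  "cont_approximable \<M> f \<longleftrightarrow> f \<in> borel_measurable borel \<and> bounded (range f) \<and>
     (\<forall>e>0. \<exists>\<phi>. continuous_on UNIV \<phi> \<and> bounded (range \<phi>) \<and> (\<forall>m\<in>\<M>. (\<integral>x. \<bar>\<phi> x - f x\<bar> \<partial>m) < e))"

context
  fixes \<M> :: "real measure set"
  assumes fin: "finite \<M>" and prob: "\<And>m. m \<in> \<M> \<Longrightarrow> prob_space m" and sets: "\<And>m. m \<in> \<M> \<Longrightarrow> sets m = sets borel"
begin

lemma integrable_bounded_borel:
  assumes "m \<in> \<M>" "f \<in> borel_measurable borel" "bounded (range f)"
  shows "integrable m (f :: real \<Rightarrow> real)"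
proof -
  interpret prob_space m by (rule prob) fact
  obtain c where "\<And>x. \<bar>f x\<bar> \<le> c" using assms(3) by (auto simp: bounded_range_real_iff)
  then show ?thesis
    using assms(2) sets[OF assms(1)] by (intro integrable_const_bound[where B=c]) (auto cong: measurable_cong_sets)
qed

lemma cont_approximable_limit:
  assumes f: "\<And>n. cont_approximable \<M> (f n)" and lim: "\<And>x. (\<lambda>n. f n x) \<longlonglongrightarrow> g x" and bd: "\<And>n x. \<bar>f n x\<bar> \<le> c"
  shows "cont_approximable \<M> g"
proof -
  have fm[measurable]: "f n \<in> borel_measurable borel" for n using f by (simp add: cont_approximable_def)
  have gm[measurable]: "g \<in> borel_measurable borel" by (rule borel_measurable_LIMSEQ_real[OF lim fm])
  have gb: "\<bar>g x\<bar> \<le> c" for x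
    by (rule LIMSEQ_le_const2[OF tendsto_rabs[OF lim]]) (use bd in auto)
  then have gbd: "bounded (range g)" by (auto simp: bounded_range_real_iff)
  have "\<exists>\<phi>. continuous_on UNIV \<phi> \<and> bounded (range \<phi>) \<and> (\<forall>m\<in>\<M>. (\<integral>x. \<bar>\<phi> x - g x\<bar> \<partial>m) < e)" if e: "e > 0" for e
  proof -
    have "eventually (\<lambda>n. (\<integral>x. \<bar>f n x - g x\<bar> \<partial>m) < e / 2) sequentially" if m: "m \<in> \<M>" for m
    proof -
      interpret prob_space m by (rule prob) fact
      note [measurable_cong] = sets[OF m]
      have "(\<lambda>n. \<integral>x. \<bar>f n x - g x\<bar> \<partial>m) \<longlonglongrightarrow> (\<integral>x. 0 \<partial>m)"
      proof (rule integral_dominated_convergence[where w="\<lambda>_. 2 * c"])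
        show "AE x in m. (\<lambda>n. \<bar>f n x - g x\<bar>) \<longlonglongrightarrow> 0"
          using tendsto_rabs_zero[OF LIM_zero[OF lim]] by auto
        show "AE x in m. norm \<bar>f n x - g x\<bar> \<le> 2 * c" for n
        proof (rule AE_I2)
          fix x show "norm \<bar>f n x - g x\<bar> \<le> 2 * c" using bd[of n x] gb[of x] by simp
        qed
      qed auto
      then show ?thesis using e by (auto dest: order_tendstoD(2)[where a="e/2"])
    qed
    then have "eventually (\<lambda>n. \<forall>m\<in>\<M>. (\<integral>x. \<bar>f n x - g x\<bar> \<partial>m) < e / 2) sequentially"
      using fin by (simp add: eventually_ball_finite)
    then obtain n where n: "\<forall>m\<in>\<M>. (\<integral>x. \<bar>f n x - g x\<bar> \<partial>m) < e / 2"
      by (auto simp: eventually_sequentially)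
    obtain \<phi> where \<phi>: "continuous_on UNIV \<phi>" "bounded (range \<phi>)" "\<forall>m\<in>\<M>. (\<integral>x. \<bar>\<phi> x - f n x\<bar> \<partial>m) < e / 2"
    proof -
      have "\<forall>e>0. \<exists>\<phi>. continuous_on UNIV \<phi> \<and> bounded (range \<phi>) \<and> (\<forall>m\<in>\<M>. (\<integral>x. \<bar>\<phi> x - f n x\<bar> \<partial>m) < e)"
        using f[of n] by (simp add: cont_approximable_def)
      then show thesis using half_gt_zero[OF e] that by blast
    qed
    have [measurable]: "\<phi> \<in> borel_measurable borel" using \<phi>(1) by (rule borel_measurable_continuous_onI)
    have "(\<integral>x. \<bar>\<phi> x - g x\<bar> \<partial>m) < e" if m: "m \<in> \<M>" for m
    proof -
      have fb: "bounded (range (f n))" using f by (simp add: cont_approximable_def)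
      have i: "integrable m \<phi>" "integrable m (f n)" "integrable m g"
        using \<phi>(2) fb gbd by (auto intro!: integrable_bounded_borel[OF m])
      have "(\<integral>x. \<bar>\<phi> x - g x\<bar> \<partial>m) \<le> (\<integral>x. \<bar>\<phi> x - f n x\<bar> + \<bar>f n x - g x\<bar> \<partial>m)"
        using i by (intro integral_mono) auto
      also have "\<dots> = (\<integral>x. \<bar>\<phi> x - f n x\<bar> \<partial>m) + (\<integral>x. \<bar>f n x - g x\<bar> \<partial>m)"
        using i by (intro Bochner_Integration.integral_add) auto
      also have "\<dots> < e" using bspec[OF n m] bspec[OF \<phi>(3) m] by linarith
      finally show ?thesis .
    qed
    with \<phi> show ?thesis by blast
  qed
  then show ?thesis using gbd by (simp add: cont_approximable_def)
qed

lemma cont_approximable_lincomb: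
  assumes f: "cont_approximable \<M> f" and g: "cont_approximable \<M> g"
  shows "cont_approximable \<M> (\<lambda>x. a * f x + b * g x)"
proof -
  have [measurable]: "f \<in> borel_measurable borel" "g \<in> borel_measurable borel" and fb: "bounded (range f)" "bounded (range g)"
    using f g by (auto simp: cont_approximable_def)
  have lb: "bounded (range (\<lambda>x. a * h x + b * k x))" if hb: "bounded (range h)" and kb: "bounded (range k)" for h k :: "real \<Rightarrow> real"
  proof -
    obtain c where "\<And>x. \<bar>h x\<bar> \<le> c" using hb unfolding bounded_range_real_iff by blast
    moreover obtain c' where "\<And>x. \<bar>k x\<bar> \<le> c'" using kb unfolding bounded_range_real_iff by blast
    ultimately have "\<bar>a * h x + b * k x\<bar> \<le> \<bar>a\<bar> * c + \<bar>b\<bar> * c'" for x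
      by (intro order_trans[OF abs_triangle_ineq] add_mono) (auto simp: abs_mult intro: mult_left_mono)
    then show ?thesis by (auto simp: bounded_range_real_iff)
  qed
  have "\<exists>\<phi>. continuous_on UNIV \<phi> \<and> bounded (range \<phi>) \<and> (\<forall>m\<in>\<M>. (\<integral>x. \<bar>\<phi> x - (a * f x + b * g x)\<bar> \<partial>m) < e)" if e: "e > 0" for e
  proof -
    define \<eta> where "\<eta> = e / (\<bar>a\<bar> + \<bar>b\<bar> + 1)"
    have \<eta>: "\<eta> > 0" using e by (simp add: \<eta>_def)
    obtain \<phi> where \<phi>: "continuous_on UNIV \<phi>" "bounded (range \<phi>)" "\<forall>m\<in>\<M>. (\<integral>x. \<bar>\<phi> x - f x\<bar> \<partial>m) < \<eta>"
      using f \<eta> unfolding cont_approximable_def by blast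
    obtain \<gamma> where \<gamma>: "continuous_on UNIV \<gamma>" "bounded (range \<gamma>)" "\<forall>m\<in>\<M>. (\<integral>x. \<bar>\<gamma> x - g x\<bar> \<partial>m) < \<eta>"
      using g \<eta> unfolding cont_approximable_def by blast
    have [measurable]: "\<phi> \<in> borel_measurable borel" "\<gamma> \<in> borel_measurable borel" using \<phi>(1) \<gamma>(1) by (auto intro: borel_measurable_continuous_onI)
    have "(\<integral>x. \<bar>(a * \<phi> x + b * \<gamma> x) - (a * f x + b * g x)\<bar> \<partial>m) < e" if m: "m \<in> \<M>" for m
    proof -
      have i: "integrable m \<phi>" "integrable m \<gamma>" "integrable m f" "integrable m g"
        using \<phi>(2) \<gamma>(2) fb by (auto intro!: integrable_bounded_borel[OF m])
      have "(\<integral>x. \<bar>(a * \<phi> x + b * \<gamma> x) - (a * f x + b * g x)\<bar> \<partial>m) \<le> (\<integral>x. \<bar>a\<bar> * \<bar>\<phi> x - f x\<bar> + \<bar>b\<bar> * \<bar>\<gamma> x - g x\<bar> \<partial>m)"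
      proof (rule integral_mono)
        fix x
        have "(a * \<phi> x + b * \<gamma> x) - (a * f x + b * g x) = a * (\<phi> x - f x) + b * (\<gamma> x - g x)" by (simp add: algebra_simps)
        then show "\<bar>(a * \<phi> x + b * \<gamma> x) - (a * f x + b * g x)\<bar> \<le> \<bar>a\<bar> * \<bar>\<phi> x - f x\<bar> + \<bar>b\<bar> * \<bar>\<gamma> x - g x\<bar>"
          using abs_triangle_ineq[of "a * (\<phi> x - f x)" "b * (\<gamma> x - g x)"] by (simp add: abs_mult)
      qed (use i in auto)
      also have "\<dots> = \<bar>a\<bar> * (\<integral>x. \<bar>\<phi> x - f x\<bar> \<partial>m) + \<bar>b\<bar> * (\<integral>x. \<bar>\<gamma> x - g x\<bar> \<partial>m)"
        using i by simp
      also have "\<dots> \<le> \<bar>a\<bar> * \<eta> + \<bar>b\<bar> * \<eta>"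
        using bspec[OF \<phi>(3) m] bspec[OF \<gamma>(3) m] by (intro add_mono mult_left_mono) auto
      also have "\<dots> < (\<bar>a\<bar> + \<bar>b\<bar> + 1) * \<eta>" using \<eta> by (simp add: algebra_simps)
      also have "\<dots> = e" unfolding \<eta>_def by simp
      finally show ?thesis .
    qed
    then show ?thesis using \<phi> \<gamma> lb by (intro exI[of _ "\<lambda>x. a * \<phi> x + b * \<gamma> x"]) (auto intro!: continuous_intros)
  qed
  then show ?thesis using lb[OF fb] by (simp add: cont_approximable_def)
qed

lemma cont_approximable_continuous:
  assumes "continuous_on UNIV f" "bounded (range f)"
  shows "cont_approximable \<M> f"
  unfolding cont_approximable_def using assms by (auto intro!: borel_measurable_continuous_onI exI[of _ f])

text \<open>
  The indicator of a half-line is a limit of continuous ramps, and the half-lines are a generator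
  of the Borel sets that is stable under intersection, so Dynkin's lemma applies.
\<close>
lemma cont_approximable_indicator:
  assumes "A \<in> sets borel"
  shows "cont_approximable \<M> (indicator A)"
proof -
  have A: "A \<in> sigma_sets UNIV (range atMost)" using assms by (simp add: borel_eq_atMost)
  have st: "Int_stable (range (atMost :: real \<Rightarrow> _))"
    by (auto simp: Int_stable_def)
  have "range (atMost :: real \<Rightarrow> _) \<subseteq> Pow UNIV" by simp
  from st this A show ?thesis
  proof (induction rule: sigma_sets_induct_disjoint)
    case (basic A)
    then obtain a where A: "A = {..a}" by auto
    show ?case
    proof (rule cont_approximable_limit[where f="\<lambda>n x. max 0 (min 1 (1 + real n * (a - x)))" and c=1])
      show "cont_approximable \<M> (\<lambda>x. max 0 (min 1 (1 + real n * (a - x))))" for n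
        by (rule cont_approximable_continuous) (auto intro!: continuous_intros simp: bounded_range_real_iff intro!: exI[of _ 1])
      show "(\<lambda>n. max 0 (min 1 (1 + real n * (a - x)))) \<longlonglongrightarrow> indicator A x" for x
      proof (cases "x \<le> a")
        case True
        then have "max 0 (min 1 (1 + real n * (a - x))) = 1" for n by (auto simp: min_def max_def)
        then show ?thesis using True by (simp add: A)
      next
        case False
        then obtain N where N: "1 / (x - a) < real N" using reals_Archimedean2 by blast
        have "eventually (\<lambda>n. max 0 (min 1 (1 + real n * (a - x))) = 0) sequentially"
        proof (rule eventually_sequentiallyI[of N])
          fix n assume "N \<le> n"
          then have "1 / (x - a) < real n" using N by linarith
          then have "1 < real n * (x - a)" using False by (simp add: field_simps)
          then show "max 0 (min 1 (1 + real n * (a - x))) = 0" by (simp add: algebra_simps)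
        qed
        then show ?thesis using False by (simp add: A tendsto_eventually)
      qed
    qed auto
  next
    case empty
    show ?case by (rule cont_approximable_continuous) auto
  next
    case (compl A)
    have "cont_approximable \<M> (\<lambda>x. 1 * 1 + (-1) * indicator A x)"
      by (rule cont_approximable_lincomb[OF cont_approximable_continuous compl(2)]) auto
    moreover have "(\<lambda>x. 1 * 1 + (-1) * indicator A x) = (indicator (UNIV - A) :: real \<Rightarrow> real)"
      by (auto simp: indicator_def fun_eq_iff)
    ultimately show ?case by simp
  next
    case (union A)
    show ?case
    proof (rule cont_approximable_limit[where f="\<lambda>n x. \<Sum>i<n. indicator (A i) x" and c=1])
      show "cont_approximable \<M> (\<lambda>x. \<Sum>i<n. indicator (A i) x)" for n
      proof (induction n)
        case 0
        show ?case by (simp, rule cont_approximable_continuous) auto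
      next
        case (Suc n)
        from cont_approximable_lincomb[OF Suc union(3)[of n], of 1 1] show ?case by simp
      qed
      have e: "(\<Sum>i<n. indicator (A i) x) = (indicator (\<Union>i<n. A i) x :: real)" for n x
        using union(1) by (subst indicator_UN_disjoint) (auto simp: disjoint_family_on_def)
      show "\<bar>\<Sum>i<n. indicator (A i) x\<bar> \<le> (1::real)" for n x
        unfolding e by (simp add: indicator_def)
      show "(\<lambda>n. \<Sum>i<n. indicator (A i) x :: real) \<longlonglongrightarrow> indicator (\<Union>i. A i) x" for x
      proof -
        have "(\<lambda>n. indicator (\<Union>i<n. A i) x :: real) \<longlonglongrightarrow> indicator (\<Union>i. A i) x"
          by (rule LIMSEQ_indicator_UN)
        then show ?thesis by (simp only: e)
      qed
    qed
  qed
qed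

text \<open>
  Boundedness is a premise of the claim proved by induction: it passes from \<open>f\<close> to the nonnegative
  functions below \<open>f\<close> from which \<open>f\<close> is built.
\<close>
lemma cont_approximable_borel_nonneg:
  assumes "f \<in> borel_measurable borel" "\<And>x. 0 \<le> f x" 
  shows "(\<exists>c. \<forall>x. f x \<le> c) \<longrightarrow> cont_approximable \<M> f"
  using assms
proof (induction f rule: borel_measurable_induct_real)
  case (set A)
  then show ?case using cont_approximable_indicator by blast
next
  case (mult u c)
  show ?case
  proof (cases "c = 0")
    case True
    then show ?thesis by (auto intro!: cont_approximable_continuous)
  next
    case False
    with mult have c: "c > 0" by simp
    show ?thesis
    proof (intro impI)
      assume "\<exists>C. \<forall>x. c * u x \<le> C"
      then obtain C where "\<And>x. c * u x \<le> C" by auto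
      then have "\<And>x. u x \<le> C / c" using c by (simp add: field_simps)
      then have "cont_approximable \<M> u" using mult by blast
      from cont_approximable_lincomb[OF this this, of c 0] show "cont_approximable \<M> (\<lambda>x. c * u x)" by simp
    qed
  qed
next
  case (add u v)
  show ?case
  proof (intro impI)
    assume "\<exists>C. \<forall>x. v x + u x \<le> C"
    then obtain C where C: "\<And>x. v x + u x \<le> C" by auto
    have "0 \<le> u x" "0 \<le> v x" for x using add by auto
    then have "v x \<le> C" "u x \<le> C" for x using C[of x] by (smt (verit))+
    then have "cont_approximable \<M> u" "cont_approximable \<M> v" using add by blast+
    from cont_approximable_lincomb[OF this(2,1), of 1 1] show "cont_approximable \<M> (\<lambda>x. v x + u x)" by simp
  qed
next
  case (seq U)
  show ?case
  proof (intro impI)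
    assume "\<exists>C. \<forall>x. f x \<le> C"
    then obtain C where C: "\<And>x. f x \<le> C" by auto
    have "U i x \<le> f x" for i x
      by (rule incseq_le[of "\<lambda>i. U i x"]) (use seq in \<open>auto simp: incseq_def le_fun_def\<close>)
    then have UC: "U i x \<le> C" for i x using C[of x] order_trans by blast
    then have "cont_approximable \<M> (U i)" for i using seq UC by blast
    then show "cont_approximable \<M> f"
      by (rule cont_approximable_limit[where f=U and c=C]) (use seq UC in auto)
  qed
qed

lemma cont_approximable_borel:
  assumes "f \<in> borel_measurable borel" "\<And>x. \<bar>f x\<bar> \<le> c"
  shows "cont_approximable \<M> f"
proof -
  have b: "- c \<le> f x" "f x \<le> c" for x using assms(2)[of x] by auto
  have "cont_approximable \<M> (\<lambda>x. f x + c)"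
  proof (rule cont_approximable_borel_nonneg[THEN mp])
    show "0 \<le> f x + c" for x using b(1)[of x] by simp
    show "\<exists>C. \<forall>x. f x + c \<le> C" by (intro exI[of _ "c + c"] allI add_right_mono b(2))
  qed (use assms(1) in simp)
  from cont_approximable_lincomb[OF this cont_approximable_continuous, of "\<lambda>_. 1" 1 "- c"] show ?thesis by simp
qed

end

lemma exp_diff_le: "\<bar>x\<bar> \<le> c \<Longrightarrow> \<bar>y\<bar> \<le> c \<Longrightarrow> \<bar>exp x - exp y\<bar> \<le> exp c * \<bar>x - y\<bar>" for x y c :: real
proof (induction x y rule: linorder_wlog)
  case (le x y)
  have "exp y * (1 + (x - y)) \<le> exp y * exp (x - y)" by (intro mult_left_mono exp_ge_add_one_self) auto
  then have "exp y - exp x \<le> exp y * (y - x)" by (simp add: exp_diff algebra_simps)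
  also have "\<dots> \<le> exp c * (y - x)" using le by (intro mult_right_mono) auto
  finally show ?case using le by simp
qed (simp add: abs_minus_commute)

text \<open>
  Continuous functions that approximate \<open>\<psi>\<close> in \<open>L\<^sup>1\<close> of \<open>p\<close> and of \<open>q\<close> may be truncated to
  \<open>[-c, c]\<close>, where the exponential function is Lipschitz.
\<close>
lemma entropy_bound_borel:
  fixes p q :: "real measure" and \<psi> :: "real \<Rightarrow> real" and c C :: real
  assumes p: "prob_space p" "sets p = sets borel" and q: "prob_space q" "sets q = sets borel"
    and bound: "\<And>\<psi> c. continuous_on UNIV \<psi> \<Longrightarrow> (\<And>x. \<bar>\<psi> x\<bar> \<le> c) \<Longrightarrow> (\<integral>x. \<psi> x \<partial>q) \<le> ln (\<integral>x. exp (\<psi> x) \<partial>p) + C"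
    and \<psi>[measurable]: "\<psi> \<in> borel_measurable borel" and c: "\<And>x. \<bar>\<psi> x\<bar> \<le> c"
  shows "(\<integral>x. \<psi> x \<partial>q) \<le> ln (\<integral>x. exp (\<psi> x) \<partial>p) + C"
proof -
  interpret p: prob_space p by fact
  interpret q: prob_space q by fact
  note [measurable_cong] = p(2) q(2)
  have "cont_approximable {p, q} \<psi>"
    by (rule cont_approximable_borel[OF _ _ _ \<psi> c]) (use p q in auto)
  then have "\<forall>n. \<exists>\<phi>. continuous_on UNIV \<phi> \<and> bounded (range \<phi>) \<and> (\<forall>m\<in>{p, q}. (\<integral>x. \<bar>\<phi> x - \<psi> x\<bar> \<partial>m) < 1 / real (Suc n))"
    unfolding cont_approximable_def by (metis of_nat_0_less_iff zero_less_Suc zero_less_divide_1_iff)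
  then obtain \<phi>0 where \<phi>0: "\<And>n. continuous_on UNIV (\<phi>0 n)" "\<And>n. bounded (range (\<phi>0 n))"
    "\<And>n. (\<integral>x. \<bar>\<phi>0 n x - \<psi> x\<bar> \<partial>p) < 1 / real (Suc n)" "\<And>n. (\<integral>x. \<bar>\<phi>0 n x - \<psi> x\<bar> \<partial>q) < 1 / real (Suc n)"
    by (auto dest!: choice)
  define \<phi> where "\<phi> n x = max (- c) (min c (\<phi>0 n x))" for n x
  have c0: "0 \<le> c" using c[of 0] by simp
  have \<phi>c: "continuous_on UNIV (\<phi> n)" for n unfolding \<phi>_def by (intro continuous_intros \<phi>0)
  have \<phi>b: "\<bar>\<phi> n x\<bar> \<le> c" for n x using c0 by (auto simp: \<phi>_def)
  have [measurable]: "\<phi> n \<in> borel_measurable borel" "\<phi>0 n \<in> borel_measurable borel" for n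
    using \<phi>c \<phi>0(1) by (auto intro: borel_measurable_continuous_onI)
  have closer: "\<bar>\<phi> n x - \<psi> x\<bar> \<le> \<bar>\<phi>0 n x - \<psi> x\<bar>" for n x
    using c[of x] by (auto simp: \<phi>_def)
  have \<phi>close: "(\<integral>x. \<bar>\<phi> n x - \<psi> x\<bar> \<partial>m) \<le> 1 / real (Suc n)" if m: "m = p \<or> m = q" for m n
  proof -
    interpret m: prob_space m using m p q by auto
    have [measurable_cong]: "sets m = sets borel" using m p q by auto
    obtain B where B: "\<And>x. \<bar>\<phi>0 n x\<bar> \<le> B" using \<phi>0(2)[of n] by (auto simp: bounded_range_real_iff)
    have i: "integrable m (\<phi>0 n)" "integrable m (\<phi> n)" "integrable m \<psi>"
      using B \<phi>b c by (auto intro!: m.integrable_const_bound AE_I2)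
    have "(\<integral>x. \<bar>\<phi> n x - \<psi> x\<bar> \<partial>m) \<le> (\<integral>x. \<bar>\<phi>0 n x - \<psi> x\<bar> \<partial>m)"
      using i closer by (intro integral_mono) auto
    also have "\<dots> \<le> 1 / real (Suc n)" using m \<phi>0(3,4)[of n] by auto
    finally show ?thesis .
  qed
  have l0: "(\<lambda>n. k * (1 / real (Suc n))) \<longlonglongrightarrow> 0" for k
    using tendsto_mult_right_zero[OF LIMSEQ_Suc[OF lim_const_over_n[of 1]]] by simp
  have iq: "integrable q (\<phi> n)" "integrable q \<psi>" for n
    using \<phi>b c by (auto intro!: q.integrable_const_bound[where B=c])
  have ip: "integrable p (\<phi> n)" "integrable p \<psi>" for n
    using \<phi>b c by (auto intro!: p.integrable_const_bound[where B=c])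
  have ep: "integrable p (\<lambda>x. exp (\<phi> n x))" "integrable p (\<lambda>x. exp (\<psi> x))" for n
    using \<phi>b c by (auto intro!: p.integrable_const_bound[where B="exp c"] simp: abs_le_iff)
  have 1: "(\<lambda>n. \<integral>x. \<phi> n x \<partial>q) \<longlonglongrightarrow> (\<integral>x. \<psi> x \<partial>q)"
  proof (rule LIM_zero_cancel, rule Lim_null_comparison[OF always_eventually l0[of 1]], rule allI)
    fix n
    have "norm ((\<integral>x. \<phi> n x \<partial>q) - (\<integral>x. \<psi> x \<partial>q)) = \<bar>\<integral>x. \<phi> n x - \<psi> x \<partial>q\<bar>" using iq by simp
    also have "\<dots> \<le> (\<integral>x. \<bar>\<phi> n x - \<psi> x\<bar> \<partial>q)" by (rule integral_abs_bound)
    also have "\<dots> \<le> 1 * (1 / real (Suc n))" using \<phi>close[of q n] by simp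
    finally show "norm ((\<integral>x. \<phi> n x \<partial>q) - (\<integral>x. \<psi> x \<partial>q)) \<le> 1 * (1 / real (Suc n))" .
  qed
  have 2: "(\<lambda>n. \<integral>x. exp (\<phi> n x) \<partial>p) \<longlonglongrightarrow> (\<integral>x. exp (\<psi> x) \<partial>p)"
  proof (rule LIM_zero_cancel, rule Lim_null_comparison[OF always_eventually l0[of "exp c"]], rule allI)
    fix n
    have "norm ((\<integral>x. exp (\<phi> n x) \<partial>p) - (\<integral>x. exp (\<psi> x) \<partial>p)) = \<bar>\<integral>x. exp (\<phi> n x) - exp (\<psi> x) \<partial>p\<bar>" using ep by simp
    also have "\<dots> \<le> (\<integral>x. \<bar>exp (\<phi> n x) - exp (\<psi> x)\<bar> \<partial>p)" by (rule integral_abs_bound)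
    also have "\<dots> \<le> (\<integral>x. exp c * \<bar>\<phi> n x - \<psi> x\<bar> \<partial>p)"
      using ep ip exp_diff_le[OF \<phi>b c] by (intro integral_mono) auto
    also have "\<dots> \<le> exp c * (1 / real (Suc n))" using ip mult_left_mono[OF \<phi>close[of p n], of "exp c"] by simp
    finally show "norm ((\<integral>x. exp (\<phi> n x) \<partial>p) - (\<integral>x. exp (\<psi> x) \<partial>p)) \<le> exp c * (1 / real (Suc n))" .
  qed
  have "(\<integral>x. exp (- c) \<partial>p) \<le> (\<integral>x. exp (\<psi> x) \<partial>p)"
    using c by (intro integral_mono ep) (auto simp: abs_le_iff minus_le_iff)
  then have "0 < (\<integral>x. exp (\<psi> x) \<partial>p)"
    using exp_gt_zero[of "- c"] by (simp add: p.prob_space del: exp_gt_zero)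
  then have "(\<lambda>n. ln (\<integral>x. exp (\<phi> n x) \<partial>p) + C) \<longlonglongrightarrow> ln (\<integral>x. exp (\<psi> x) \<partial>p) + C"
    using 2 by (intro tendsto_intros) auto
  with 1 show ?thesis by (rule LIMSEQ_le) (use bound[OF \<phi>c \<phi>b] in auto)
qed

section \<open>Invariant kernels, adjoints and transport cost\<close>

text \<open>
  The variable \<open>Xi (x, \<omega>)\<close> stands for the terminal value of the solution started at \<open>x\<close>, in a
  version that is jointly measurable.
\<close>
locale invariant_kernel =
  M: prob_space M + \<mu>: prob_space \<mu>
  for M :: "'a measure" and \<mu> :: "real measure" +
  fixes Xi :: "real \<times> 'a \<Rightarrow> real" and P :: "(real \<Rightarrow> real) \<Rightarrow> real \<Rightarrow> real"
  assumes sets_\<mu>: "sets \<mu> = sets borel"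
    and Xi_measurable: "Xi \<in> borel_measurable (borel \<Otimes>\<^sub>M M)"
    and P_eq: "\<And>g x. g \<in> borel_measurable borel \<Longrightarrow> P g x = (\<integral>\<omega>. g (Xi (x, \<omega>)) \<partial>M)"
    and subinvariant: "\<And>g. g \<in> borel_measurable borel \<Longrightarrow> bounded (range g) \<Longrightarrow> (\<And>x. 0 \<le> g x) \<Longrightarrow> (\<integral>x. P g x \<partial>\<mu>) \<le> (\<integral>x. g x \<partial>\<mu>)"
begin

declare Xi_measurable[measurable]

interpretation PM: pair_prob_space \<mu> M ..

lemma measurable_\<mu>_cong [measurable_cong]: "sets \<mu> = sets borel" by (rule sets_\<mu>)

lemma space_\<mu>: "space \<mu> = UNIV" using sets_eq_imp_space_eq[OF sets_\<mu>] by simp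

lemma P_measurable:
  assumes [measurable]: "g \<in> borel_measurable borel"
  shows "P g \<in> borel_measurable borel"
proof -
  have "(\<lambda>x. \<integral>\<omega>. g (Xi (x, \<omega>)) \<partial>M) \<in> borel_measurable borel"
    by (rule M.borel_measurable_lebesgue_integral) (simp add: case_prod_beta')
  then show ?thesis using P_eq[OF assms] by (simp cong: measurable_cong)
qed

lemma P_integral:
  assumes [measurable]: "g \<in> borel_measurable borel" "f \<in> borel_measurable borel"
    and i: "integrable (\<mu> \<Otimes>\<^sub>M M) (\<lambda>p. f (fst p) * g (Xi p))"
  shows "(\<integral>x. f x * P g x \<partial>\<mu>) = (\<integral>p. f (fst p) * g (Xi p) \<partial>(\<mu> \<Otimes>\<^sub>M M))"
    and "integrable \<mu> (\<lambda>x. f x * P g x)"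
proof -
  have e: "(\<integral>\<omega>. f x * g (Xi (x, \<omega>)) \<partial>M) = f x * P g x" for x
    using P_eq[OF assms(1)] by simp
  have i': "integrable (\<mu> \<Otimes>\<^sub>M M) (case_prod (\<lambda>x \<omega>. f x * g (Xi (x, \<omega>))))"
    using i by (simp add: case_prod_beta')
  show "(\<integral>x. f x * P g x \<partial>\<mu>) = (\<integral>p. f (fst p) * g (Xi p) \<partial>(\<mu> \<Otimes>\<^sub>M M))"
    using PM.integral_fst[OF i'] unfolding e by (simp add: case_prod_beta')
  show "integrable \<mu> (\<lambda>x. f x * P g x)"
    using PM.integrable_fst[OF i'] unfolding e .
qed

lemma P_bounds:
  assumes [measurable]: "g \<in> borel_measurable borel" and g: "\<And>x. a \<le> g x" "\<And>x. g x \<le> c"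
  shows "a \<le> P g x" "P g x \<le> c"
proof -
  have "\<bar>g y\<bar> \<le> \<bar>a\<bar> + \<bar>c\<bar>" for y using g(1)[of y] g(2)[of y] by auto
  then have "integrable M (\<lambda>\<omega>. g (Xi (x, \<omega>)))"
    by (intro M.integrable_const_bound[where B="\<bar>a\<bar> + \<bar>c\<bar>"]) auto
  note i = this
  have "(\<integral>\<omega>. a \<partial>M) \<le> (\<integral>\<omega>. g (Xi (x, \<omega>)) \<partial>M)" by (rule integral_mono) (use i g in auto)
  moreover have "(\<integral>\<omega>. g (Xi (x, \<omega>)) \<partial>M) \<le> (\<integral>\<omega>. c \<partial>M)" by (rule integral_mono) (use i g in auto)
  ultimately show "a \<le> P g x" "P g x \<le> c" unfolding P_eq[OF assms(1)] by (simp_all add: M.prob_space)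
qed

text \<open>
  By subinvariance the law of \<open>Xi\<close> gives no Borel set more mass than \<open>\<mu>\<close> does. Both are
  probability measures, so the same bound for the complement forces equality.
\<close>
lemma distr_Xi: "distr (\<mu> \<Otimes>\<^sub>M M) borel Xi = \<mu>"
proof (rule measure_eqI)
  show "sets (distr (\<mu> \<Otimes>\<^sub>M M) borel Xi) = sets \<mu>" by (simp add: sets_\<mu>)
  interpret D: prob_space "distr (\<mu> \<Otimes>\<^sub>M M) borel Xi" by (rule PM.prob_space_distr) simp
  have le: "D.prob A \<le> \<mu>.prob A" if A[measurable]: "A \<in> sets borel" for A
  proof -
    have "D.prob A = (\<integral>x. indicator A x \<partial>distr (\<mu> \<Otimes>\<^sub>M M) borel Xi)" by simp
    also have "\<dots> = (\<integral>p. 1 * indicator A (Xi p) \<partial>(\<mu> \<Otimes>\<^sub>M M))"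
      by (subst integral_distr) simp_all
    also have "\<dots> = (\<integral>x. 1 * P (indicator A) x \<partial>\<mu>)"
      by (rule P_integral(1)[of "indicator A" "\<lambda>_. 1", symmetric])
         (auto intro!: PM.integrable_const_bound[where B=1] simp: indicator_def)
    also have "\<dots> \<le> (\<integral>x. indicator A x \<partial>\<mu>)"
    proof -
      have "bounded (range (indicator A :: real \<Rightarrow> real))"
        unfolding bounded_range_real_iff by (rule exI[of _ 1]) (simp add: indicator_def)
      then show ?thesis using subinvariant[of "indicator A"] by simp
    qed
    also have "\<dots> = \<mu>.prob A" by (simp add: space_\<mu>)
    finally show ?thesis .
  qed
  fix A assume "A \<in> sets (distr (\<mu> \<Otimes>\<^sub>M M) borel Xi)"
  then have A: "A \<in> sets borel" by simp
  have "D.prob (UNIV - A) \<le> \<mu>.prob (UNIV - A)" by (rule le) (use A in auto)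
  then have "\<mu>.prob A \<le> D.prob A"
    using D.prob_compl[of A] \<mu>.prob_compl[of A] A by (simp add: space_\<mu> sets_\<mu>)
  with le[OF A] have "D.prob A = \<mu>.prob A" by simp
  then show "emeasure (distr (\<mu> \<Otimes>\<^sub>M M) borel Xi) A = emeasure \<mu> A"
    by (simp add: D.emeasure_eq_measure \<mu>.emeasure_eq_measure)
qed

lemma nn_integral_Xi:
  assumes [measurable]: "g \<in> borel_measurable borel"
  shows "(\<integral>\<^sup>+p. g (Xi p) \<partial>(\<mu> \<Otimes>\<^sub>M M)) = (\<integral>\<^sup>+x. g x \<partial>\<mu>)"
  by (subst (2) distr_Xi[symmetric]) (simp add: nn_integral_distr)

lemma P_invariant:
  assumes [measurable]: "g \<in> borel_measurable borel" and g: "\<And>x. \<bar>g x\<bar> \<le> c"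
  shows "(\<integral>x. P g x \<partial>\<mu>) = (\<integral>x. g x \<partial>\<mu>)"
proof -
  have "(\<integral>x. 1 * P g x \<partial>\<mu>) = (\<integral>p. 1 * g (Xi p) \<partial>(\<mu> \<Otimes>\<^sub>M M))"
    by (rule P_integral(1)) (use g in \<open>auto intro!: PM.integrable_const_bound[where B=c]\<close>)
  also have "\<dots> = (\<integral>x. g x \<partial>distr (\<mu> \<Otimes>\<^sub>M M) borel Xi)" by (subst integral_distr) simp_all
  finally show ?thesis by (simp add: distr_Xi)
qed

context
  fixes f :: "real \<Rightarrow> real" and L :: real
  assumes f[measurable]: "f \<in> borel_measurable borel" and f_nonneg: "\<And>x. 0 \<le> f x" and f_le: "\<And>x. f x \<le> L"
    and f_int: "(\<integral>x. f x \<partial>\<mu>) = 1"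
begin

lemma integrable_f_Xi:
  assumes [measurable]: "g \<in> borel_measurable borel" and i: "integrable \<mu> g"
  shows "integrable (\<mu> \<Otimes>\<^sub>M M) (\<lambda>p. f (fst p) * g (Xi p))"
proof (rule Bochner_Integration.integrable_bound)
  have "(\<integral>\<^sup>+p. ennreal (norm (g (Xi p))) \<partial>(\<mu> \<Otimes>\<^sub>M M)) = (\<integral>\<^sup>+x. ennreal (norm (g x)) \<partial>\<mu>)"
    by (rule nn_integral_Xi[of "\<lambda>x. ennreal (norm (g x))"]) simp
  then have "integrable (\<mu> \<Otimes>\<^sub>M M) (\<lambda>p. g (Xi p))"
    using i by (simp add: integrable_iff_bounded)
  then show "integrable (\<mu> \<Otimes>\<^sub>M M) (\<lambda>p. L * g (Xi p))" by simp
  show "AE p in \<mu> \<Otimes>\<^sub>M M. norm (f (fst p) * g (Xi p)) \<le> norm (L * g (Xi p))"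
  proof (rule AE_I2)
    fix p :: "real \<times> 'a"
    have "\<bar>f (fst p)\<bar> \<le> \<bar>L\<bar>" using f_nonneg[of "fst p"] f_le[of "fst p"] by linarith
    then show "norm (f (fst p) * g (Xi p)) \<le> norm (L * g (Xi p))" by (simp add: abs_mult mult_right_mono)
  qed
qed measurable

lemma L2_integrable:
  assumes "g \<in> L2_fun \<mu>"
  shows "g \<in> borel_measurable borel" "integrable \<mu> g"
proof -
  have gm: "g \<in> borel_measurable \<mu>" and g2: "integrable \<mu> (\<lambda>x. (g x)\<^sup>2)" using assms by (auto simp: L2_fun_def)
  show "g \<in> borel_measurable borel" using gm by (simp add: sets_\<mu> cong: measurable_cong_sets)
  show "integrable \<mu> g"
  proof (rule Bochner_Integration.integrable_bound)
    show "integrable \<mu> (\<lambda>x. 1 + (g x)\<^sup>2)" using g2 by simp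
    have "\<bar>y\<bar> \<le> 1 + y\<^sup>2" for y :: real
      using sum_squares_bound[of "\<bar>y\<bar>" 1] abs_ge_zero[of y] by (simp add: add_increasing)
    then show "AE x in \<mu>. norm (g x) \<le> norm (1 + (g x)\<^sup>2)" by (auto simp: abs_le_iff)
  qed (rule gm)
qed

lemma L2_bounded:
  assumes "g \<in> borel_measurable borel" "\<And>x. \<bar>g x\<bar> \<le> c"
  shows "g \<in> L2_fun \<mu>"
proof -
  have [measurable]: "g \<in> borel_measurable borel" by fact
  have "(g x)\<^sup>2 \<le> c\<^sup>2" for x using power_mono[OF assms(2)[of x], of 2] by simp
  then show ?thesis unfolding L2_fun_def
    by (auto intro!: \<mu>.integrable_const_bound[where B="c\<^sup>2"])
qed

lemma f_P_bounds:
  assumes A[measurable]: "A \<in> sets borel"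
  shows "0 \<le> (\<integral>x. f x * P (indicator A) x \<partial>\<mu>)" "(\<integral>x. f x * P (indicator A) x \<partial>\<mu>) \<le> L * \<mu>.prob A"
proof -
  have Pb: "0 \<le> P (indicator A) x" "P (indicator A) x \<le> 1" for x
    using P_bounds[of "indicator A" 0 1 x] by (auto simp: indicator_def)
  have [measurable]: "P (indicator A) \<in> borel_measurable borel" by (rule P_measurable) simp
  have i1: "integrable \<mu> (\<lambda>x. f x * P (indicator A) x)"
    by (rule P_integral(2)[OF _ f integrable_f_Xi]) (auto intro!: \<mu>.integrable_const_bound[where B=1])
  have i2: "integrable \<mu> (P (indicator A))"
    by (rule \<mu>.integrable_const_bound[where B=1]) (use Pb in \<open>auto simp: abs_le_iff intro: order_trans[OF _ Pb(1)]\<close>)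
  show "0 \<le> (\<integral>x. f x * P (indicator A) x \<partial>\<mu>)"
    using f_nonneg Pb by (intro integral_nonneg_AE) auto
  have "(\<integral>x. f x * P (indicator A) x \<partial>\<mu>) \<le> (\<integral>x. L * P (indicator A) x \<partial>\<mu>)"
    using i1 i2 f_le Pb by (intro integral_mono mult_right_mono) auto
  also have "\<dots> = L * (\<integral>x. P (indicator A) x \<partial>\<mu>)" by simp
  also have "(\<integral>x. P (indicator A) x \<partial>\<mu>) = \<mu>.prob A"
  proof -
    have "\<bar>indicator A x :: real\<bar> \<le> 1" for x by (simp add: indicator_def)
    from P_invariant[OF _ this] show ?thesis by (simp add: space_\<mu>)
  qed
  finally show "(\<integral>x. f x * P (indicator A) x \<partial>\<mu>) \<le> L * \<mu>.prob A" .
qed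

text \<open>
  Let \<open>\<nu>\<close> be the law of \<open>Xi\<close> under the product measure weighted with \<open>f\<close>. By invariance \<open>\<nu> \<le> L * \<mu>\<close>,
  and the adjoint is the Radon-Nikodym density \<open>h0\<close> of \<open>\<nu>\<close>. It is square integrable because the
  \<open>\<mu>\<close>-integral of \<open>h0 * h0\<close> is the \<open>\<nu>\<close>-integral of \<open>h0\<close>, hence at most \<open>L\<close> times its \<open>\<mu>\<close>-integral.
\<close>
lemma adjoint_exists:
  "\<exists>h. h \<in> L2_fun \<mu> \<and> (\<forall>g\<in>L2_fun \<mu>. (\<integral>x. h x * g x \<partial>\<mu>) = (\<integral>x. f x * P g x \<partial>\<mu>))"
proof -
  let ?D = "density (\<mu> \<Otimes>\<^sub>M M) (\<lambda>p. ennreal (f (fst p)))"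
  define \<nu> where "\<nu> = distr ?D borel Xi"
  have L0: "0 \<le> L" using f_nonneg f_le order_trans by blast
  have nn\<nu>: "(\<integral>\<^sup>+x. g x \<partial>\<nu>) = (\<integral>\<^sup>+p. ennreal (f (fst p)) * g (Xi p) \<partial>(\<mu> \<Otimes>\<^sub>M M))"
    if [measurable]: "g \<in> borel_measurable borel" for g
    unfolding \<nu>_def by (subst nn_integral_distr) (auto simp: nn_integral_density)
  have \<nu>_le: "(\<integral>\<^sup>+x. g x \<partial>\<nu>) \<le> ennreal L * (\<integral>\<^sup>+x. g x \<partial>\<mu>)" if g[measurable]: "g \<in> borel_measurable borel" for g
  proof -
    have "(\<integral>\<^sup>+x. g x \<partial>\<nu>) \<le> (\<integral>\<^sup>+p. ennreal L * g (Xi p) \<partial>(\<mu> \<Otimes>\<^sub>M M))"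
      unfolding nn\<nu>[OF g] using f_le by (intro nn_integral_mono mult_right_mono ennreal_leI) auto
    also have "\<dots> = ennreal L * (\<integral>\<^sup>+x. g x \<partial>\<mu>)" using nn_integral_Xi[OF g] by (simp add: nn_integral_cmult)
    finally show ?thesis .
  qed
  have s\<nu>: "sets \<nu> = sets \<mu>" by (simp add: \<nu>_def sets_\<mu>)
  have "absolutely_continuous \<mu> \<nu>"
    unfolding absolutely_continuous_def
  proof
    fix A assume A: "A \<in> null_sets \<mu>"
    then have Ab[measurable]: "A \<in> sets borel" by (auto simp: sets_\<mu>)
    have "emeasure \<nu> A \<le> ennreal L * emeasure \<mu> A"
      using \<nu>_le[of "indicator A"] Ab s\<nu> by (simp add: sets_\<mu>)
    then show "A \<in> null_sets \<nu>" using A Ab s\<nu> by (auto simp: null_sets_def sets_\<mu>)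
  qed
  then obtain h0 where h0[measurable]: "h0 \<in> borel_measurable \<mu>" and d: "density \<mu> h0 = \<nu>"
    using \<mu>.Radon_Nikodym[OF _ s\<nu>] by blast
  have h0b: "h0 \<in> borel_measurable borel" using h0 by (simp add: sets_\<mu> cong: measurable_cong_sets)
  have fin1: "(\<integral>\<^sup>+x. h0 x \<partial>\<mu>) \<le> ennreal L"
  proof -
    have "(\<integral>\<^sup>+x. h0 x \<partial>\<mu>) = (\<integral>\<^sup>+x. 1 \<partial>\<nu>)"
      unfolding d[symmetric] by (subst nn_integral_density) auto
    also have "\<dots> \<le> ennreal L * (\<integral>\<^sup>+x. 1 \<partial>\<mu>)" by (rule \<nu>_le) simp
    finally show ?thesis by (simp add: \<mu>.emeasure_space_1)
  qed
  have "(\<integral>\<^sup>+x. h0 x * h0 x \<partial>\<mu>) = (\<integral>\<^sup>+x. h0 x \<partial>\<nu>)"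
    unfolding d[symmetric] by (subst nn_integral_density) auto
  also have "\<dots> \<le> ennreal L * (\<integral>\<^sup>+x. h0 x \<partial>\<mu>)" by (rule \<nu>_le[OF h0b])
  also have "\<dots> \<le> ennreal L * ennreal L" by (rule mult_left_mono[OF fin1]) simp
  also have "\<dots> < \<infinity>" by (simp add: ennreal_mult_less_top)
  finally have fin2: "(\<integral>\<^sup>+x. h0 x * h0 x \<partial>\<mu>) < \<infinity>" .
  define h where "h x = enn2real (h0 x)" for x
  have hm[measurable]: "h \<in> borel_measurable \<mu>" unfolding h_def by measurable
  have h_nonneg: "0 \<le> h x" for x by (simp add: h_def)
  have "(\<integral>\<^sup>+x. h0 x \<partial>\<mu>) \<noteq> \<infinity>" using fin1 by (auto simp: top_unique)
  then have "AE x in \<mu>. h0 x \<noteq> \<infinity>" by (intro nn_integral_PInf_AE h0)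
  then have ae: "AE x in \<mu>. h0 x = ennreal (h x)"
    by eventually_elim (simp add: h_def less_top)
  have "(\<integral>\<^sup>+x. ennreal (norm ((h x)\<^sup>2)) \<partial>\<mu>) = (\<integral>\<^sup>+x. h0 x * h0 x \<partial>\<mu>)"
    using ae by (intro nn_integral_cong_AE) (auto elim!: eventually_mono simp: power2_eq_square ennreal_mult h_nonneg)
  then have hL2: "h \<in> L2_fun \<mu>" unfolding L2_fun_def using fin2 by (auto simp: integrable_iff_bounded)
  have "density \<mu> (\<lambda>x. ennreal (h x)) = \<nu>"
    unfolding d[symmetric] using ae by (intro density_cong) (auto elim!: eventually_mono)
  note d' = this
  have "(\<integral>x. h x * g x \<partial>\<mu>) = (\<integral>x. f x * P g x \<partial>\<mu>)" if g: "g \<in> L2_fun \<mu>" for g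
  proof -
    note gi = L2_integrable[OF g]
    have [measurable]: "g \<in> borel_measurable borel" by (rule gi)
    have "(\<integral>x. h x * g x \<partial>\<mu>) = (\<integral>x. g x \<partial>\<nu>)"
      unfolding d'[symmetric] by (subst integral_density) (auto simp: h_nonneg)
    also have "\<dots> = (\<integral>p. f (fst p) * g (Xi p) \<partial>(\<mu> \<Otimes>\<^sub>M M))"
      unfolding \<nu>_def by (subst integral_distr) (auto simp: integral_density f_nonneg)
    also have "\<dots> = (\<integral>x. f x * P g x \<partial>\<mu>)"
      by (rule P_integral(1)[symmetric, OF gi(1) f integrable_f_Xi[OF gi]])
    finally show ?thesis .
  qed
  with hL2 show ?thesis by blast
qed

lemma adjoint_spec:
  "L2_adjoint \<mu> P f \<in> L2_fun \<mu>"
  "g \<in> L2_fun \<mu> \<Longrightarrow> (\<integral>x. L2_adjoint \<mu> P f x * g x \<partial>\<mu>) = (\<integral>x. f x * P g x \<partial>\<mu>)"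
  using someI_ex[OF adjoint_exists] unfolding L2_adjoint_def by blast+

text \<open>
  Test the adjoint with the indicators of the sets on which it is negative or exceeds \<open>L\<close>.
\<close>
lemma adjoint_bounds: "AE x in \<mu>. 0 \<le> L2_adjoint \<mu> P f x \<and> L2_adjoint \<mu> P f x \<le> L"
proof -
  let ?h = "L2_adjoint \<mu> P f"
  have hm[measurable]: "?h \<in> borel_measurable borel" and hi: "integrable \<mu> ?h"
    using L2_integrable[OF adjoint_spec(1)] by auto
  have ind: "indicator A \<in> L2_fun \<mu>" if "A \<in> sets borel" for A :: "real set"
    by (rule L2_bounded[where c=1]) (use that in \<open>auto simp: indicator_def\<close>)
  have hA: "0 \<le> (\<integral>x. ?h x * indicator A x \<partial>\<mu>)" "(\<integral>x. ?h x * indicator A x \<partial>\<mu>) \<le> L * \<mu>.prob A"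
    and iA: "integrable \<mu> (\<lambda>x. ?h x * indicator A x)" if A: "A \<in> sets borel" for A
    using f_P_bounds[OF A] adjoint_spec(2)[OF ind[OF A]] integrable_mult_indicator[OF _ hi, of A] A
    by (auto simp: sets_\<mu> mult.commute)
  have 1: "AE x in \<mu>. 0 \<le> ?h x"
  proof -
    let ?A = "{x. ?h x < 0}"
    have A[measurable]: "?A \<in> sets borel" by measurable
    have "(\<integral>x. - (?h x * indicator ?A x) \<partial>\<mu>) = 0"
    proof (rule antisym)
      show "(\<integral>x. - (?h x * indicator ?A x) \<partial>\<mu>) \<le> 0" using hA(1)[OF A] by simp
      show "0 \<le> (\<integral>x. - (?h x * indicator ?A x) \<partial>\<mu>)" by (intro integral_nonneg_AE) (auto simp: indicator_def)
    qed
    then have "AE x in \<mu>. - (?h x * indicator ?A x) = 0"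
      using iA[OF A] by (subst (asm) integral_nonneg_eq_0_iff_AE) (auto simp: indicator_def)
    then show ?thesis by eventually_elim (auto simp: indicator_def split: if_splits)
  qed
  have 2: "AE x in \<mu>. ?h x \<le> L"
  proof -
    let ?A = "{x. L < ?h x}"
    have A[measurable]: "?A \<in> sets borel" by measurable
    have iL: "integrable \<mu> (\<lambda>x. L * indicator ?A x)" by (auto simp: sets_\<mu> \<mu>.emeasure_eq_measure)
    have e: "(?h x - L) * indicator ?A x = ?h x * indicator ?A x - L * indicator ?A x" for x by (simp add: left_diff_distrib)
    have i: "integrable \<mu> (\<lambda>x. (?h x - L) * indicator ?A x)" unfolding e using iA[OF A] iL by simp
    have "(\<integral>x. (?h x - L) * indicator ?A x \<partial>\<mu>) = (\<integral>x. ?h x * indicator ?A x \<partial>\<mu>) - L * \<mu>.prob ?A"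
      unfolding e using iA[OF A] iL by (simp add: space_\<mu>)
    then have "(\<integral>x. (?h x - L) * indicator ?A x \<partial>\<mu>) \<le> 0" using hA(2)[OF A] by simp
    moreover have "0 \<le> (\<integral>x. (?h x - L) * indicator ?A x \<partial>\<mu>)" by (intro integral_nonneg_AE) (auto simp: indicator_def)
    ultimately have "(\<integral>x. (?h x - L) * indicator ?A x \<partial>\<mu>) = 0" by simp
    then have "AE x in \<mu>. (?h x - L) * indicator ?A x = 0"
      using i by (subst (asm) integral_nonneg_eq_0_iff_AE) (auto simp: indicator_def)
    then show ?thesis by eventually_elim (auto simp: indicator_def split: if_splits)
  qed
  from 1 2 show ?thesis by eventually_elim auto
qed

text \<open>
  The chain of inequalities described at the beginning, for \<open>g = h' + \<epsilon>\<close> with the truncation \<open>h'\<close>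
  of the adjoint to \<open>[0, L]\<close>. The truncation makes \<open>ln g\<close> bounded everywhere, and \<open>\<epsilon>\<close> bounds it from
  below.
\<close>
lemma entropy_cost:
  assumes C: "0 < C"
    and log_harnack: "\<And>\<psi> c x y. \<psi> \<in> borel_measurable borel \<Longrightarrow> (\<And>x. \<bar>\<psi> x\<bar> \<le> c) \<Longrightarrow>
       P \<psi> y \<le> ln (P (\<lambda>z. exp (\<psi> z)) x) + C * (x - y)\<^sup>2"
    and \<pi>: "\<pi> \<in> couplings \<mu> (density \<mu> (\<lambda>x. ennreal (f x)))"
  shows "ennreal (\<integral>x. L2_adjoint \<mu> P f x * ln (L2_adjoint \<mu> P f x) \<partial>\<mu>) \<le> ennreal C * (\<integral>\<^sup>+p. ennreal (\<bar>fst p - snd p\<bar>\<^sup>2) \<partial>\<pi>)"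
proof (cases "(\<integral>\<^sup>+p. ennreal (\<bar>fst p - snd p\<bar>\<^sup>2) \<partial>\<pi>) = \<infinity>")
  case True
  then show ?thesis using C by (simp add: ennreal_mult_top)
next
  case False
  let ?h = "L2_adjoint \<mu> P f"
  define J where "J = (\<integral>p. (fst p - snd p)\<^sup>2 \<partial>\<pi>)"
  have s\<pi>: "sets \<pi> = sets (borel \<Otimes>\<^sub>M borel)" and d1: "distr \<pi> borel fst = \<mu>"
    and d2: "distr \<pi> borel snd = density \<mu> (\<lambda>x. ennreal (f x))"
    using \<pi> by (auto simp: couplings_def)
  have [measurable]: "fst \<in> borel_measurable \<pi>" "snd \<in> borel_measurable \<pi>"
    using s\<pi> by (simp_all cong: measurable_cong_sets)
  interpret \<pi>: prob_space \<pi>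
  proof
    have "emeasure \<pi> (space \<pi>) = emeasure (distr \<pi> borel fst) UNIV" by (simp add: emeasure_distr)
    then show "emeasure \<pi> (space \<pi>) = 1" unfolding d1 using \<mu>.emeasure_space_1 by (simp add: space_\<mu>)
  qed
  have i2: "integrable \<pi> (\<lambda>p. (fst p - snd p)\<^sup>2)"
    using False by (intro integrableI_bounded) (auto simp: less_top)
  have J: "(\<integral>\<^sup>+p. ennreal (\<bar>fst p - snd p\<bar>\<^sup>2) \<partial>\<pi>) = ennreal J"
    unfolding J_def using nn_integral_eq_integral[OF i2] by simp
  have J0: "0 \<le> J" unfolding J_def by (intro integral_nonneg_AE) auto
  have L0: "0 \<le> L" using f_nonneg f_le order_trans by blast
  have hm[measurable]: "?h \<in> borel_measurable borel" and hi: "integrable \<mu> ?h"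
    using L2_integrable[OF adjoint_spec(1)] by auto
  define h' where "h' x = max 0 (min L (?h x))" for x
  have h'm[measurable]: "h' \<in> borel_measurable borel" unfolding h'_def by measurable
  have h'b: "0 \<le> h' x" "h' x \<le> L" for x using L0 by (auto simp: h'_def)
  have hh': "AE x in \<mu>. ?h x = h' x"
    using adjoint_bounds by eventually_elim (auto simp: h'_def)
  have h1: "(\<integral>x. h' x \<partial>\<mu>) = 1"
  proof -
    have "P (\<lambda>_. 1) x = 1" for x by (simp add: P_eq M.prob_space)
    moreover have "(\<lambda>_. 1) \<in> L2_fun \<mu>" by (rule L2_bounded[where c=1]) auto
    ultimately have "(\<integral>x. ?h x \<partial>\<mu>) = 1" using adjoint_spec(2)[of "\<lambda>_. 1"] f_int by simp
    moreover have "(\<integral>x. ?h x \<partial>\<mu>) = (\<integral>x. h' x \<partial>\<mu>)" by (rule integral_cong_AE) (use hh' in auto)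
    ultimately show ?thesis by simp
  qed
  have ih': "integrable \<mu> h'" by (rule \<mu>.integrable_const_bound[where B=L]) (use h'b in auto)
  have main: "(\<integral>x. ?h x * ln (?h x) \<partial>\<mu>) \<le> C * J + \<epsilon>" if \<epsilon>: "0 < \<epsilon>" for \<epsilon>
  proof -
    define g where "g x = h' x + \<epsilon>" for x
    define \<psi> where "\<psi> x = ln (g x)" for x
    define c where "c = max \<bar>ln \<epsilon>\<bar> \<bar>ln (L + \<epsilon>)\<bar>"
    have gm[measurable]: "g \<in> borel_measurable borel" unfolding g_def by measurable
    have \<psi>m[measurable]: "\<psi> \<in> borel_measurable borel" unfolding \<psi>_def by measurable
    have gb: "\<epsilon> \<le> g x" "g x \<le> L + \<epsilon>" for x using h'b[of x] by (auto simp: g_def)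
    have lnb: "\<bar>ln y\<bar> \<le> c" if "\<epsilon> \<le> y" "y \<le> L + \<epsilon>" for y
    proof -
      have "ln \<epsilon> \<le> ln y" "ln y \<le> ln (L + \<epsilon>)" using that \<epsilon> by auto
      then show ?thesis unfolding c_def by linarith
    qed
    have \<psi>b: "\<bar>\<psi> x\<bar> \<le> c" for x unfolding \<psi>_def by (rule lnb[OF gb])
    have e\<psi>: "(\<lambda>z. exp (\<psi> z)) = g"
    proof (rule ext)
      fix x show "exp (\<psi> x) = g x" unfolding \<psi>_def using gb(1)[of x] \<epsilon> by (intro exp_ln) linarith
    qed
    have P\<psi>m[measurable]: "P \<psi> \<in> borel_measurable borel" and Pgm[measurable]: "P g \<in> borel_measurable borel"
      by (auto intro: P_measurable)
    have Pgb: "\<epsilon> \<le> P g x" "P g x \<le> L + \<epsilon>" for x using P_bounds[OF gm gb] by auto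
    have P\<psi>b: "\<bar>P \<psi> x\<bar> \<le> c" for x
    proof -
      have "- c \<le> \<psi> y" "\<psi> y \<le> c" for y using \<psi>b[of y] by auto
      from P_bounds[OF \<psi>m this] show ?thesis by (simp add: abs_le_iff minus_le_iff)
    qed
    have "(\<integral>x. ?h x * ln (?h x) \<partial>\<mu>) = (\<integral>x. h' x * ln (h' x) \<partial>\<mu>)"
      by (rule integral_cong_AE) (use hh' in auto)
    also have "\<dots> \<le> (\<integral>x. h' x * \<psi> x \<partial>\<mu>)"
    proof (rule integral_mono)
      show "integrable \<mu> (\<lambda>x. h' x * \<psi> x)"
      proof (rule \<mu>.integrable_const_bound[where B="L * c"])
        show "AE x in \<mu>. norm (h' x * \<psi> x) \<le> L * c"
          using h'b \<psi>b L0 by (intro AE_I2) (auto simp: abs_mult intro!: mult_mono)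
      qed measurable
      show "integrable \<mu> (\<lambda>x. h' x * ln (h' x))"
      proof (rule \<mu>.integrable_const_bound[where B="1 + L\<^sup>2"])
        show "AE x in \<mu>. norm (h' x * ln (h' x)) \<le> 1 + L\<^sup>2"
        proof (rule AE_I2)
          fix x
          show "norm (h' x * ln (h' x)) \<le> 1 + L\<^sup>2"
          proof (cases "h' x = 0")
            case False
            then have p: "0 < h' x" using h'b(1)[of x] by simp
            have "ln (h' x) \<le> h' x" using ln_le_minus_one[OF p] by simp
            then have "h' x * ln (h' x) \<le> h' x * h' x" using p by (intro mult_left_mono) auto
            also have "\<dots> \<le> L * L" using h'b[of x] by (intro mult_mono) auto
            finally have u: "h' x * ln (h' x) \<le> L\<^sup>2" by (simp add: power2_eq_square)
            have "- ln (h' x) \<le> 1 / h' x - 1" using ln_le_minus_one[of "1 / h' x"] p by (simp add: ln_div)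
            then have "h' x * (- ln (h' x)) \<le> h' x * (1 / h' x - 1)" using p by (intro mult_left_mono) auto
            then have "- (h' x * ln (h' x)) \<le> 1" using p by (simp add: right_diff_distrib)
            with u show ?thesis using zero_le_power2[of L] unfolding real_norm_def by linarith
          qed (simp add: add_nonneg_nonneg)
        qed
      qed measurable
      show "h' x * ln (h' x) \<le> h' x * \<psi> x" for x
      proof (cases "h' x = 0")
        case False
        then have p: "0 < h' x" using h'b(1)[of x] by simp
        then show ?thesis unfolding \<psi>_def g_def using \<epsilon> by (intro mult_left_mono) auto
      qed simp
    qed
    also have "\<dots> = (\<integral>x. ?h x * \<psi> x \<partial>\<mu>)"
      by (rule integral_cong_AE) (use hh' in auto)
    also have "\<dots> = (\<integral>x. f x * P \<psi> x \<partial>\<mu>)"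
      by (rule adjoint_spec(2)[OF L2_bounded[OF \<psi>m \<psi>b]])
    also have "\<dots> = (\<integral>x. P \<psi> x \<partial>density \<mu> (\<lambda>x. ennreal (f x)))"
      by (subst integral_density) (auto simp: f_nonneg)
    also have "\<dots> = (\<integral>p. P \<psi> (snd p) \<partial>\<pi>)"
      unfolding d2[symmetric] by (subst integral_distr) simp_all
    also have "\<dots> \<le> (\<integral>p. ln (P g (fst p)) + C * (fst p - snd p)\<^sup>2 \<partial>\<pi>)"
    proof (rule integral_mono)
      show "integrable \<pi> (\<lambda>p. P \<psi> (snd p))"
        by (rule \<pi>.integrable_const_bound[where B=c]) (use P\<psi>b in auto)
      have "integrable \<pi> (\<lambda>p. ln (P g (fst p)))"
        by (rule \<pi>.integrable_const_bound[where B=c]) (use lnb[OF Pgb] in auto)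
      then show "integrable \<pi> (\<lambda>p. ln (P g (fst p)) + C * (fst p - snd p)\<^sup>2)" using i2 by simp
      show "P \<psi> (snd p) \<le> ln (P g (fst p)) + C * (fst p - snd p)\<^sup>2" for p
        using log_harnack[OF \<psi>m \<psi>b, of "snd p" "fst p"] unfolding e\<psi> .
    qed
    also have "\<dots> = (\<integral>p. ln (P g (fst p)) \<partial>\<pi>) + C * J"
    proof -
      have "integrable \<pi> (\<lambda>p. ln (P g (fst p)))"
        by (rule \<pi>.integrable_const_bound[where B=c]) (use lnb[OF Pgb] in auto)
      then show ?thesis using i2 by (simp add: J_def)
    qed
    also have "(\<integral>p. ln (P g (fst p)) \<partial>\<pi>) = (\<integral>x. ln (P g x) \<partial>\<mu>)"
      unfolding d1[symmetric] by (subst integral_distr) simp_all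
    also have "(\<integral>x. ln (P g x) \<partial>\<mu>) \<le> \<epsilon>"
    proof -
      have el: "exp (ln (P g x)) = P g x" for x using Pgb(1)[of x] \<epsilon> by (intro exp_ln) linarith
      have "exp (\<integral>x. ln (P g x) \<partial>\<mu>) \<le> (\<integral>x. exp (ln (P g x)) \<partial>\<mu>)"
      proof (rule \<mu>.expectation_exp_ge)
        show "integrable \<mu> (\<lambda>x. ln (P g x))"
          by (rule \<mu>.integrable_const_bound[where B=c]) (use lnb[OF Pgb] in auto)
        have "\<bar>P g x\<bar> \<le> L + \<epsilon>" for x using Pgb[of x] \<epsilon> by auto
        then show "integrable \<mu> (\<lambda>x. exp (ln (P g x)))"
          unfolding el by (intro \<mu>.integrable_const_bound[where B="L + \<epsilon>"]) auto
      qed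
      also have "\<dots> = (\<integral>x. P g x \<partial>\<mu>)" unfolding el ..
      also have "\<dots> = (\<integral>x. g x \<partial>\<mu>)"
      proof (rule P_invariant[OF gm])
        show "\<bar>g x\<bar> \<le> L + \<epsilon>" for x using gb[of x] \<epsilon> by auto
      qed
      also have "\<dots> = 1 + \<epsilon>" unfolding g_def using ih' h1 by (simp add: \<mu>.prob_space)
      also have "\<dots> \<le> exp \<epsilon>" by (rule exp_ge_add_one_self)
      finally show ?thesis by simp
    qed
    finally show ?thesis by simp
  qed
  have "(\<integral>x. ?h x * ln (?h x) \<partial>\<mu>) \<le> C * J"
    by (rule field_le_epsilon) (rule main)
  then have "ennreal (\<integral>x. ?h x * ln (?h x) \<partial>\<mu>) \<le> ennreal (C * J)" by (rule ennreal_leI)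
  then show ?thesis unfolding J using C J0 by (simp add: ennreal_mult)
qed

end

end

section \<open>The entropy-cost inequality\<close>

lemma lipschitz_drift_extend:
  fixes b :: "real \<Rightarrow> real \<Rightarrow> real" and K T :: real
  assumes b_borel: "(\<lambda>p. b (fst p) (snd p)) \<in> borel_measurable (restrict_space borel ({0..T} \<times> UNIV))"
    and K: "0 < K"
    and b_Lipschitz: "\<forall>t\<in>{0..T}. \<forall>x y. \<bar>b t x - b t y\<bar> \<le> K * \<bar>x - y\<bar>"
    and b_bounded: "bounded ((\<lambda>t. b t 0) ` {0..T})"
  obtains c0 where "lipschitz_drift (\<lambda>t x. indicator {0..T} t * b t x) K c0"
proof -
  obtain c where "\<forall>y\<in>(\<lambda>t. b t 0) ` {0..T}. norm y \<le> c" using b_bounded unfolding bounded_iff by blast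
  then have c: "\<bar>b t 0\<bar> \<le> c" if "t \<in> {0..T}" for t using that by auto
  have "lipschitz_drift (\<lambda>t x. indicator {0..T} t * b t x) K \<bar>c\<bar>"
  proof
    have "(\<lambda>p. indicator ({0..T} \<times> UNIV) p *\<^sub>R b (fst p) (snd p)) \<in> borel_measurable borel"
      using b_borel by (subst (asm) borel_measurable_restrict_space_iff) (auto intro!: borel_closed closed_Times)
    moreover have "(\<lambda>p. indicator ({0..T} \<times> UNIV) p *\<^sub>R b (fst p) (snd p)) = (\<lambda>p. indicator {0..T} (fst p) * b (fst p) (snd p))"
      by (auto simp: fun_eq_iff indicator_def)
    ultimately show "(\<lambda>p. indicator {0..T} (fst p) * b (fst p) (snd p)) \<in> borel_measurable (borel \<Otimes>\<^sub>M borel)"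
      by (simp add: borel_prod)
    show "\<bar>indicator {0..T} t * b t x - indicator {0..T} t * b t y\<bar> \<le> K * \<bar>x - y\<bar>" for t x y
      using b_Lipschitz K by (cases "t \<in> {0..T}") auto
    show "\<bar>indicator {0..T} t * b t 0\<bar> \<le> \<bar>c\<bar>" for t
      using c[of t] by (cases "t \<in> {0..T}") auto
  qed (rule K)
  then show ?thesis by (rule that)
qed

lemma sde_solution_extend:
  assumes "sde_solution M F T b B x X"
  shows "sde_solution M F T (\<lambda>t x. indicator {0..T} t * b t x) B x X"
proof -
  have "(LINT s:{0..t}|lborel. indicator {0..T} s * b s (X s \<omega>)) = (LINT s:{0..t}|lborel. b s (X s \<omega>))" if "t \<in> {0..T}" for t \<omega>
    unfolding set_lebesgue_integral_def
    using that by (intro Bochner_Integration.integral_cong) (auto simp: indicator_def)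
  then show ?thesis using assms unfolding sde_solution_def by (auto elim!: eventually_mono)
qed

text \<open>
  After \<open>drift_constant_bound\<close> this is an identity: the factor 4 from the square of \<open>2 * K\<close> cancels
  one factor 2 of \<open>2 - 2 * H\<close> and the final division by 2.
\<close>
lemma cost_constant_bound:
  fixes H T K \<beta> d :: real
  assumes H: "0 < H" "H < 1/2" and T: "0 < T" and K: "0 < K"
  shows "((K + 1 / T) * \<bar>d\<bar> * \<beta>)\<^sup>2 * (T powr (2 - 2 * H) / (2 - 2 * H)) / 2
     \<le> \<beta>\<^sup>2 * (T powr (2 - 2 * H) / (inverse (K\<^sup>2) * (1 - exp (- 2 * K * T))\<^sup>2 * (1 - H))) * d\<^sup>2"
proof -
  define E where "E = 1 - exp (- 2 * K * T)"
  have E: "0 < E" using K T by (simp add: E_def)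
  have "(K + 1 / T)\<^sup>2 \<le> (2 * K / E)\<^sup>2"
    unfolding E_def using drift_constant_bound[OF K T] K T by (intro power_mono) auto
  then have "(K + 1 / T)\<^sup>2 * (d\<^sup>2 * \<beta>\<^sup>2 * (T powr (2 - 2 * H) / (2 - 2 * H)) / 2)
      \<le> (2 * K / E)\<^sup>2 * (d\<^sup>2 * \<beta>\<^sup>2 * (T powr (2 - 2 * H) / (2 - 2 * H)) / 2)"
    using H by (intro mult_right_mono) (auto intro!: mult_nonneg_nonneg divide_nonneg_nonneg)
  also have "\<dots> = \<beta>\<^sup>2 * (T powr (2 - 2 * H) / (inverse (K\<^sup>2) * E\<^sup>2 * (1 - H))) * d\<^sup>2"
  proof -
    have h: "2 - 2 * H = 2 * (1 - H)" by simp
    have nz: "K \<noteq> 0" "E \<noteq> 0" "1 - H \<noteq> 0" using E K H by auto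
    have "(2 * k / e)\<^sup>2 * (x * y * (z / (2 * g)) / 2) = y * (z / (inverse (k\<^sup>2) * e\<^sup>2 * g)) * x"
      if "k \<noteq> 0" "e \<noteq> 0" "g \<noteq> 0" for k e g x y z :: real
      using that by (simp add: field_simps power2_eq_square)
    from this[OF nz] show ?thesis unfolding h .
  qed
  finally show ?thesis unfolding E_def by (simp add: power_mult_distrib mult_ac)
qed

theorem corollary3p6:
  fixes H T K :: real
    and b :: "real \<Rightarrow> real \<Rightarrow> real"
    and M :: "'a measure" and F :: "real \<Rightarrow> 'a measure"
    and W B :: "real \<Rightarrow> 'a \<Rightarrow> real"
    and X :: "real \<Rightarrow> real \<Rightarrow> 'a \<Rightarrow> real"
    and \<mu> :: "real measure"
    and f :: "real \<Rightarrow> real"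
  assumes H: "0 < H" "H < 1/2"
    and T: "0 < T"
    and b_borel: "(\<lambda>p. b (fst p) (snd p)) \<in> borel_measurable (restrict_space borel ({0..T} \<times> UNIV))"
    and K: "0 < K"
    and b_Lipschitz: "\<forall>t\<in>{0..T}. \<forall>x y. \<bar>b t x - b t y\<bar> \<le> K * \<bar>x - y\<bar>"
    and b_bounded: "bounded ((\<lambda>t. b t 0) ` {0..T})"
    and M: "filtered_prob_space M F T"
    and B: "fractional_brownian_motion M F T H W B"
    and X: "\<forall>x. sde_solution M F T b B x (X x)"
    and \<mu>: "prob_space \<mu>" "sets \<mu> = sets borel"
    and \<mu>_P: "\<forall>g. g \<in> borel_measurable borel \<and> bounded (range g) \<and> (\<forall>x. 0 \<le> g x) \<longrightarrow>
                (\<integral>x. transition_op M X T g x \<partial>\<mu>) \<le> (\<integral>x. g x \<partial>\<mu>)"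
    and f: "f \<in> borel_measurable borel" "bounded (range f)" "\<forall>x. 0 \<le> f x" "(\<integral>x. f x \<partial>\<mu>) = 1"
  shows "ereal (\<integral>x. L2_adjoint \<mu> (transition_op M X T) f x *
                    ln (L2_adjoint \<mu> (transition_op M X T) f x) \<partial>\<mu>)
         \<le> ereal ((Beta (3/2 - H) (1/2 - H) / Gamma (1/2 - H))\<^sup>2 *
                    (T powr (2 - 2 * H) /
                       (inverse (K\<^sup>2) * (1 - exp (- 2 * K * T))\<^sup>2 * (1 - H)))) *
            enn2ereal (wasserstein2_sq \<mu> (density \<mu> (\<lambda>x. ennreal (f x))))"
proof -
  define \<beta> where "\<beta> = Beta (3/2 - H) (1/2 - H) / Gamma (1/2 - H)"
  define C where "C = \<beta>\<^sup>2 * (T powr (2 - 2 * H) / (inverse (K\<^sup>2) * (1 - exp (- 2 * K * T))\<^sup>2 * (1 - H)))"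
  define b' where "b' = (\<lambda>t x. indicator {0..T} t * b t x)"
  let ?P = "transition_op M X T"
  let ?h = "L2_adjoint \<mu> ?P f"
  interpret prob_space M using M by (simp add: filtered_prob_space_def)
  obtain c0 where "lipschitz_drift b' K c0"
    using lipschitz_drift_extend[OF b_borel K b_Lipschitz b_bounded] unfolding b'_def by blast
  then interpret lipschitz_drift b' K c0 .
  have sol: "sde_solution M F T b' B x (X x)" for x
    unfolding b'_def using X by (intro sde_solution_extend) auto
  have XT: "X x T \<in> borel_measurable M" for x
    using sol[of x] M T by (auto intro!: measurable_from_subalg[of M "F T"] simp: sde_solution_def adapted_def filtered_prob_space_def)
  have BmM: "B t \<in> borel_measurable M" if "t \<in> {0..T}" for t
    using B that by (auto simp: fractional_brownian_motion_def has_wiener_integral_def)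
  have \<beta>: "0 < \<beta>" unfolding \<beta>_def Beta_def using H by (intro divide_pos_pos mult_pos_pos Gamma_real_pos) auto
  have C: "0 < C" unfolding C_def using \<beta> H T K by (auto intro!: mult_pos_pos divide_pos_pos)
  \<comment> \<open>The limit of the Euler schemes is jointly measurable in the starting point and \<open>\<omega>\<close>, and it is a
     version of \<open>X x T\<close> for every \<open>x\<close>.\<close>
  define Xi where "Xi p = lim (\<lambda>n. euler b' (T / real n) (fst p) (\<lambda>i. B (real i * (T / real n)) (snd p)) n)" for p
  have Xim: "Xi \<in> borel_measurable (borel \<Otimes>\<^sub>M M)"
    unfolding Xi_def[abs_def]
  proof (rule borel_measurable_lim_metric)
    fix n
    have "real i * (T / real n) \<in> {0..T}" if "i \<le> n" for i
    proof -
      have "real i * (T / real n) \<le> real n * (T / real n)" using that T by (intro mult_right_mono) auto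
      also have "\<dots> \<le> T" using T by (cases "n = 0") auto
      finally show ?thesis using T by simp
    qed
    then show "(\<lambda>p. euler b' (T / real n) (fst p) (\<lambda>i. B (real i * (T / real n)) (snd p)) n) \<in> borel_measurable (borel \<Otimes>\<^sub>M M)"
      using T by (intro borel_measurable_euler measurable_compose[OF measurable_snd BmM]) auto
  qed
  have XiX: "AE \<omega> in M. X x T \<omega> = Xi (x, \<omega>)" for x
    using solution_euler_limit[OF T sol[of x]] by eventually_elim (simp add: Xi_def limI)
  have P_eq: "?P g x = (\<integral>\<omega>. g (Xi (x, \<omega>)) \<partial>M)" if [measurable]: "g \<in> borel_measurable borel" for g x
    unfolding transition_op_def
  proof (rule integral_cong_AE)
    show "(\<lambda>\<omega>. g (X x T \<omega>)) \<in> borel_measurable M" using XT[of x] by measurable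
    show "(\<lambda>\<omega>. g (Xi (x, \<omega>))) \<in> borel_measurable M"
      by (rule measurable_compose[OF measurable_compose[OF _ Xim] that]) measurable
    show "AE \<omega> in M. g (X x T \<omega>) = g (Xi (x, \<omega>))" using XiX[of x] by eventually_elim simp
  qed
  interpret \<mu>: prob_space \<mu> by (rule \<mu>)
  interpret invariant_kernel M \<mu> Xi ?P
    by unfold_locales (use \<mu>(2) Xim P_eq \<mu>_P in auto)
  obtain L where L: "\<And>x. f x \<le> L" using f(2,3) unfolding bounded_range_real_iff by (metis abs_of_nonneg)
  have log_harnack: "?P \<psi> y \<le> ln (?P (\<lambda>z. exp (\<psi> z)) x) + C * (x - y)\<^sup>2"
    if \<psi>[measurable]: "\<psi> \<in> borel_measurable borel" and c: "\<And>x. \<bar>\<psi> x\<bar> \<le> c" for \<psi> c x y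
  proof -
    have [measurable]: "X x T \<in> borel_measurable M" "X y T \<in> borel_measurable M" by (rule XT)+
    have "(\<integral>z. \<psi> z \<partial>distr M borel (X y T)) \<le> ln (\<integral>z. exp (\<psi> z) \<partial>distr M borel (X x T)) + C * (x - y)\<^sup>2"
    proof (rule entropy_bound_borel[OF _ _ _ _ _ \<psi> c])
      show "prob_space (distr M borel (X x T))" "prob_space (distr M borel (X y T))" by (auto intro: prob_space_distr)
      fix \<phi> :: "real \<Rightarrow> real" and k assume \<phi>: "continuous_on UNIV \<phi>" "\<And>x. \<bar>\<phi> x\<bar> \<le> k"
      have [measurable]: "\<phi> \<in> borel_measurable borel" using \<phi>(1) by (rule borel_measurable_continuous_onI)
      have "(\<integral>\<omega>. \<phi> (X y T \<omega>) \<partial>M) \<le> ln (\<integral>\<omega>. exp (\<phi> (X x T \<omega>)) \<partial>M)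
         + ((K + 1 / T) * \<bar>x - y\<bar> * \<beta>)\<^sup>2 * (T powr (2 - 2 * H) / (2 - 2 * H)) / 2"
        unfolding \<beta>_def by (rule solution_entropy_bound[OF H T M B sol sol \<phi>])
      also have "\<dots> \<le> ln (\<integral>\<omega>. exp (\<phi> (X x T \<omega>)) \<partial>M) + C * (x - y)\<^sup>2"
        using cost_constant_bound[OF H T K, of "x - y" \<beta>] unfolding C_def by simp
      finally show "(\<integral>z. \<phi> z \<partial>distr M borel (X y T)) \<le> ln (\<integral>z. exp (\<phi> z) \<partial>distr M borel (X x T)) + C * (x - y)\<^sup>2"
        by (simp add: integral_distr)
    qed auto
    then show ?thesis by (simp add: integral_distr transition_op_def)
  qed
  let ?E = "\<integral>x. ?h x * ln (?h x) \<partial>\<mu>"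
  let ?W = "wasserstein2_sq \<mu> (density \<mu> (\<lambda>x. ennreal (f x)))"
  \<comment> \<open>Divided by \<open>C\<close>, the bound holds for every coupling, hence for the infimum.\<close>
  have "ennreal ?E / ennreal C \<le> ?W"
    unfolding wasserstein2_sq_def
  proof (rule INF_greatest)
    fix \<pi> assume \<pi>: "\<pi> \<in> couplings \<mu> (density \<mu> (\<lambda>x. ennreal (f x)))"
    have "ennreal ?E \<le> ennreal C * (\<integral>\<^sup>+p. ennreal (\<bar>fst p - snd p\<bar>\<^sup>2) \<partial>\<pi>)"
    proof (rule entropy_cost[OF f(1) _ L f(4) C _ \<pi>])
      show "0 \<le> f x" for x using f(3) by simp
    qed (rule log_harnack)
    then show "ennreal ?E / ennreal C \<le> (\<integral>\<^sup>+p. ennreal (\<bar>fst p - snd p\<bar>\<^sup>2) \<partial>\<pi>)"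
      using C by (intro divide_le_posI_ennreal) auto
  qed
  then have "ennreal C * (ennreal ?E / ennreal C) \<le> ennreal C * ?W" by (rule mult_left_mono) simp
  moreover have "ennreal C * (ennreal ?E / ennreal C) = ennreal ?E"
    unfolding ennreal_times_divide mult.commute[of "ennreal C"] using C by (intro mult_divide_eq_ennreal) auto
  ultimately have le: "ennreal ?E \<le> ennreal C * ?W" by simp
  have "ereal ?E \<le> enn2ereal (ennreal ?E)"
    by (cases "0 \<le> ?E") (auto simp: enn2ereal_ennreal ennreal_neg zero_ennreal.rep_eq)
  also have "\<dots> \<le> enn2ereal (ennreal C * ?W)" using le by (simp add: less_eq_ennreal.rep_eq)
  also have "\<dots> = ereal C * enn2ereal ?W" using C by (simp add: times_ennreal.rep_eq enn2ereal_ennreal)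
  finally show ?thesis unfolding C_def \<beta>_def .
qed

end
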